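(* Let $(T_n)_{n\in\mathbb{N}}$ be a sequence of nontrivial finite trees that is convergent in metric sampling, that is, for every $r\ge 1$ the sequence of measures $(\tau_r(T_n))_{n\in\mathbb{N}}$ converges weakly in $\mathrm{Prob}(M_r)$. Then there exists a dendron $D$ (the sampling limit of $(T_n)_{n\in\mathbb{N}}$) such that, for all positive integers $r$, the sampling measures $\tau_r(T_n)$ weakly converge to $\tau_r(D)$.
   Context: $\mathbb{N}$ is the set of positive integers. A finite (graph-theoretic) tree is identified with its vertex set and is nontrivial if it has at least two vertices. For a nontrivial finite tree $T$ with shortest path metric $\overline{d}_T$, the normalized distance is $d_T(x,y)=\overline{d}_T(x,y)/\mathrm{diam}_{\overline{d}_T}(T)$, and $\mu_T$ is the uniform probability measure on $T$. Sampling measures. For $r\ge1$, $M_r$ is the space of real $r\times r$ matrices, identified with $\prod_{1\le i,j\le r}\mathbb{R}$; $\mathrm{Prob}(M_r)$ is the space of Borel probability measures on $M_r$. For a set $X$ and $d:X^2\to\mathbb{R}$, define $\rho_r^{X,d}:X^r\to M_r$ by $\rho_r^{X,d}(x_1,\dots,x_r)=(d_{ij})$, with $d_{ij}=d(x_i,x_j)$ for $i\ne j$ and $d_{ii}=0$. For a triple $(X,d,\mu)$ with $\mu$ a probability measure on $X$ and $d$ a $\mu^2$-measurable function, $\tau_r(X,d,\mu)\in\mathrm{Prob}(M_r)$ is the push-forward of $\mu^r$ along $\rho_r^{X,d}$. For a nontrivial finite tree, $\tau_r(T)=\tau_r(T,d_T,\mu_T)$. Real trees. A real tree is a non-empty complete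 metric space $(T,d)$ such that for any two distinct points $p,q\in T$ there is an isometric embedding $\alpha:[a,b]\to T$ of an interval with $\alpha(a)=p$, $\alpha(b)=q$ and such that for every $a<c<b$ the points $p$ and $q$ are in distinct connected components of $T\setminus\{\alpha(c)\}$. For $p\in T$ the connected components of $T\setminus\{p\}$ are the $p$-branches; a branch of $T$ is a $p$-branch for some $p\in T$. Dendrons. A long dendron $D=(T,d,\nu)$ is a real tree $(T,d)$ together with a Borel probability measure $\nu$ on $A_D=T\times[0,\infty)$ (product topology) satisfying $\nu(B\times[0,\infty))>0$ for all branches $B$ of $T$. Define $d_D:A_D^2\to\mathbb{R}$ by $d_D((u,a),(v,b))=d(u,v)+a+b$. A long dendron $D$ is a dendron if $\nu^2(\{(x,y)\in A_D^2\mid d_D(x,y)>1\})=0$. For a long dendron, $\tau_r(D)=\tau_r(A_D,d_D,\nu)$. *)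

theory Defs
  imports
    "Graph_Theory.Pair_Digraph"
    "Graph_Theory.Digraph_Component"
    "Graph_Theory.Shortest_Path"
    "HOL-Probability.Probability"
begin

section \<open>Finite trees\<close>

text \<open>
  A finite simple graph is a \<open>pair_graph\<close>: a finite loop-free digraph with symmetric arc set.
  An undirected edge is therefore a pair of opposite arcs, which is itself a directed cycle of
  length two; the predicate \<open>tree\<close> of the graph library rejects these, so acyclicity is stated
  for cycles of length at least three, the cycles of the undirected graph.
\<close>

definition finite_tree :: "'a pair_pre_digraph \<Rightarrow> bool" where
  "finite_tree T \<longleftrightarrow>
     pair_graph T \<and> Digraph_Component.connected (with_proj T) \<and>
     \<not> (\<exists>p. pre_digraph.cycle (with_proj T) p \<and> 3 \<le> length p)"

definition nontrivial_tree :: "'a pair_pre_digraph \<Rightarrow> bool" where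
  "nontrivial_tree T \<longleftrightarrow> finite_tree T \<and> 2 \<le> card (pverts T)"

text \<open>The library's minimal walk cost, with every arc having cost 1.\<close>

definition tree_path_dist :: "'a pair_pre_digraph \<Rightarrow> 'a \<Rightarrow> 'a \<Rightarrow> real" where
  "tree_path_dist T u v = real_of_ereal (wf_digraph.\<mu> (with_proj T) (\<lambda>_. 1) u v)"

lemma tree_path_dist_eq_Least:
  assumes "finite_tree T" "u \<in> pverts T" "v \<in> pverts T"
  shows "tree_path_dist T u v =
    real (LEAST n. \<exists>p. pre_digraph.awalk (with_proj T) u p v \<and> length p = n)"
proof -
  interpret pair_graph T using assms(1) by (simp add: finite_tree_def)
  have "mk_symmetric (with_proj T) = T"
  proof -
    have "(\<Union>e\<in>parcs T. {(fst e, snd e), (snd e, fst e)}) = parcs T"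
      using pair_sym_arcs by (auto simp: symmetric_def dest: symD)
    then show ?thesis by (simp add: mk_symmetric_def)
  qed
  then have "u \<rightarrow>\<^sup>*\<^bsub>with_proj T\<^esub> v"
    using assms by (simp add: finite_tree_def Digraph_Component.connected_def strongly_connected_def)
  then obtain p0 where p0: "awalk u p0 v"
    using reachable_awalk by auto
  let ?P = "\<lambda>n. \<exists>p. awalk u p v \<and> length p = n"
  have cost: "awalk_cost (\<lambda>_. 1) p = real (length p)" for p
    by (induction p) auto
  obtain q where q: "awalk u q v" "length q = (LEAST n. ?P n)"
    using LeastI_ex[of ?P] p0 by blast
  have "\<mu> (\<lambda>_. 1) u v = ereal (real (LEAST n. ?P n))"
    unfolding \<mu>_def cost
  proof (rule INF_eqI)
    fix p assume "p \<in> {p. awalk u p v}"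
    then show "ereal (real (LEAST n. ?P n)) \<le> ereal (real (length p))"
      by (auto intro: Least_le)
  next
    fix y assume "\<And>i. i \<in> {p. awalk u p v} \<Longrightarrow> y \<le> ereal (real (length i))"
    from this[of q] q show "y \<le> ereal (real (LEAST n. ?P n))" by simp
  qed
  then show ?thesis by (simp add: tree_path_dist_def)
qed

definition tree_diam :: "'a pair_pre_digraph \<Rightarrow> real" where
  "tree_diam T = (MAX (u, v) \<in> pverts T \<times> pverts T. tree_path_dist T u v)"

definition tree_dist :: "'a pair_pre_digraph \<Rightarrow> 'a \<Rightarrow> 'a \<Rightarrow> real" where
  "tree_dist T u v = tree_path_dist T u v / tree_diam T"


section \<open>Weak convergence of Borel probability measures\<close>

definition borel_of :: "'a topology \<Rightarrow> 'a measure" where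
  "borel_of X = sigma (topspace X) {U. openin X U}"

definition borel_probs :: "'a topology \<Rightarrow> 'a measure set" where
  "borel_probs X = {\<mu>. prob_space \<mu> \<and> sets \<mu> = sets (borel_of X)}"

definition weakly_converges :: "'a topology \<Rightarrow> (nat \<Rightarrow> 'a measure) \<Rightarrow> 'a measure \<Rightarrow> bool" where
  "weakly_converges X \<mu>s \<mu> \<longleftrightarrow>
     (\<forall>n. \<mu>s n \<in> borel_probs X) \<and> \<mu> \<in> borel_probs X \<and>
     (\<forall>f. continuous_map X euclideanreal f \<and> bounded (f ` topspace X) \<longrightarrow>
        (\<lambda>n. \<integral>x. f x \<partial>\<mu>s n) \<longlonglongrightarrow> (\<integral>x. f x \<partial>\<mu>))"


section \<open>Sampling measures\<close>

text \<open>
  Real \<open>r \<times> r\<close> matrices are the extensional functions on \<open>{1..r} \<times> {1..r}\<close>,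
  with the product topology.
\<close>

definition matrix_space :: "nat \<Rightarrow> (nat \<times> nat \<Rightarrow> real) topology" where
  "matrix_space r = powertop_real ({1..r} \<times> {1..r})"

definition sample_matrix :: "nat \<Rightarrow> ('a \<Rightarrow> 'a \<Rightarrow> real) \<Rightarrow> (nat \<Rightarrow> 'a) \<Rightarrow> nat \<times> nat \<Rightarrow> real" where
  "sample_matrix r d x =
     (\<lambda>(i, j) \<in> {1..r} \<times> {1..r}. if i = j then 0 else d (x i) (x j))"

text \<open>The underlying set of the triple \<open>(X, d, \<mu>)\<close> is \<open>space \<mu>\<close>.\<close>

definition sampling_measure ::
  "nat \<Rightarrow> ('a \<Rightarrow> 'a \<Rightarrow> real) \<Rightarrow> 'a measure \<Rightarrow> (nat \<times> nat \<Rightarrow> real) measure" where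
  "sampling_measure r d \<mu> =
     distr (Pi\<^sub>M {1..r} (\<lambda>_. \<mu>)) (borel_of (matrix_space r)) (sample_matrix r d)"

definition tree_sampling :: "nat \<Rightarrow> 'a pair_pre_digraph \<Rightarrow> (nat \<times> nat \<Rightarrow> real) measure" where
  "tree_sampling r T =
     sampling_measure r (tree_dist T) (uniform_count_measure (pverts T))"

lemma tree_sampling_in_borel_probs:
  assumes "nontrivial_tree T"
  shows "tree_sampling r T \<in> borel_probs (matrix_space r)"
proof -
  let ?V = "pverts T" and ?U = "uniform_count_measure (pverts T)"
  have V: "finite ?V" "?V \<noteq> {}"
    using assms pair_fin_digraph.pair_finite_verts
    by (auto simp: nontrivial_tree_def finite_tree_def pair_graph_def pair_digraph_def)
  have U: "prob_space ?U"
    by (rule prob_space_uniform_count_measure) (use V in auto)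
  have P: "prob_space (Pi\<^sub>M {1..r} (\<lambda>_. ?U))"
    by (rule prob_space_PiM) (use U in auto)
  have S: "sets (Pi\<^sub>M {1..r} (\<lambda>_. ?U)) = Pow (Pi\<^sub>E {1..r} (\<lambda>_. ?V))"
  proof -
    have "sets (Pi\<^sub>M {1..r} (\<lambda>_. ?U)) = sets (Pi\<^sub>M {1..r} (\<lambda>_. count_space ?V))"
      by (intro sets_PiM_cong) (auto simp: sets_uniform_count_measure)
    also have "\<dots> = sets (count_space (Pi\<^sub>E {1..r} (\<lambda>_. ?V)))"
      using V by (subst count_space_PiM_finite) (auto intro: countable_finite)
    finally show ?thesis by simp
  qed
  have "sample_matrix r (tree_dist T) \<in>
      Pi\<^sub>M {1..r} (\<lambda>_. ?U) \<rightarrow>\<^sub>M borel_of (matrix_space r)"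
    by (auto simp: measurable_def S space_PiM space_uniform_count_measure borel_of_def
        matrix_space_def sample_matrix_def space_measure_of_conv simp del: One_nat_def)
  then show ?thesis
    unfolding tree_sampling_def sampling_measure_def borel_probs_def
    using prob_space.prob_space_distr[OF P] by auto
qed


section \<open>Real trees\<close>

definition real_tree :: "'a metric \<Rightarrow> bool" where
  "real_tree T \<longleftrightarrow>
     mspace T \<noteq> {} \<and> mcomplete_of T \<and>
     (\<forall>p \<in> mspace T. \<forall>q \<in> mspace T. p \<noteq> q \<longrightarrow>
       (\<exists>a b \<alpha>. a \<le> b \<and> \<alpha> \<in> {a..b} \<rightarrow> mspace T \<and>
          (\<forall>s \<in> {a..b}. \<forall>t \<in> {a..b}. mdist T (\<alpha> s) (\<alpha> t) = dist s (t::real)) \<and>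
          \<alpha> a = p \<and> \<alpha> b = q \<and>
          (\<forall>c. a < c \<and> c < b \<longrightarrow>
             \<not> connected_component_of
                 (subtopology (mtopology_of T) (mspace T - {\<alpha> c})) p q)))"

definition branches_at :: "'a metric \<Rightarrow> 'a \<Rightarrow> 'a set set" where
  "branches_at T p = connected_components_of (subtopology (mtopology_of T) (mspace T - {p}))"

definition branches :: "'a metric \<Rightarrow> 'a set set" where
  "branches T = (\<Union>p \<in> mspace T. branches_at T p)"


section \<open>Dendrons\<close>

definition dendron_topology :: "'a metric \<Rightarrow> ('a \<times> real) topology" where
  "dendron_topology T = prod_topology (mtopology_of T) (top_of_set {0..})"

definition dendron_dist :: "'a metric \<Rightarrow> 'a \<times> real \<Rightarrow> 'a \<times> real \<Rightarrow> real" where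
  "dendron_dist T = (\<lambda>(u, a) (v, b). mdist T u v + a + b)"

definition long_dendron :: "'a metric \<Rightarrow> ('a \<times> real) measure \<Rightarrow> bool" where
  "long_dendron T \<nu> \<longleftrightarrow>
     real_tree T \<and> \<nu> \<in> borel_probs (dendron_topology T) \<and>
     (\<forall>B \<in> branches T. emeasure \<nu> (B \<times> {0..}) > 0)"

text \<open>
  Since \<open>emeasure\<close> is 0 on non-measurable sets, the nullity of the set below is stated with
  \<open>null_sets\<close>, which includes measurability. In a long dendron the set is always
  measurable: the positivity of the branches makes the real tree separable, so that the
  continuous function \<open>dendron_dist T\<close> is measurable for the product sigma-algebra.
\<close>

definition dendron :: "'a metric \<Rightarrow> ('a \<times> real) measure \<Rightarrow> bool" where
  "dendron T \<nu> \<longleftrightarrow>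
     long_dendron T \<nu> \<and>
     {(x, y) \<in> (mspace T \<times> {0..}) \<times> (mspace T \<times> {0..}). dendron_dist T x y > 1}
       \<in> null_sets (\<nu> \<Otimes>\<^sub>M \<nu>)"

definition dendron_sampling ::
  "nat \<Rightarrow> 'a metric \<Rightarrow> ('a \<times> real) measure \<Rightarrow> (nat \<times> nat \<Rightarrow> real) measure" where
  "dendron_sampling r T \<nu> = sampling_measure r (dendron_dist T) \<nu>"

end

theory Submission
  imports Defs
begin

text \<open>
  A finite tree is 0-hyperbolic: its distance satisfies the four-point condition. In each \<open>T\<^sub>n\<close>
  choose spanning points \<open>z\<^sub>0, z\<^sub>1, \<dots>\<close> greedily, the next one minimising the average height of
  the vertices above the subtree spanned so far. These averages decrease, so for most \<open>M\<close> a
  further random vertex hardly lowers them: two random vertices then part almost at the subtree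
  spanned by \<open>z\<^sub>0, \<dots>, z\<^sub>M\<close>, and their distance is, up to a small average error, a function of their
  distances to the \<open>z\<^sub>i\<close>. The latter are points of a Hilbert cube; coding them by a single
  real number through a space-filling curve, Helly's theorem and Skorohod's representation
  provide a subsequence and a coupling along which they converge pointwise. In the limit a sample
  point becomes a point of a real tree (a tight span) together with a hair length, and the sampled
  distances converge almost surely. The real tree of the dendron is the tight span of
  a countable dense subset of the support of the first component; passing to the support gives
  every branch positive measure.
\<close>

section \<open>Distances in finite trees\<close>

text \<open>The quantity \<open>(f i + f j - e i j) / 2\<close> behind all heights is a Gromov
  product: in a tree it is the distance from a point to the segment between the points
  \<open>i\<close> and \<open>j\<close>, and the subtree spanned by finitely many points is the
  union of such segments. Hairs are unavoidable because the mean heights need not tend to 0: in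
  large stars every leaf keeps normalised distance 1/2 from the centre, so the trees have no compact
  limit as metric spaces, and compactness is available only for the laws of the coordinates.
  Distances of pairs are not continuous in these coordinates uniformly in \<open>n\<close>, and the
  error made by replacing them with a function of the coordinates is small only on average over
  pairs. Hence the sampled distances converge first in mean over
  \<open>\<Omega> \<Otimes>\<^sub>M \<Omega>\<close>, and almost surely only along a second
  subsequence. The construction thus yields a dendron for a subsequence; the assumed convergence of
  all test integrals carries its sampling measures to the whole sequence.\<close>

definition tree_pseudometric :: "'a set \<Rightarrow> ('a \<Rightarrow> 'a \<Rightarrow> real) \<Rightarrow> bool" where
  "tree_pseudometric V d \<longleftrightarrow>
     (\<forall>x\<in>V. d x x = 0) \<and> (\<forall>x\<in>V. \<forall>y\<in>V. d x y = d y x \<and> d x y \<le> 1) \<and>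
     (\<forall>x\<in>V. \<forall>y\<in>V. \<forall>z\<in>V. \<forall>w\<in>V. d x y + d z w \<le> max (d x z + d y w) (d x w + d y z))"

locale finite_tree_graph = pair_graph T for T :: "'a pair_pre_digraph" +
  assumes finite_tree: "finite_tree T"
begin

text \<open>The edges that survive the deletion of \<open>x\<close>. Lying in the same branch at
  \<open>x\<close> becomes the reflexive transitive closure, so that no subgraph has to be
  formed.\<close>

definition avoiding :: "'a \<Rightarrow> ('a \<times> 'a) set" where
  "avoiding x = {(a, b) \<in> parcs T. a \<noteq> x \<and> b \<noteq> x}"

lemma parcs_sym: "(a, b) \<in> parcs T \<Longrightarrow> (b, a) \<in> parcs T"
  using pair_sym_arcs by (auto simp: symmetric_def dest: symD)

lemma avoiding_sym: "(a, b) \<in> (avoiding x)\<^sup>* \<Longrightarrow> (b, a) \<in> (avoiding x)\<^sup>*"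
proof -
  have "sym (avoiding x)"
    by (auto simp: avoiding_def sym_def intro: parcs_sym)
  then show "(a, b) \<in> (avoiding x)\<^sup>* \<Longrightarrow> (b, a) \<in> (avoiding x)\<^sup>*"
    by (meson sym_rtrancl symD)
qed

lemma awalk_avoiding:
  "awalk u p v \<Longrightarrow> x \<notin> set (awalk_verts u p) \<Longrightarrow> (u, v) \<in> (avoiding x)\<^sup>*"
proof (induction p arbitrary: u)
  case (Cons e p)
  then have "(snd e, v) \<in> (avoiding x)\<^sup>*"
    by (auto simp: awalk_Cons_iff)
  moreover have "snd e \<noteq> x"
    using Cons.prems by (cases p) (auto simp: awalk_Cons_iff)
  moreover have "(u, snd e) \<in> parcs T" "u \<noteq> x"
    using Cons.prems by (cases e, auto simp: awalk_Cons_iff)+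
  ultimately show ?case
    by (auto simp: avoiding_def intro: converse_rtrancl_into_rtrancl[of u "snd e"])
qed (auto simp: awalk_Nil_iff)

lemma avoiding_awalk:
  assumes "(u, v) \<in> (avoiding x)\<^sup>*" "u \<in> pverts T" "u \<noteq> x"
  shows "\<exists>p. awalk u p v \<and> x \<notin> set (awalk_verts u p)"
  using assms
proof (induction rule: converse_rtrancl_induct)
  case base
  then have "awalk v [] v \<and> x \<notin> set (awalk_verts v [])"
    by (simp add: awalk_Nil_iff)
  then show ?case by blast
next
  case (step y z)
  then have yz: "(y, z) \<in> parcs T" "y \<noteq> x" "z \<noteq> x"
    by (auto simp: avoiding_def)
  then have "z \<in> pverts T"
    using in_arcsD2 by auto
  then obtain p where p: "awalk z p v" "x \<notin> set (awalk_verts z p)"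
    using step yz by blast
  then have "awalk y ((y, z) # p) v \<and> x \<notin> set (awalk_verts y ((y, z) # p))"
    using yz by (auto simp: awalk_Cons_iff)
  then show ?case by blast
qed

text \<open>Distinct neighbours of \<open>x\<close> joined by a path avoiding \<open>x\<close> would close up to a cycle through \<open>x\<close>.\<close>

lemma neighbours_separated:
  assumes "(x, y) \<in> parcs T" "(x, z) \<in> parcs T" "y \<noteq> z"
  shows "(y, z) \<notin> (avoiding x)\<^sup>*"
proof
  assume "(y, z) \<in> (avoiding x)\<^sup>*"
  moreover have "y \<in> pverts T" "y \<noteq> x" "z \<noteq> x"
    using assms in_arcsD2 no_loops by fastforce+
  ultimately obtain p where p: "awalk y p z" "x \<notin> set (awalk_verts y p)"
    using avoiding_awalk by blast
  define q where "q = awalk_to_apath p"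
  have q: "apath y q z" "set q \<subseteq> set p"
    using p apath_awalk_to_apath awalk_to_apath_subset by (auto simp: q_def)
  then have qw: "awalk y q z" and qd: "distinct (awalk_verts y q)"
    by (auto simp: apath_def)
  have qx: "x \<notin> set (awalk_verts y q)"
    using p q \<open>y \<noteq> x\<close> set_awalk_verts[OF p(1)] set_awalk_verts[OF qw] by auto
  have zx: "(z, x) \<in> parcs T" "x \<in> pverts T"
    using assms parcs_sym in_arcsD1 by auto
  then have last: "awalk z [(z, x)] x"
    by (simp add: awalk_Cons_iff awalk_Nil_iff)
  have w: "awalk y (q @ [(z, x)]) x"
    using awalk_appendI[OF qw last] .
  have awl: "awlast y q = z"
    using qw by (auto elim: awalkE')
  have "awalk_verts y (q @ [(z, x)]) = awalk_verts y q @ [x]"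
    using awalk_verts_append[OF w] awl by simp
  then have "distinct (tl (awalk_verts x ((x, y) # q @ [(z, x)])))"
    using qx qd by simp
  moreover have "awalk x ((x, y) # q @ [(z, x)]) x"
    using w assms by (simp add: awalk_Cons_iff del: awalk_append_iff)
  ultimately have "cycle ((x, y) # q @ [(z, x)])"
    unfolding cycle_def by blast
  moreover have "q \<noteq> []"
    using qw assms by (auto simp: awalk_Nil_iff)
  then have "3 \<le> length ((x, y) # q @ [(z, x)])"
    by (cases q) auto
  ultimately show False
    using finite_tree by (auto simp: finite_tree_def)
qed

definition walk_dist :: "'a \<Rightarrow> 'a \<Rightarrow> nat" where
  "walk_dist u v = (LEAST n. \<exists>p. awalk u p v \<and> length p = n)"

lemma walk_dist_le: "awalk u p v \<Longrightarrow> walk_dist u v \<le> length p"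
  unfolding walk_dist_def by (rule Least_le) blast

lemma shortest_walk:
  assumes "u \<in> pverts T" "v \<in> pverts T"
  obtains p where "awalk u p v" "length p = walk_dist u v"
proof -
  have "mk_symmetric (with_proj T) = T"
  proof -
    have "(\<Union>e\<in>parcs T. {(fst e, snd e), (snd e, fst e)}) = parcs T"
      using parcs_sym by auto
    then show ?thesis by (simp add: mk_symmetric_def)
  qed
  then have "u \<rightarrow>\<^sup>*\<^bsub>with_proj T\<^esub> v"
    using assms finite_tree
    by (simp add: finite_tree_def Digraph_Component.connected_def strongly_connected_def)
  then obtain p0 where p0: "awalk u p0 v"
    using reachable_awalk by auto
  let ?P = "\<lambda>n. \<exists>p. awalk u p v \<and> length p = n"
  have "?P (walk_dist u v)"
    unfolding walk_dist_def using LeastI_ex[of ?P] p0 by blast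
  then show ?thesis using that by blast
qed

lemma walk_dist_self: "u \<in> pverts T \<Longrightarrow> walk_dist u u = 0"
  using walk_dist_le[of u "[]" u] by (simp add: awalk_Nil_iff)

lemma walk_dist_pos:
  assumes "u \<in> pverts T" "v \<in> pverts T" "u \<noteq> v"
  shows "0 < walk_dist u v"
proof -
  obtain p where "awalk u p v" "length p = walk_dist u v"
    using assms shortest_walk by blast
  then show ?thesis using assms by (cases p) (auto simp: awalk_Nil_iff)
qed

lemma walk_dist_triangle:
  assumes "u \<in> pverts T" "v \<in> pverts T" "w \<in> pverts T"
  shows "walk_dist u w \<le> walk_dist u v + walk_dist v w"
proof -
  obtain p q where "awalk u p v" "length p = walk_dist u v" "awalk v q w" "length q = walk_dist v w"
    using assms shortest_walk by metis
  then show ?thesis using walk_dist_le[of u "p @ q" w] awalk_appendI by fastforce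
qed

lemma awalk_reverse: "awalk u p v \<Longrightarrow> \<exists>q. awalk v q u \<and> length q = length p"
proof (induction p arbitrary: u)
  case (Cons e p)
  then obtain q where "awalk v q (snd e)" "length q = length p" "u = fst e" "e \<in> parcs T"
    by (auto simp: awalk_Cons_iff)
  moreover from this have "awalk (snd e) [(snd e, u)] u"
    using parcs_sym in_arcsD1[of "fst e" "snd e"] by (auto simp: awalk_Cons_iff awalk_Nil_iff)
  ultimately have "awalk v (q @ [(snd e, u)]) u \<and> length (q @ [(snd e, u)]) = length (e # p)"
    by (auto intro!: awalk_appendI simp del: awalk_append_iff)
  then show ?case by blast
qed (auto simp: awalk_Nil_iff)

lemma walk_dist_sym:
  assumes "u \<in> pverts T" "v \<in> pverts T"
  shows "walk_dist u v = walk_dist v u"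
proof -
  have "walk_dist b a \<le> walk_dist a b" if ab: "a \<in> pverts T" "b \<in> pverts T" for a b
  proof -
    obtain p where "awalk a p b" "length p = walk_dist a b"
      using shortest_walk[OF ab] .
    then show ?thesis using awalk_reverse walk_dist_le by metis
  qed
  then show ?thesis using assms by (simp add: antisym)
qed

text \<open>\<open>n\<close> is the second vertex of a shortest walk. A shortest walk from
  \<open>n\<close> that returned to \<open>x\<close> would contain a walk from \<open>x\<close> to
  \<open>y\<close> that is too short, so it stays within one branch at \<open>x\<close>.\<close>

lemma step_towards:
  assumes "x \<in> pverts T" "y \<in> pverts T" "x \<noteq> y"
  obtains n where "(x, n) \<in> parcs T" "n \<in> pverts T" "walk_dist x y = Suc (walk_dist n y)"
    "(n, y) \<in> (avoiding x)\<^sup>*"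
proof -
  obtain p where p: "awalk x p y" "length p = walk_dist x y"
    using assms shortest_walk by blast
  then obtain e q where q: "p = e # q"
    using assms by (cases p) (auto simp: awalk_Nil_iff)
  define n where "n = snd e"
  have e: "(x, n) \<in> parcs T" and nq: "awalk n q y"
    using p q by (auto simp: awalk_Cons_iff n_def)
  then have n: "n \<in> pverts T" using in_arcsD2 by auto
  have "walk_dist n y \<le> length q" using nq walk_dist_le by blast
  moreover obtain r where r: "awalk n r y" "length r = walk_dist n y"
    using n assms shortest_walk by blast
  then have "awalk x ((x, n) # r) y" using e by (auto simp: awalk_Cons_iff)
  then have "walk_dist x y \<le> Suc (walk_dist n y)"
    using walk_dist_le[of x "(x, n) # r" y] r by simp
  ultimately have d: "walk_dist x y = Suc (walk_dist n y)" using p q by simp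
  have "x \<notin> set (awalk_verts n r)"
  proof
    assume "x \<in> set (awalk_verts n r)"
    then obtain r1 r2 where "r = r1 @ r2" "awalk x r2 y"
      using awalk_decomp[OF r(1)] by blast
    then have "walk_dist x y \<le> length r" using walk_dist_le by fastforce
    then show False using d r by simp
  qed
  then show ?thesis using that e n d r awalk_avoiding by blast
qed

text \<open>\<open>y\<close> and \<open>z\<close> lie in different branches at \<open>x\<close>: a
  walk between them that missed \<open>x\<close> would join the neighbours \<open>m\<close> and
  \<open>n\<close> outside \<open>x\<close>.\<close>

lemma walk_dist_through:
  assumes V: "x \<in> pverts T" "y \<in> pverts T" "z \<in> pverts T"
    and m: "(x, m) \<in> parcs T" "(m, y) \<in> (avoiding x)\<^sup>*"
    and n: "(x, n) \<in> parcs T" "(n, z) \<in> (avoiding x)\<^sup>*" and "m \<noteq> n"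
  shows "walk_dist y z = walk_dist x y + walk_dist x z"
proof -
  obtain p where p: "awalk y p z" "length p = walk_dist y z"
    using shortest_walk[OF V(2,3)] .
  have "x \<in> set (awalk_verts y p)"
  proof (rule ccontr)
    assume "x \<notin> set (awalk_verts y p)"
    then have "(y, z) \<in> (avoiding x)\<^sup>*" using p awalk_avoiding by blast
    then have "(m, n) \<in> (avoiding x)\<^sup>*"
      using m(2) avoiding_sym[OF n(2)] by (meson rtrancl_trans)
    then show False using neighbours_separated m n \<open>m \<noteq> n\<close> by blast
  qed
  then obtain q r where "p = q @ r" "awalk y q x" "awalk x r z"
    using awalk_decomp[OF p(1)] by blast
  then have "walk_dist y x + walk_dist x z \<le> walk_dist y z"
    using walk_dist_le[of y q x] walk_dist_le[of x r z] p by simp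
  then show ?thesis
    using walk_dist_triangle[of y x z] walk_dist_sym[of x y] V by simp
qed

text \<open>\<open>x\<close> moves towards \<open>y\<close>. If \<open>y\<close>, \<open>z\<close>
  and \<open>w\<close> lie in one branch at \<open>x\<close>, one step lowers all three distances
  from \<open>x\<close> by 1 and both sides of the inequality by 1. Otherwise \<open>x\<close> lies
  between \<open>y\<close> and \<open>z\<close> or between \<open>y\<close> and \<open>w\<close>,
  and the triangle inequality for \<open>z\<close>, \<open>x\<close>, \<open>w\<close>
  suffices.\<close>

lemma walk_dist_four_point:
  assumes "x \<in> pverts T" "y \<in> pverts T" "z \<in> pverts T" "w \<in> pverts T"
  shows "walk_dist x y + walk_dist z w \<le>
    max (walk_dist x z + walk_dist y w) (walk_dist x w + walk_dist y z)"
  using assms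
proof (induction "walk_dist x y" arbitrary: x)
  case 0
  then have [simp]: "x = y" using walk_dist_pos[of x y] by fastforce
  have "walk_dist z w \<le> walk_dist y z + walk_dist y w" "walk_dist y y = 0"
    using 0 walk_dist_triangle[of z y w] walk_dist_sym[of z y] walk_dist_self by simp_all
  then show ?case by simp
next
  case (Suc k)
  note V = Suc.prems
  have neq: "x \<noteq> y" using Suc.hyps(2) walk_dist_self[of x] V(1) by (metis nat.distinct(1))
  consider "x = z" | "x = w" | "x \<noteq> z" "x \<noteq> w" by blast
  then show ?case
  proof cases
    case 1
    then show ?thesis
      using walk_dist_sym[of z y] V by simp
  next
    case 2
    then show ?thesis
      using walk_dist_sym[of w y] walk_dist_sym[of z w] V by simp
  next
    case 3
    obtain m where m: "(x, m) \<in> parcs T" "m \<in> pverts T" "walk_dist x y = Suc (walk_dist m y)"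
      "(m, y) \<in> (avoiding x)\<^sup>*" by (rule step_towards[OF V(1,2) neq])
    obtain n where n: "(x, n) \<in> parcs T" "n \<in> pverts T" "walk_dist x z = Suc (walk_dist n z)"
      "(n, z) \<in> (avoiding x)\<^sup>*" by (rule step_towards[OF V(1,3) 3(1)])
    obtain l where l: "(x, l) \<in> parcs T" "l \<in> pverts T" "walk_dist x w = Suc (walk_dist l w)"
      "(l, w) \<in> (avoiding x)\<^sup>*" by (rule step_towards[OF V(1,4) 3(2)])
    show ?thesis
    proof (cases "m = n \<and> m = l")
      case True
      moreover have "walk_dist m y + walk_dist z w \<le>
          max (walk_dist m z + walk_dist y w) (walk_dist m w + walk_dist y z)"
        using Suc.hyps(1)[of m] Suc.hyps(2) m V by simp
      ultimately show ?thesis using m(3) n(3) l(3) by auto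
    next
      case False
      have zw: "walk_dist z w \<le> walk_dist x z + walk_dist x w"
        using walk_dist_triangle[of z x w] walk_dist_sym[of z x] V by simp
      from False consider "m \<noteq> n" | "m \<noteq> l" by blast
      then show ?thesis
      proof cases
        case 1
        then show ?thesis
          using walk_dist_through[of x y z m n] m n V zw by simp
      next
        case 2
        then show ?thesis
          using walk_dist_through[of x y w m l] m l V zw by simp
      qed
    qed
  qed
qed

lemma tree_path_dist_eq:
  "u \<in> pverts T \<Longrightarrow> v \<in> pverts T \<Longrightarrow> tree_path_dist T u v = real (walk_dist u v)"
  unfolding walk_dist_def by (rule tree_path_dist_eq_Least[OF finite_tree])

end

lemma tree_pseudometric_tree_dist:
  assumes "nontrivial_tree T"
  shows "tree_pseudometric (pverts T) (tree_dist T)"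
proof -
  interpret pair_graph T
    using assms by (simp add: nontrivial_tree_def finite_tree_def)
  interpret finite_tree_graph T
    using assms by unfold_locales (simp add: nontrivial_tree_def)
  obtain a b where ab: "a \<in> pverts T" "b \<in> pverts T" "a \<noteq> b"
    using assms by (auto simp: nontrivial_tree_def numeral_2_eq_2 card_le_Suc_iff)
  have le: "tree_path_dist T u v \<le> tree_diam T" if "u \<in> pverts T" "v \<in> pverts T" for u v
    unfolding tree_diam_def
    by (rule Max_ge) (use that in auto)
  have pos: "0 < tree_diam T"
    using le[OF ab(1,2)] walk_dist_pos[OF ab] tree_path_dist_eq[OF ab(1,2)] by simp
  have fp: "tree_dist T x y + tree_dist T z w \<le>
      max (tree_dist T x z + tree_dist T y w) (tree_dist T x w + tree_dist T y z)"
    if "x \<in> pverts T" "y \<in> pverts T" "z \<in> pverts T" "w \<in> pverts T" for x y z w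
  proof -
    have "real (walk_dist x y) + real (walk_dist z w) \<le>
        max (real (walk_dist x z) + real (walk_dist y w)) (real (walk_dist x w) + real (walk_dist y z))"
      using walk_dist_four_point[OF that] by linarith
    then have "(real (walk_dist x y) + real (walk_dist z w)) / tree_diam T \<le>
        max (real (walk_dist x z) + real (walk_dist y w)) (real (walk_dist x w) + real (walk_dist y z))
          / tree_diam T"
      using pos by (simp add: divide_right_mono)
    then show ?thesis
      using pos that by (auto simp: tree_dist_def tree_path_dist_eq add_divide_distrib max_def split: if_splits)
  qed
  show ?thesis
    unfolding tree_pseudometric_def
  proof (intro conjI ballI)
    fix x y assume "x \<in> pverts T" "y \<in> pverts T"
    then show "tree_dist T x y = tree_dist T y x" "tree_dist T x y \<le> 1"
      using walk_dist_sym[of x y] le[of x y] pos by (simp_all add: tree_dist_def tree_path_dist_eq)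
  qed (use fp walk_dist_self in \<open>simp_all add: tree_dist_def tree_path_dist_eq\<close>)
qed

section \<open>A curve through the Hilbert cube\<close>

text \<open>Equal to 0 on \<open>[2m, 2m + 1/3]\<close> and to 1 on \<open>[2m + 2/3, 2m + 1]\<close>, as in Schoenberg's space-filling curve.\<close>

definition digit_wave :: "real \<Rightarrow> real" where
  "digit_wave t = max 0 (min 1 (1/2 - cos (pi * t)))"

text \<open>Binary digit \<open>k\<close> of coordinate \<open>j\<close> is read from ternary place
  \<open>prod_encode (j, k)\<close> of \<open>t\<close>. The pairing function lets countably many
  coordinates share one parameter, where the planar curve alternates between two.\<close>

definition schoenberg :: "nat \<Rightarrow> real \<Rightarrow> real" where
  "schoenberg j t = (\<Sum>k. digit_wave (3 ^ prod_encode (j, k) * t) / 2 ^ Suc k)"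

lemma digit_wave_bounds: "0 \<le> digit_wave t" "digit_wave t \<le> 1"
  by (auto simp: digit_wave_def)

lemma digit_wave_low:
  assumes "0 \<le> s" "s \<le> 1/3"
  shows "digit_wave (2 * of_int m + s) = 0"
proof -
  have "cos (pi * (2 * of_int m + s)) = cos (pi * s)"
    by (simp add: distrib_left cos_add mult.assoc mult.left_commute sin_times_pi_eq_0)
       (metis cos_int_2pin sin_int_2pin mult.assoc mult.commute mult_1 mult_zero_left diff_zero)
  moreover have "cos (pi/3) \<le> cos (pi * s)"
    by (rule cos_monotone_0_pi_le) (use assms in auto)
  ultimately show ?thesis by (simp add: digit_wave_def cos_60)
qed

lemma digit_wave_high:
  assumes "2/3 \<le> s" "s \<le> 1"
  shows "digit_wave (2 * of_int m + s) = 1"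
proof -
  have "cos (pi * (2 * of_int m + s)) = cos (pi * s)"
    by (simp add: distrib_left cos_add mult.assoc mult.left_commute sin_times_pi_eq_0)
       (metis cos_int_2pin sin_int_2pin mult.assoc mult.commute mult_1 mult_zero_left diff_zero)
  moreover have "cos (pi * s) \<le> cos (pi * (2/3))"
    by (rule cos_monotone_0_pi_le) (use assms in auto)
  moreover have "cos (pi * (2/3)) = - 1/2"
    using cos_pi_minus[of "pi/3"] by (simp add: cos_60 field_simps)
  ultimately show ?thesis by (simp add: digit_wave_def)
qed

lemma summable_half_powers: "summable (\<lambda>k. (1::real) / 2 ^ Suc k)"
  using power_half_series by (simp add: sums_iff power_divide)

lemma continuous_schoenberg: "continuous_on UNIV (schoenberg j)"
proof -
  have "uniform_limit UNIV (\<lambda>n t. \<Sum>k<n. digit_wave (3 ^ prod_encode (j, k) * t) / 2 ^ Suc k)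
      (\<lambda>t. \<Sum>k. digit_wave (3 ^ prod_encode (j, k) * t) / 2 ^ Suc k) sequentially"
    by (rule Weierstrass_m_test[OF _ summable_half_powers])
       (simp add: digit_wave_bounds divide_right_mono)
  then have "continuous_on UNIV (\<lambda>t. \<Sum>k. digit_wave (3 ^ prod_encode (j, k) * t) / 2 ^ Suc k)"
    by (rule uniform_limit_theorem[rotated])
       (auto intro!: always_eventually continuous_intros simp: digit_wave_def)
  then show ?thesis by (simp add: schoenberg_def[abs_def])
qed

text \<open>The \<open>m\<close>-th ternary digit of a point of the Cantor set is read off after multiplication by \<open>3^m\<close>.\<close>

lemma digit_wave_ternary:
  fixes b :: "nat \<Rightarrow> nat"
  assumes b: "\<And>i. b i \<in> {0, 1}"
  defines "t \<equiv> (\<Sum>i. 2 * real (b i) / 3 ^ Suc i)"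
  shows "digit_wave (3 ^ m * t) = real (b m)" "0 \<le> t" "t \<le> 1"
proof -
  have sm: "summable (\<lambda>i. (2::real) / 3 ^ Suc i)" and sv: "(\<Sum>i. (2::real) / 3 ^ Suc i) = 1"
  proof -
    have "(\<lambda>i. (2/3) * (1/3::real) ^ i) sums ((2/3) * (1 / (1 - 1/3)))"
      by (intro sums_mult geometric_sums) auto
    then have "(\<lambda>i. (2::real) / 3 ^ Suc i) sums 1"
      by (simp add: power_divide)
    then show "summable (\<lambda>i. (2::real) / 3 ^ Suc i)" "(\<Sum>i. (2::real) / 3 ^ Suc i) = 1"
      by (simp_all add: sums_iff)
  qed
  have bb: "0 \<le> real (b i)" "real (b i) \<le> 1" for i
    using b[of i] by auto
  have b_le: "b i \<le> Suc 0" for i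
    using b[of i] by auto
  have sm': "summable (\<lambda>i. 2 * real (b (i + n)) / 3 ^ Suc i)" for n
    by (rule summable_comparison_test'[OF sm, of 0]) (auto intro!: divide_right_mono simp: b_le)
  have tail0: "0 \<le> (\<Sum>i. 2 * real (b (i + n)) / 3 ^ Suc i)" for n
    by (rule suminf_nonneg[OF sm']) (simp add: bb)
  have tail1: "(\<Sum>i. 2 * real (b (i + n)) / 3 ^ Suc i) \<le> 1" for n
  proof -
    have "(\<Sum>i. 2 * real (b (i + n)) / 3 ^ Suc i) \<le> (\<Sum>i. (2::real) / 3 ^ Suc i)"
      by (rule suminf_le[OF _ sm' sm]) (auto intro!: divide_right_mono simp: b_le)
    then show ?thesis using sv by simp
  qed
  show "0 \<le> t" "t \<le> 1" using tail0[of 0] tail1[of 0] by (simp_all add: t_def)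
  define v where "v n = (\<Sum>i. 2 * real (b (i + n)) / 3 ^ Suc i)" for n
  have step: "3 * v n = 2 * real (b n) + v (Suc n)" for n
  proof -
    have "v n = 2 * real (b n) / 3 + (\<Sum>i. 2 * real (b (Suc i + n)) / 3 ^ Suc (Suc i))"
      unfolding v_def using suminf_split_head[OF sm'[of n]] by simp
    also have "(\<Sum>i. 2 * real (b (Suc i + n)) / 3 ^ Suc (Suc i))
        = (\<Sum>i. (2 * real (b (i + Suc n)) / 3 ^ Suc i) / 3)"
      by (simp add: field_simps)
    also have "\<dots> = v (Suc n) / 3"
      unfolding v_def by (rule suminf_divide[OF sm'])
    finally show ?thesis by simp
  qed
  \<comment> \<open>The ternary digits are 0 or 2, so multiplication by \<open>3 ^ m\<close> moves
    the first \<open>m\<close> of them into an even integer, a multiple of the period of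
    \<open>digit_wave\<close>. The rest \<open>v m\<close> lies in \<open>[0, 1/3]\<close> or in
    \<open>[2/3, 1]\<close> according to the next digit.\<close>
  have "\<exists>k::int. 3 ^ m * t = 2 * of_int k + v m"
  proof (induction m)
    case 0
    show ?case by (rule exI[of _ 0]) (simp add: t_def v_def)
  next
    case (Suc m)
    then obtain k :: int where k: "3 ^ m * t = 2 * of_int k + v m" by blast
    have "3 ^ Suc m * t = 2 * of_int (3 * k + int (b m)) + v (Suc m)"
      using k step[of m] by simp
    then show ?case by blast
  qed
  then obtain k :: int where k: "3 ^ m * t = 2 * of_int k + v m" by blast
  have vm: "v m = (2 * real (b m) + v (Suc m)) / 3" using step[of m] by simp
  have v01: "0 \<le> v (Suc m)" "v (Suc m) \<le> 1"
    unfolding v_def by (rule tail0, rule tail1)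
  show "digit_wave (3 ^ m * t) = real (b m)"
  proof (cases "b m = 0")
    case True
    then show ?thesis unfolding k by (subst digit_wave_low) (use vm v01 in auto)
  next
    case False
    then have "b m = 1" using b[of m] by auto
    then show ?thesis unfolding k by (subst digit_wave_high) (use vm v01 in auto)
  qed
qed

lemma binary_expansion:
  assumes "0 \<le> (x::real)" "x \<le> 1"
  shows "\<exists>b :: nat \<Rightarrow> nat. (\<forall>k. b k \<in> {0, 1}) \<and> (\<lambda>k. real (b k) / 2 ^ Suc k) sums x"
proof -
  \<comment> \<open>\<open>r n\<close> is the remainder of \<open>x\<close> after \<open>n\<close>
    digits, scaled by \<open>2 ^ n\<close>. The doubling map used here fixes 1, so the endpoint
    \<open>x = 1\<close> receives the expansion with all digits 1.\<close>
  define r where "r = rec_nat x (\<lambda>_ y. if 1/2 \<le> y then 2 * y - 1 else 2 * y)"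
  define b where "b k = (if 1/2 \<le> r k then 1 else 0 :: nat)" for k
  have r: "0 \<le> r n \<and> r n \<le> 1" for n
    by (induction n) (use assms in \<open>auto simp: r_def\<close>)
  have rS: "r (Suc n) = 2 * r n - real (b n)" for n
    by (simp add: r_def b_def)
  have "x = (\<Sum>k<n. real (b k) / 2 ^ Suc k) + r n / 2 ^ n" for n
  proof (induction n)
    case 0
    show ?case by (simp add: r_def)
  next
    case (Suc n)
    have "r n / 2 ^ n = real (b n) / 2 ^ Suc n + r (Suc n) / 2 ^ Suc n"
      using rS[of n] by (simp add: field_simps)
    then show ?case using Suc by simp
  qed
  then have "(\<lambda>n. \<Sum>k<n. real (b k) / 2 ^ Suc k) = (\<lambda>n. x - r n / 2 ^ n)"
    by (auto simp: fun_eq_iff algebra_simps)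
  moreover have "(\<lambda>n. r n / 2 ^ n) \<longlonglongrightarrow> 0"
  proof (rule tendsto_sandwich[of "\<lambda>_. 0" _ _ "\<lambda>n. (1/2) ^ n"])
    show "(\<lambda>n. (1/2::real) ^ n) \<longlonglongrightarrow> 0" by (rule LIMSEQ_power_zero) simp
  qed (use r in \<open>auto simp: power_divide divide_right_mono\<close>)
  ultimately have "(\<lambda>k. real (b k) / 2 ^ Suc k) sums x"
    unfolding sums_def using tendsto_diff[of "\<lambda>_. x" x sequentially "\<lambda>n. r n / 2 ^ n" 0] by simp
  then show ?thesis by (intro exI[of _ b]) (auto simp: b_def)
qed

text \<open>The binary digits of all coordinates are interleaved into one point of the Cantor set,
  where the curve reads them back exactly.\<close>

lemma schoenberg_surj:
  assumes "\<And>j. 0 \<le> \<phi> j \<and> \<phi> j \<le> 1"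
  obtains t where "0 \<le> t" "t \<le> 1" "\<And>j. schoenberg j t = \<phi> j"
proof -
  have "\<forall>j. \<exists>b :: nat \<Rightarrow> nat. (\<forall>k. b k \<in> {0, 1}) \<and> (\<lambda>k. real (b k) / 2 ^ Suc k) sums \<phi> j"
    using assms binary_expansion by blast
  then obtain b :: "nat \<Rightarrow> nat \<Rightarrow> nat" where
    b: "\<And>j k. b j k \<in> {0, 1}" "\<And>j. (\<lambda>k. real (b j k) / 2 ^ Suc k) sums \<phi> j"
    by metis
  define c where "c i = b (fst (prod_decode i)) (snd (prod_decode i))" for i
  have c: "c i \<in> {0, 1}" for i unfolding c_def by (rule b(1))
  define t where "t = (\<Sum>i. 2 * real (c i) / 3 ^ Suc i)"
  have "digit_wave (3 ^ prod_encode (j, k) * t) = real (b j k)" for j k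
    using digit_wave_ternary(1)[OF c, of "prod_encode (j, k)"] by (simp add: t_def c_def)
  then have "schoenberg j t = \<phi> j" for j
    using b(2)[of j] by (simp add: schoenberg_def sums_iff)
  moreover have "0 \<le> t" "t \<le> 1"
    unfolding t_def by (rule digit_wave_ternary(2,3)[OF c])+
  ultimately show ?thesis using that by blast
qed

section \<open>The real tree spanned by a countable tree metric\<close>

text \<open>A point of the spanned tree is represented by its distances to the given points.\<close>

definition tight_span :: "(nat \<Rightarrow> nat \<Rightarrow> real) \<Rightarrow> (nat \<Rightarrow> real) set" where
  "tight_span E = {f. (\<forall>i j. E i j \<le> f i + f j) \<and> (\<forall>i. \<forall>e>0. \<exists>j. f i + f j \<le> E i j + e)}"

text \<open>The truncation only makes the supremum meaningful for arbitrary sequences.\<close>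

definition sup_dist :: "(nat \<Rightarrow> real) \<Rightarrow> (nat \<Rightarrow> real) \<Rightarrow> real" where
  "sup_dist f g = (SUP i. min 1 \<bar>f i - g i\<bar>)"

lemma bdd_sup_dist: "bdd_above (range (\<lambda>i. min 1 \<bar>f i - g i\<bar>))" for f g :: "nat \<Rightarrow> real"
  by (rule bdd_aboveI[of _ 1]) auto

lemma sup_dist_nonneg: "0 \<le> sup_dist f g"
  unfolding sup_dist_def by (rule cSUP_upper2[OF bdd_sup_dist, of 0]) auto

lemma sup_dist_commute: "sup_dist f g = sup_dist g f"
  by (simp add: sup_dist_def abs_minus_commute)

lemma sup_dist_le: "(\<And>i. \<bar>f i - g i\<bar> \<le> c) \<Longrightarrow> sup_dist f g \<le> c"
  unfolding sup_dist_def by (rule cSUP_least) (auto simp: min.coboundedI2)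

lemma sup_dist_upper: "\<bar>f i - g i\<bar> \<le> 1 \<Longrightarrow> \<bar>f i - g i\<bar> \<le> sup_dist f g"
  unfolding sup_dist_def by (rule cSUP_upper2[OF bdd_sup_dist, of i]) auto

locale tree_span =
  fixes E :: "nat \<Rightarrow> nat \<Rightarrow> real"
  assumes tree_E: "tree_pseudometric UNIV E"
begin

lemma E_refl [simp]: "E i i = 0" and E_sym: "E i j = E j i" and E_le1: "E i j \<le> 1"
  and E_four: "E i j + E k l \<le> max (E i k + E j l) (E i l + E j k)"
  using tree_E by (auto simp: tree_pseudometric_def)

lemma E_tri: "E i j \<le> E i k + E k j"
  using E_four[of i j k k] E_sym[of j k] by simp

lemma span_ge: "f \<in> tight_span E \<Longrightarrow> E i j \<le> f i + f j"
  by (simp add: tight_span_def)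

text \<open>Up to \<open>e\<close>, the point lies on the segment from \<open>i\<close> to some
  \<open>j\<close>. Among infinitely many \<open>j\<close> the infimum need not be attained.\<close>

lemma span_tight:
  assumes "f \<in> tight_span E" "0 < e"
  obtains j where "f i + f j \<le> E i j + e"
  using assms unfolding tight_span_def by blast

lemma span_nonneg: "f \<in> tight_span E \<Longrightarrow> 0 \<le> f i"
  using span_ge[of f i i] by simp

lemma span_le1:
  assumes "f \<in> tight_span E"
  shows "f i \<le> 1"
proof (rule field_le_epsilon)
  fix e :: real assume "0 < e"
  then obtain j where "f i + f j \<le> E i j + e" using span_tight assms by blast
  then show "f i \<le> 1 + e" using span_nonneg[OF assms, of j] E_le1[of i j] by linarith
qed

lemma span_lip:
  assumes "f \<in> tight_span E"
  shows "f i \<le> E i j + f j"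
proof (rule field_le_epsilon)
  fix e :: real assume "0 < e"
  then obtain k where "f i + f k \<le> E i k + e" using span_tight assms by blast
  then show "f i \<le> E i j + f j + e" using span_ge[OF assms, of j k] E_tri[of i k j] by linarith
qed

lemma abs_le_sup_dist:
  assumes "f \<in> tight_span E" "g \<in> tight_span E"
  shows "\<bar>f i - g i\<bar> \<le> sup_dist f g"
  using assms[THEN span_nonneg, of i] assms[THEN span_le1, of i] by (intro sup_dist_upper) auto

text \<open>Together with \<open>E_le_sup_dist\<close> this identifies \<open>sup_dist f g\<close>
  as the supremum of \<open>E k l - f k - g l\<close>, through which inequalities for
  \<open>E\<close> pass to the span. A nearly optimal coordinate \<open>i\<close> is one end;
  tightness of the function with the larger value at \<open>i\<close> supplies the other.\<close>

lemma sup_dist_approx: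
  assumes "f \<in> tight_span E" "g \<in> tight_span E" "0 < e"
  obtains k l where "sup_dist f g - e \<le> E k l - f k - g l"
proof -
  have "\<exists>i. sup_dist f g - e/2 < min 1 \<bar>f i - g i\<bar>"
    using less_cSUP_iff[OF UNIV_not_empty bdd_sup_dist, of "sup_dist f g - e/2" f g] assms(3)
    unfolding sup_dist_def by simp
  then obtain i where i: "sup_dist f g - e/2 < \<bar>f i - g i\<bar>" by auto
  show ?thesis
  proof (cases "g i \<le> f i")
    case True
    obtain l where "f i + f l \<le> E i l + e/2" using span_tight assms half_gt_zero by blast
    then have "sup_dist f g - e \<le> E l i - f l - g i" using True i E_sym[of i l] by simp
    then show ?thesis by (rule that)
  next
    case False
    obtain l where "g i + g l \<le> E i l + e/2" using span_tight assms half_gt_zero by blast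
    then have "sup_dist f g - e \<le> E i l - f i - g l" using False i by simp
    then show ?thesis by (rule that)
  qed
qed

lemma E_le_sup_dist:
  assumes "f \<in> tight_span E" "g \<in> tight_span E"
  shows "E k l - f k - g l \<le> sup_dist f g"
  using abs_le_sup_dist[OF assms, of k] span_ge[OF assms(2), of k l] by linarith

sublocale Metric_space "tight_span E" sup_dist
proof
  fix f g h assume fgh: "f \<in> tight_span E" "g \<in> tight_span E"
  show "(sup_dist f g = 0) = (f = g)"
    using abs_le_sup_dist[OF fgh] sup_dist_le[of f g 0] sup_dist_nonneg[of f g]
    by (fastforce intro!: ext)
  assume h: "h \<in> tight_span E"
  show "sup_dist f h \<le> sup_dist f g + sup_dist g h"
  proof (rule sup_dist_le)
    fix i show "\<bar>f i - h i\<bar> \<le> sup_dist f g + sup_dist g h"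
      using abs_le_sup_dist[OF fgh, of i] abs_le_sup_dist[OF fgh(2) h, of i] by linarith
  qed
qed (simp_all add: sup_dist_nonneg sup_dist_commute)

text \<open>Nearly optimal pairs for the two distances on the left reduce the claim to the
  four-point condition for \<open>E\<close> at four indices.\<close>

lemma sup_dist_four_point:
  assumes "f \<in> tight_span E" "g \<in> tight_span E" "h \<in> tight_span E" "m \<in> tight_span E"
  shows "sup_dist f g + sup_dist h m \<le> max (sup_dist f h + sup_dist g m) (sup_dist f m + sup_dist g h)"
proof (rule field_le_epsilon)
  fix e :: real assume "0 < e"
  then have e: "0 < e/2" by simp
  obtain k l where kl: "sup_dist f g - e/2 \<le> E k l - f k - g l"
    using sup_dist_approx[OF assms(1,2) e] .
  obtain i j where ij: "sup_dist h m - e/2 \<le> E i j - h i - m j"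
    using sup_dist_approx[OF assms(3,4) e] .
  show "sup_dist f g + sup_dist h m
      \<le> max (sup_dist f h + sup_dist g m) (sup_dist f m + sup_dist g h) + e"
    using kl ij E_four[of k l i j] E_le_sup_dist[OF assms(1,3), of k i]
      E_le_sup_dist[OF assms(2,4), of l j] E_le_sup_dist[OF assms(1,4), of k j]
      E_le_sup_dist[OF assms(2,3), of l i] by linarith
qed

lemma sup_dist_le1:
  assumes "f \<in> tight_span E" "g \<in> tight_span E"
  shows "sup_dist f g \<le> 1"
proof (rule sup_dist_le)
  fix i show "\<bar>f i - g i\<bar> \<le> 1"
    using assms[THEN span_nonneg, of i] assms[THEN span_le1, of i] by linarith
qed

text \<open>Rows embed the given points (Kuratowski). The point \<open>i\<close> lies on every
  segment that ends in it, so \<open>i\<close> itself is the tight partner.\<close>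

lemma row_in_span: "E i \<in> tight_span E"
proof -
  have "\<exists>j. E i k + E i j \<le> E k j + e" if "0 < e" for k and e :: real
    using that E_sym[of k i] by (intro exI[of _ i]) simp
  then show ?thesis using E_tri[of _ _ i] E_sym[of i] by (auto simp: tight_span_def)
qed

lemma sup_dist_row:
  assumes "f \<in> tight_span E"
  shows "sup_dist f (E i) = f i"
proof (rule antisym)
  show "sup_dist f (E i) \<le> f i"
  proof (rule sup_dist_le)
    fix k show "\<bar>f k - E i k\<bar> \<le> f i"
      using span_ge[OF assms, of i k] span_lip[OF assms, of k i] E_sym[of i k] by simp
  qed
  show "f i \<le> sup_dist f (E i)"
    using abs_le_sup_dist[OF assms row_in_span, of i i] by simp
qed

section \<open>Geodesics, completeness and separation in the span\<close>

text \<open>The triangle inequality through \<open>f\<close> and through \<open>g\<close> gives two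
  lower bounds for the distance from \<open>k\<close> to the point at distance \<open>s\<close> from
  \<open>f\<close>. In a tree the larger one is exact: which one depends on where the way to
  \<open>k\<close> leaves the segment.\<close>

definition geodesic :: "(nat \<Rightarrow> real) \<Rightarrow> (nat \<Rightarrow> real) \<Rightarrow> real \<Rightarrow> nat \<Rightarrow> real" where
  "geodesic f g s k = max (f k - s) (g k - (sup_dist f g - s))"

text \<open>This covers the mixed case of the first span condition for a geodesic, in which
  coordinate \<open>i\<close> is bounded through one end and \<open>j\<close> through the other, so
  that \<open>s\<close> cancels.\<close>

lemma four_point_ends:
  assumes "f \<in> tight_span E" "g \<in> tight_span E"
  shows "E i j + sup_dist f g \<le> max (f i + g j) (g i + f j)"
proof (rule field_le_epsilon)
  fix e :: real assume "0 < e"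
  then obtain k l where kl: "sup_dist f g - e \<le> E k l - f k - g l"
    using sup_dist_approx assms by blast
  show "E i j + sup_dist f g \<le> max (f i + g j) (g i + f j) + e"
    using kl E_four[of i j k l] span_ge[OF assms(1), of i k] span_ge[OF assms(2), of j l]
      span_ge[OF assms(2), of i l] span_ge[OF assms(1), of j k] by linarith
qed

lemma geodesic_in_span:
  assumes "f \<in> tight_span E" "g \<in> tight_span E" "0 \<le> s" "s \<le> sup_dist f g"
  shows "geodesic f g s \<in> tight_span E"
proof -
  have d: "\<bar>f i - g i\<bar> \<le> sup_dist f g" for i
    using abs_le_sup_dist[OF assms(1,2)] .
  have "E i j \<le> geodesic f g s i + geodesic f g s j" for i j
    unfolding geodesic_def using four_point_ends[OF assms(1,2), of i j] by linarith
  \<comment> \<open>The partner of \<open>i\<close> comes from the end that realises the maximum at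
    \<open>i\<close>. Relative to that end, coordinate \<open>i\<close> drops by the distance to it,
    and coordinate \<open>j\<close> rises by at most the same amount.\<close>
  moreover have "\<exists>j. geodesic f g s i + geodesic f g s j \<le> E i j + e" if e: "0 < e" for i e
  proof (cases "f i - s \<le> g i - (sup_dist f g - s)")
    case True
    obtain j where "g i + g j \<le> E i j + e" using span_tight assms(2) e by blast
    then show ?thesis
      using True d[of j] assms(3,4) by (intro exI[of _ j]) (simp add: geodesic_def)
  next
    case False
    obtain j where "f i + f j \<le> E i j + e" using span_tight assms(1) e by blast
    then show ?thesis
      using False d[of j] assms(3,4) by (intro exI[of _ j]) (simp add: geodesic_def)
  qed
  ultimately show ?thesis by (auto simp: tight_span_def)
qed

lemma geodesic_ends:
  assumes "f \<in> tight_span E" "g \<in> tight_span E"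
  shows "geodesic f g 0 = f" "geodesic f g (sup_dist f g) = g"
  using abs_le_sup_dist[OF assms] by (auto simp: geodesic_def fun_eq_iff max_def abs_le_iff) (smt (verit))+

text \<open>Each coordinate is 1-Lipschitz in the parameter, which gives the upper bound. A strict
  inequality would make the way from \<open>f\<close> to \<open>g\<close> through both points
  shorter than \<open>sup_dist f g\<close>.\<close>

lemma geodesic_isometric:
  assumes "f \<in> tight_span E" "g \<in> tight_span E" "0 \<le> s" "s \<le> sup_dist f g" "0 \<le> t" "t \<le> sup_dist f g"
  shows "sup_dist (geodesic f g s) (geodesic f g t) = \<bar>s - t\<bar>"
proof (rule antisym)
  show "sup_dist (geodesic f g s) (geodesic f g t) \<le> \<bar>s - t\<bar>"
    by (rule sup_dist_le) (auto simp: geodesic_def)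
  have le: "sup_dist f g \<le> sup_dist f (geodesic f g u) + sup_dist (geodesic f g u) (geodesic f g v)
      + sup_dist (geodesic f g v) g"
    if "0 \<le> u" "u \<le> sup_dist f g" "0 \<le> v" "v \<le> sup_dist f g" for u v
    using triangle[of f "geodesic f g u" g] triangle[of "geodesic f g u" "geodesic f g v" g]
      geodesic_in_span[OF assms(1,2)] that assms(1,2) by fastforce
  have a: "sup_dist f (geodesic f g u) \<le> u" "sup_dist (geodesic f g u) g \<le> sup_dist f g - u"
    if "0 \<le> u" "u \<le> sup_dist f g" for u
    using abs_le_sup_dist[OF assms(1,2)] that
    by (auto intro!: sup_dist_le simp: geodesic_def abs_le_iff max_def) (smt (verit))+
  show "\<bar>s - t\<bar> \<le> sup_dist (geodesic f g s) (geodesic f g t)"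
  proof (cases "s \<le> t")
    case True
    then show ?thesis using le[of s t] a(1)[of s] a(2)[of t] assms by simp
  next
    case False
    then show ?thesis
      using le[of t s] a(1)[of t] a(2)[of s] assms sup_dist_commute[of "geodesic f g t"] by simp
  qed
qed

text \<open>Convergence is uniform in the coordinates. Tightness survives because the partner
  \<open>j\<close> found for one late term \<open>\<sigma> N\<close> still works for the limit, at
  the cost of two further errors \<open>e/3\<close>.\<close>

lemma span_complete: "mcomplete"
  unfolding mcomplete_def
proof (intro allI impI)
  fix \<sigma> assume cau: "MCauchy \<sigma>"
  then have mem: "\<sigma> n \<in> tight_span E" for n by (auto simp: MCauchy_def)
  have d: "\<bar>\<sigma> m i - \<sigma> n i\<bar> \<le> sup_dist (\<sigma> m) (\<sigma> n)" for m n i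
    using abs_le_sup_dist[OF mem mem] .
  have "Cauchy (\<lambda>n. \<sigma> n i)" for i
  proof (rule CauchyI)
    fix e :: real assume "0 < e"
    then obtain N where "\<And>n n'. N \<le> n \<Longrightarrow> N \<le> n' \<Longrightarrow> sup_dist (\<sigma> n) (\<sigma> n') < e"
      using cau unfolding MCauchy_def by blast
    then show "\<exists>M. \<forall>m\<ge>M. \<forall>n\<ge>M. norm (\<sigma> m i - \<sigma> n i) < e"
      using d by (intro exI[of _ N]) (auto intro: le_less_trans[OF d])
  qed
  then have "\<forall>i. \<exists>l. (\<lambda>n. \<sigma> n i) \<longlonglongrightarrow> l"
    using real_Cauchy_convergent convergent_def by blast
  then obtain l where l: "\<And>i. (\<lambda>n. \<sigma> n i) \<longlonglongrightarrow> l i" by metis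
  have unif: "\<exists>N. \<forall>n\<ge>N. \<forall>i. \<bar>\<sigma> n i - l i\<bar> \<le> e" if "0 < e" for e
  proof -
    obtain N where N: "\<And>n n'. N \<le> n \<Longrightarrow> N \<le> n' \<Longrightarrow> sup_dist (\<sigma> n) (\<sigma> n') < e"
      using cau \<open>0 < e\<close> unfolding MCauchy_def by blast
    have "\<bar>\<sigma> n i - l i\<bar> \<le> e" if "N \<le> n" for n i
    proof (rule LIMSEQ_le_const2)
      show "(\<lambda>m. \<bar>\<sigma> n i - \<sigma> m i\<bar>) \<longlonglongrightarrow> \<bar>\<sigma> n i - l i\<bar>"
        by (intro tendsto_intros l)
      show "\<exists>M. \<forall>m\<ge>M. \<bar>\<sigma> n i - \<sigma> m i\<bar> \<le> e"
        using N[OF that] d by (intro exI[of _ N]) (auto intro!: less_imp_le intro: le_less_trans[OF d])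
    qed
    then show ?thesis by blast
  qed
  have "l \<in> tight_span E"
    unfolding tight_span_def
  proof (intro CollectI conjI allI impI)
    fix i j
    show "E i j \<le> l i + l j"
      by (rule LIMSEQ_le_const[of "\<lambda>n. \<sigma> n i + \<sigma> n j"])
         (use mem[THEN span_ge] in \<open>auto intro!: tendsto_add l\<close>)
  next
    fix i and e :: real assume "0 < e"
    then have e: "0 < e/3" by simp
    then obtain N where N: "\<And>i. \<bar>\<sigma> N i - l i\<bar> \<le> e/3" using unif by blast
    obtain j where "\<sigma> N i + \<sigma> N j \<le> E i j + e/3" using span_tight[OF mem e] .
    then have "l i + l j \<le> E i j + e" using N[of i] N[of j] by linarith
    then show "\<exists>j. l i + l j \<le> E i j + e" by blast
  qed
  moreover have "\<exists>N. \<forall>n\<ge>N. \<sigma> n \<in> tight_span E \<and> sup_dist (\<sigma> n) l < e" if "0 < e" for e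
  proof -
    obtain N where N: "\<And>n i. N \<le> n \<Longrightarrow> \<bar>\<sigma> n i - l i\<bar> \<le> e/2"
      using unif[of "e/2"] \<open>0 < e\<close> by auto
    have "sup_dist (\<sigma> n) l < e" if "N \<le> n" for n
    proof -
      have "sup_dist (\<sigma> n) l \<le> e/2" by (rule sup_dist_le) (rule N[OF that])
      then show ?thesis using \<open>0 < e\<close> by simp
    qed
    then show ?thesis using mem by blast
  qed
  ultimately show "\<exists>x. limitin mtopology \<sigma> x sequentially"
    unfolding limit_metric_sequentially by blast
qed

text \<open>By the four-point condition, \<open>sup_dist h m < sup_dist h p + sup_dist p m\<close> is an equivalence on the
  complement of \<open>p\<close>; its classes are open, hence clopen.\<close>

lemma separated_by_midpoint:
  assumes f: "f \<in> tight_span E" and p: "p \<in> tight_span E"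
    and eq: "sup_dist f g = sup_dist f p + sup_dist p g" and "f \<noteq> p" "g \<noteq> p"
  shows "\<not> connected_component_of (subtopology mtopology (tight_span E - {p})) f g"
proof
  assume "connected_component_of (subtopology mtopology (tight_span E - {p})) f g"
  then obtain C where C: "connectedin mtopology C" "C \<subseteq> tight_span E - {p}" "f \<in> C" "g \<in> C"
    by (auto simp: connected_component_of_def connectedin_subtopology)
  define U where "U = {h \<in> tight_span E. sup_dist f h < sup_dist f p + sup_dist p h}"
  define W where "W = {h \<in> tight_span E. h \<noteq> p \<and> sup_dist f h = sup_dist f p + sup_dist p h}"
  have "openin mtopology U"
    unfolding openin_mtopology
  proof (intro conjI allI impI)
    fix h assume h: "h \<in> U"
    define r where "r = (sup_dist f p + sup_dist p h - sup_dist f h) / 2"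
    have "mball h r \<subseteq> U"
    proof
      fix m assume "m \<in> mball h r"
      then have m: "m \<in> tight_span E" "sup_dist h m < r" "h \<in> tight_span E" by auto
      then show "m \<in> U"
        using triangle[of f h m] triangle[of p m h] f p sup_dist_commute[of h m]
        by (simp add: U_def r_def)
    qed
    moreover have "0 < r" using h by (simp add: U_def r_def)
    ultimately show "\<exists>r>0. mball h r \<subseteq> U" by blast
  qed (auto simp: U_def)
  moreover have "openin mtopology W"
    unfolding openin_mtopology
  proof (intro conjI allI impI)
    fix h assume h: "h \<in> W"
    define r where "r = sup_dist p h"
    have "mball h r \<subseteq> W"
    proof
      fix m assume "m \<in> mball h r"
      then have m: "m \<in> tight_span E" "sup_dist h m < r" "h \<in> tight_span E" by auto
      then have "m \<noteq> p" using sup_dist_commute[of h p] by (auto simp: r_def)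
      \<comment> \<open>The second alternative of the maximum is too small, because \<open>m\<close>
        is closer to \<open>h\<close> than \<open>p\<close> is; the first one puts \<open>p\<close>
        between \<open>f\<close> and \<open>m\<close>.\<close>
      moreover have "sup_dist f h + sup_dist m p \<le> max (sup_dist f m + sup_dist h p) (sup_dist f p + sup_dist h m)"
        using sup_dist_four_point[of f h m p] m f p by simp
      then have "sup_dist f p + sup_dist p m \<le> sup_dist f m"
        using h m(2) mdist_pos_less[OF \<open>m \<noteq> p\<close> m(1) p] sup_dist_commute[of m p] sup_dist_commute[of h p]
        by (auto simp: W_def r_def)
      ultimately show "m \<in> W"
        using m triangle[OF f p m(1)] by (simp add: W_def)
    qed
    moreover have "0 < r" using h p by (auto simp: W_def r_def)
    ultimately show "\<exists>r>0. mball h r \<subseteq> W" by blast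
  qed (auto simp: W_def)
  moreover have "C \<subseteq> U \<union> W"
  proof
    fix h assume "h \<in> C"
    then show "h \<in> U \<union> W" using C(2) triangle[OF f p, of h] by (auto simp: U_def W_def)
  qed
  moreover have "f \<in> U" "g \<in> W" "U \<inter> W = {}"
    using f p \<open>f \<noteq> p\<close> \<open>g \<noteq> p\<close> C eq mdist_pos_less[OF \<open>f \<noteq> p\<close> f p] sup_dist_commute[of f p]
    by (auto simp: U_def W_def)
  ultimately show False using C(1,3,4) unfolding connectedin by blast
qed

text \<open>Strictness in the triangle inequality keeps \<open>p\<close> off the geodesic, whose
  image is then a connected set joining \<open>f\<close> to \<open>g\<close> outside
  \<open>p\<close>.\<close>

lemma geodesic_connects:
  assumes f: "f \<in> tight_span E" and g: "g \<in> tight_span E" and p: "p \<in> tight_span E"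
    and less: "sup_dist f g < sup_dist f p + sup_dist p g"
  shows "connected_component_of (subtopology mtopology (tight_span E - {p})) f g"
proof -
  let ?I = "{0..sup_dist f g}"
  have "continuous_map (top_of_set ?I) mtopology (geodesic f g)"
    unfolding continuous_map_to_metric
  proof (intro ballI allI impI)
    fix x and e :: real assume x: "x \<in> topspace (top_of_set ?I)" and "0 < e"
    show "\<exists>U. openin (top_of_set ?I) U \<and> x \<in> U \<and> (\<forall>y\<in>U. geodesic f g y \<in> mball (geodesic f g x) e)"
    proof (intro exI conjI ballI)
      show "openin (top_of_set ?I) (?I \<inter> ball x e)" by auto
      fix y assume "y \<in> ?I \<inter> ball x e"
      then show "geodesic f g y \<in> mball (geodesic f g x) e"
        using x geodesic_in_span[OF f g] geodesic_isometric[OF f g, of x y] by (auto simp: dist_real_def)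
    qed (use x \<open>0 < e\<close> in auto)
  qed
  then have "connectedin mtopology (geodesic f g ` ?I)"
    by (rule connectedin_continuous_map_image) (simp add: connectedin_absolute)
  moreover have "geodesic f g s \<noteq> p" if "0 \<le> s" "s \<le> sup_dist f g" for s
  proof
    assume "geodesic f g s = p"
    then have "sup_dist f p = s" "sup_dist p g = sup_dist f g - s"
      using geodesic_isometric[OF f g, of 0 s] geodesic_isometric[OF f g, of s "sup_dist f g"] that
      by (simp_all add: geodesic_ends[OF f g])
    then show False using less by simp
  qed
  ultimately have "connectedin (subtopology mtopology (tight_span E - {p})) (geodesic f g ` ?I)"
    using geodesic_in_span[OF f g] by (simp add: connectedin_subtopology image_subset_iff)
  moreover have "f \<in> geodesic f g ` ?I"
    by (rule image_eqI[of _ _ 0]) (simp_all add: geodesic_ends[OF f g] sup_dist_nonneg)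
  moreover have "g \<in> geodesic f g ` ?I"
    by (rule image_eqI[of _ _ "sup_dist f g"]) (simp_all add: geodesic_ends[OF f g] sup_dist_nonneg)
  ultimately show ?thesis unfolding connected_component_of_def by blast
qed

definition span_metric :: "(nat \<Rightarrow> real) metric" where
  "span_metric = metric (tight_span E, sup_dist)"

lemma span_metric_simps [simp]:
  "mspace span_metric = tight_span E" "mdist span_metric = sup_dist"
  "mtopology_of span_metric = mtopology"
  by (simp_all add: span_metric_def)

lemma real_tree_span: "real_tree span_metric"
  unfolding real_tree_def
proof (intro conjI ballI impI)
  show "mspace span_metric \<noteq> {}" using row_in_span by auto
  show "mcomplete_of span_metric" using span_complete by (simp add: span_metric_def)
  fix p q assume pq: "p \<in> mspace span_metric" "q \<in> mspace span_metric" "p \<noteq> q"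
  then have p: "p \<in> tight_span E" and q: "q \<in> tight_span E" by auto
  have "\<not> connected_component_of (subtopology mtopology (tight_span E - {geodesic p q c})) p q"
    if c: "0 < c" "c < sup_dist p q" for c
  proof (rule separated_by_midpoint[OF p])
    have e: "sup_dist p (geodesic p q c) = c" "sup_dist (geodesic p q c) q = sup_dist p q - c"
      using geodesic_isometric[OF p q, of 0 c] geodesic_isometric[OF p q, of c "sup_dist p q"]
        c by (simp_all add: geodesic_ends[OF p q])
    then show "sup_dist p q = sup_dist p (geodesic p q c) + sup_dist (geodesic p q c) q" by simp
    show m: "geodesic p q c \<in> tight_span E" using geodesic_in_span[OF p q] c by simp
    show "p \<noteq> geodesic p q c" "q \<noteq> geodesic p q c"
      using e c mdist_zero[OF m] by auto
  qed
  then show "\<exists>a b \<alpha>. a \<le> b \<and> \<alpha> \<in> {a..b} \<rightarrow> mspace span_metric \<and>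
      (\<forall>s\<in>{a..b}. \<forall>t\<in>{a..b}. mdist span_metric (\<alpha> s) (\<alpha> t) = dist s (t::real)) \<and>
      \<alpha> a = p \<and> \<alpha> b = q \<and>
      (\<forall>c. a < c \<and> c < b \<longrightarrow>
        \<not> connected_component_of
          (subtopology (mtopology_of span_metric) (mspace span_metric - {\<alpha> c})) p q)"
    using sup_dist_nonneg[of p q] geodesic_in_span[OF p q] geodesic_isometric[OF p q] geodesic_ends[OF p q]
    by - (rule exI[of _ 0], rule exI[of _ "sup_dist p q"], rule exI[of _ "geodesic p q"],
        auto simp: dist_real_def)
qed

section \<open>Branches of the span\<close>

text \<open>This reduces positivity of all branches to positivity of balls around the generating
  points. A pair \<open>k\<close>, \<open>l\<close> that nearly realises the distance from
  \<open>f\<close> to \<open>p\<close> has \<open>k\<close> on the side of \<open>f\<close>, so the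
  row \<open>E k\<close> lies in the branch; the ball around it that just misses \<open>p\<close>
  stays there.\<close>

lemma branch_contains_row_ball:
  assumes "B \<in> branches span_metric"
  obtains i r where "0 < r" "mball (E i) r \<subseteq> B"
proof -
  obtain p f where p: "p \<in> tight_span E" and f: "f \<in> tight_span E" "f \<noteq> p"
    and B: "B = connected_component_of_set (subtopology mtopology (tight_span E - {p})) f"
    using assms by (auto simp: branches_def branches_at_def connected_components_of_def)
  have "0 < sup_dist f p" using mdist_pos_less f p by blast
  then obtain k l where kl: "sup_dist f p - sup_dist f p / 2 \<le> E k l - f k - p l"
    using sup_dist_approx[OF f(1) p, of "sup_dist f p / 2"] by auto
  have "E k l \<le> p k + p l" using span_ge[OF p] .
  then have "f k < sup_dist f p + p k" using kl \<open>0 < sup_dist f p\<close> by linarith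
  then have "sup_dist f (E k) < sup_dist f p + sup_dist p (E k)"
    using sup_dist_row f p by simp
  then have k: "connected_component_of (subtopology mtopology (tight_span E - {p})) f (E k)"
    using geodesic_connects f p row_in_span by blast
  then have "E k \<noteq> p" using connected_component_in_topspace by fastforce
  then have r: "0 < sup_dist p (E k)" using mdist_pos_less p row_in_span by metis
  have "mball (E k) (sup_dist p (E k)) \<subseteq> B"
  proof
    fix h assume h: "h \<in> mball (E k) (sup_dist p (E k))"
    then have "sup_dist (E k) h < sup_dist (E k) p + sup_dist p h"
      using sup_dist_nonneg[of p h] sup_dist_commute[of p "E k"]
      unfolding in_mball by linarith
    then have "connected_component_of (subtopology mtopology (tight_span E - {p})) (E k) h"
      using geodesic_connects[of "E k" h p] row_in_span p h by auto
    then show "h \<in> B" unfolding B using k connected_component_of_trans by fastforce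
  qed
  then show ?thesis using that r by blast
qed

text \<open>A geodesic to a point closer to \<open>h\<close> than \<open>p\<close> is cannot pass
  through \<open>p\<close>. Openness is what makes the cylinder over a branch a Borel set.\<close>

lemma openin_branch:
  assumes "B \<in> branches span_metric"
  shows "openin mtopology B"
proof -
  obtain p f where p: "p \<in> tight_span E"
    and B: "B = connected_component_of_set (subtopology mtopology (tight_span E - {p})) f"
    using assms by (auto simp: branches_def branches_at_def connected_components_of_def)
  have sub: "B \<subseteq> tight_span E - {p}"
    unfolding B using connected_component_of_subset_topspace[of "subtopology mtopology (tight_span E - {p})" f] by auto
  show ?thesis
    unfolding openin_mtopology
  proof (intro conjI allI impI)
    fix h assume h: "h \<in> B"
    then have hp: "h \<in> tight_span E" "h \<noteq> p" using sub by auto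
    have "mball h (sup_dist h p) \<subseteq> B"
    proof
      fix m assume m: "m \<in> mball h (sup_dist h p)"
      then have "sup_dist h m < sup_dist h p + sup_dist p m"
        using sup_dist_nonneg[of p m] unfolding in_mball by linarith
      then have "connected_component_of (subtopology mtopology (tight_span E - {p})) h m"
        using geodesic_connects[of h m p] p m by auto
      then show "m \<in> B" using h connected_component_of_trans unfolding B by fastforce
    qed
    then show "\<exists>r>0. mball h r \<subseteq> B" using mdist_pos_less[OF hp(2) hp(1) p] by blast
  qed (use sub in auto)
qed

end

section \<open>Coupling uniform vertices along a subsequence\<close>

text \<open>The curve codes a vertex by one real number, so that the one-dimensional theorems of Helly and
  Skorohod apply to infinitely many coordinates at once.\<close>

lemma uniform_coordinates_limit:
  fixes V :: "nat \<Rightarrow> 'a set" and \<phi> :: "nat \<Rightarrow> nat \<Rightarrow> 'a \<Rightarrow> real"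
  assumes V: "\<And>n. finite (V n)" "\<And>n. V n \<noteq> {}"
    and \<phi>: "\<And>n j x. x \<in> V n \<Longrightarrow> 0 \<le> \<phi> n j x \<and> \<phi> n j x \<le> 1"
  obtains s :: "nat \<Rightarrow> nat" and \<Omega> :: "real measure" and X \<Phi> where
    "strict_mono s" "prob_space \<Omega>"
    "\<And>n. X n \<in> \<Omega> \<rightarrow>\<^sub>M count_space (V (s n))"
    "\<And>n. distr \<Omega> (count_space (V (s n))) (X n) = uniform_count_measure (V (s n))"
    "\<And>j. \<Phi> j \<in> borel_measurable \<Omega>"
    "\<And>\<omega> j. \<omega> \<in> space \<Omega> \<Longrightarrow> (\<lambda>n. \<phi> (s n) j (X n \<omega>)) \<longlonglongrightarrow> \<Phi> j \<omega>"
proof -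
  text \<open>The zeroth coordinate makes the code injective, so that a vertex can be recovered from its code.\<close>
  define \<psi> where "\<psi> n x j = (case j of 0 \<Rightarrow> 1 / (1 + real (to_nat_on (V n) x)) | Suc j \<Rightarrow> \<phi> n j x)"
    for n x j
  have "\<exists>t. 0 \<le> t \<and> t \<le> 1 \<and> (\<forall>j. schoenberg j t = \<psi> n x j)" if "x \<in> V n" for n x
  proof -
    have "0 \<le> \<psi> n x j \<and> \<psi> n x j \<le> 1" for j
      using \<phi>[OF that] by (cases j) (auto simp: \<psi>_def)
    then show ?thesis using schoenberg_surj[of "\<psi> n x"] by metis
  qed
  then have "\<forall>n x. \<exists>t. x \<in> V n \<longrightarrow> 0 \<le> t \<and> t \<le> 1 \<and> (\<forall>j. schoenberg j t = \<psi> n x j)"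
    by blast
  then have "\<exists>t. \<forall>n x. x \<in> V n \<longrightarrow> 0 \<le> t n x \<and> t n x \<le> 1 \<and> (\<forall>j. schoenberg j (t n x) = \<psi> n x j)"
    by (simp only: choice_iff)
  then obtain t where t: "\<And>n x. x \<in> V n \<Longrightarrow> 0 \<le> t n x \<and> t n x \<le> 1 \<and> (\<forall>j. schoenberg j (t n x) = \<psi> n x j)"
    by blast
  have t_inj: "inj_on (t n) (V n)" for n
  proof (rule inj_onI)
    fix x y assume xy: "x \<in> V n" "y \<in> V n" "t n x = t n y"
    then have "\<psi> n x 0 = \<psi> n y 0" using t by metis
    then have "to_nat_on (V n) x = to_nat_on (V n) y" by (simp add: \<psi>_def)
    then show "x = y" using xy V countable_finite by (metis inj_onD inj_on_to_nat_on)
  qed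
  define U where "U n = uniform_count_measure (V n)" for n
  have U: "prob_space (U n)" "space (U n) = V n" "sets (U n) = Pow (V n)" for n
    using V by (auto simp: U_def space_uniform_count_measure sets_uniform_count_measure
        intro: prob_space_uniform_count_measure)
  have tm: "t n \<in> borel_measurable (U n)" for n
    by (auto simp: measurable_def U)
  define \<mu> where "\<mu> n = distr (U n) borel (t n)" for n
  have \<mu>: "real_distribution (\<mu> n)" for n
    unfolding \<mu>_def by (intro prob_space.real_distribution_distr U) (use tm in auto)
  have "tight \<mu>"
    unfolding tight_def
  proof (intro conjI allI impI \<mu>)
    fix e :: real assume "0 < e"
    \<comment> \<open>Tightness is stated with intervals open on the left, and a code may equal
      0.\<close>
    have "measure (\<mu> n) {-1<..1} = 1" for n
    proof -
      have "t n -` {-1<..1} \<inter> space (U n) = space (U n)"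
        using t by (fastforce simp: U)
      then show ?thesis
        by (simp add: \<mu>_def measure_distr[OF tm] prob_space.prob_space[OF U(1)])
    qed
    then show "\<exists>a b. a < b \<and> (\<forall>n. 1 - e < measure (\<mu> n) {a<..b})"
      using \<open>0 < e\<close> by (intro exI[of _ "-1"] exI[of _ 1]) auto
  qed
  then obtain s M where s: "strict_mono s" and M: "real_distribution M" "weak_conv_m (\<mu> \<circ> id \<circ> s) M"
    using tight_imp_convergent_subsubsequence[of \<mu> id] strict_mono_id by blast
  have \<mu>s: "real_distribution ((\<mu> \<circ> id \<circ> s) n)" for n using \<mu> by simp
  obtain \<Omega> :: "real measure" and Yn Y where \<Omega>: "prob_space \<Omega>"
    and Yn: "\<And>n. Yn n \<in> borel_measurable \<Omega>" "\<And>n. distr \<Omega> borel (Yn n) = \<mu> (s n)"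
    and Y': "Y \<in> \<Omega> \<rightarrow>\<^sub>M lborel" and Ylim: "\<And>\<omega>. \<omega> \<in> space \<Omega> \<Longrightarrow> (\<lambda>n. Yn n \<omega>) \<longlonglongrightarrow> Y \<omega>"
    using Skorohod[OF \<mu>s M] unfolding comp_apply id_apply by blast
  have Y: "Y \<in> borel_measurable \<Omega>" using Y' by simp
  interpret prob_space \<Omega> by fact
  \<comment> \<open>The variables from Skorohod's theorem take codes of vertices as values only
    almost surely. The map \<open>\<pi>\<close> below sends the exceptional null set to one point of
    \<open>G\<close>, which makes \<open>X\<close> total and keeps the convergence at every
    point.\<close>
  define G where "G = {\<omega> \<in> space \<Omega>. \<forall>n. Yn n \<omega> \<in> t (s n) ` V (s n)}"
  have fin: "t (s n) ` V (s n) \<in> sets borel" for n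
    using V by (intro borel_closed finite_imp_closed) auto
  have emY: "emeasure \<Omega> (Yn n -` A \<inter> space \<Omega>) = emeasure (U (s n)) (t (s n) -` A \<inter> V (s n))"
    if "A \<in> sets borel" for n A
    using emeasure_distr[OF Yn(1) that, of n] emeasure_distr[OF tm that, of "s n"]
    by (simp add: Yn(2) \<mu>_def U)
  have Gm: "G \<in> sets \<Omega>"
    unfolding G_def using Yn(1) fin by measurable
  have G_AE: "AE \<omega> in \<Omega>. \<omega> \<in> G"
  proof -
    have "AE \<omega> in \<Omega>. Yn n \<omega> \<in> t (s n) ` V (s n)" for n
    proof (rule AE_I_eq_1)
      have "{\<omega> \<in> space \<Omega>. Yn n \<omega> \<in> t (s n) ` V (s n)} = Yn n -` (t (s n) ` V (s n)) \<inter> space \<Omega>"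
        by auto
      moreover have "t (s n) -` (t (s n) ` V (s n)) \<inter> V (s n) = V (s n)" by auto
      ultimately show "emeasure \<Omega> {\<omega> \<in> space \<Omega>. Yn n \<omega> \<in> t (s n) ` V (s n)} = 1"
        using emY[OF fin] prob_space.emeasure_space_1[OF U(1), of "s n"] by (simp add: U)
      show "{\<omega> \<in> space \<Omega>. Yn n \<omega> \<in> t (s n) ` V (s n)} \<in> sets \<Omega>"
        using Yn(1) fin by measurable
    qed
    then have "AE \<omega> in \<Omega>. \<forall>n. Yn n \<omega> \<in> t (s n) ` V (s n)" by (simp add: AE_all_countable)
    then show ?thesis by (rule AE_mp) (auto simp: G_def intro!: AE_I2)
  qed
  have "G \<noteq> {}"
    using G_AE AE_False by auto
  then obtain \<omega>0 where \<omega>0: "\<omega>0 \<in> G" by blast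
  define \<pi> where "\<pi> \<omega> = (if \<omega> \<in> G then \<omega> else \<omega>0)" for \<omega>
  have \<pi>G: "\<pi> \<omega> \<in> G" for \<omega> using \<omega>0 by (simp add: \<pi>_def)
  have G_space: "G \<subseteq> space \<Omega>" by (auto simp: G_def)
  have \<pi>m: "\<pi> \<in> \<Omega> \<rightarrow>\<^sub>M \<Omega>"
    unfolding \<pi>_def using Gm G_space \<omega>0 by (intro measurable_If_set) auto
  have \<pi>AE: "AE \<omega> in \<Omega>. \<pi> \<omega> = \<omega>"
    using G_AE by (auto simp: \<pi>_def elim: AE_mp)
  define X where "X n \<omega> = the_inv_into (V (s n)) (t (s n)) (Yn n (\<pi> \<omega>))" for n \<omega>
  have YG: "Yn n (\<pi> \<omega>) \<in> t (s n) ` V (s n)" for n \<omega>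
    using \<pi>G[of \<omega>] by (auto simp: G_def)
  have XV: "X n \<omega> \<in> V (s n)" for n \<omega>
    unfolding X_def by (rule the_inv_into_into[OF t_inj YG]) simp
  have tX: "t (s n) (X n \<omega>) = Yn n (\<pi> \<omega>)" for n \<omega>
    unfolding X_def by (rule f_the_inv_into_f[OF t_inj YG])
  have Yn\<pi>: "(\<lambda>\<omega>. Yn n (\<pi> \<omega>)) \<in> borel_measurable \<Omega>" for n
    by (rule measurable_compose[OF \<pi>m Yn(1)])
  have Xpre: "X n -` {x} \<inter> space \<Omega> = (\<lambda>\<omega>. Yn n (\<pi> \<omega>)) -` {t (s n) x} \<inter> space \<Omega>"
    if "x \<in> V (s n)" for n x
  proof -
    have "X n \<omega> = x \<longleftrightarrow> Yn n (\<pi> \<omega>) = t (s n) x" for \<omega>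
      using inj_on_eq_iff[OF t_inj XV that, of \<omega>] tX[of n \<omega>] by simp
    then show ?thesis by auto
  qed
  have Xm: "X n \<in> \<Omega> \<rightarrow>\<^sub>M count_space (V (s n))" for n
  proof (subst measurable_count_space_eq2[OF V(1)], intro conjI ballI)
    show "X n \<in> space \<Omega> \<rightarrow> V (s n)" using XV by auto
    fix x assume x: "x \<in> V (s n)"
    show "X n -` {x} \<inter> space \<Omega> \<in> sets \<Omega>"
      unfolding Xpre[OF x] using measurable_sets[OF Yn\<pi>, of "{t (s n) x}" n] by simp
  qed
  have Xd: "distr \<Omega> (count_space (V (s n))) (X n) = uniform_count_measure (V (s n))" for n
  proof (rule measure_eqI_finite[OF _ _ V(1)])
    fix x assume x: "x \<in> V (s n)"
    have "emeasure (distr \<Omega> (count_space (V (s n))) (X n)) {x} = emeasure \<Omega> (X n -` {x} \<inter> space \<Omega>)"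
      by (rule emeasure_distr[OF Xm]) (use x in auto)
    also have "\<dots> = emeasure \<Omega> (Yn n -` {t (s n) x} \<inter> space \<Omega>)"
      unfolding Xpre[OF x]
    proof (rule emeasure_eq_AE)
      show "AE \<omega> in \<Omega>. (\<omega> \<in> (\<lambda>\<omega>. Yn n (\<pi> \<omega>)) -` {t (s n) x} \<inter> space \<Omega>)
          \<longleftrightarrow> (\<omega> \<in> Yn n -` {t (s n) x} \<inter> space \<Omega>)"
        using \<pi>AE by (rule AE_mp) (auto intro!: AE_I2)
    qed (use measurable_sets[OF Yn\<pi>, of "{t (s n) x}"] measurable_sets[OF Yn(1), of "{t (s n) x}"] in auto)
    also have "\<dots> = emeasure (U (s n)) (t (s n) -` {t (s n) x} \<inter> V (s n))"
      by (rule emY) simp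
    also have "t (s n) -` {t (s n) x} \<inter> V (s n) = {x}"
      using x t_inj by (auto dest: inj_onD)
    finally show "emeasure (distr \<Omega> (count_space (V (s n))) (X n)) {x}
        = emeasure (uniform_count_measure (V (s n))) {x}"
      by (simp add: U_def)
  qed (auto simp: sets_uniform_count_measure)
  \<comment> \<open>Coordinate 0 of the curve holds the vertex number, so coordinate
    \<open>j\<close> of \<open>\<phi>\<close> sits at \<open>Suc j\<close>.\<close>
  define \<Phi> where "\<Phi> j \<omega> = schoenberg (Suc j) (Y (\<pi> \<omega>))" for j \<omega>
  have "\<Phi> j \<in> borel_measurable \<Omega>" for j
    unfolding \<Phi>_def
    by (rule borel_measurable_continuous_on[OF continuous_schoenberg measurable_compose[OF \<pi>m Y]])
  moreover have "(\<lambda>n. \<phi> (s n) j (X n \<omega>)) \<longlonglongrightarrow> \<Phi> j \<omega>" if "\<omega> \<in> space \<Omega>" for \<omega> j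
  proof -
    have "\<phi> (s n) j (X n \<omega>) = schoenberg (Suc j) (Yn n (\<pi> \<omega>))" for n
      using t[OF XV, of n \<omega>] tX[of n \<omega>] by (simp add: \<psi>_def)
    moreover have "(\<lambda>n. schoenberg (Suc j) (Yn n (\<pi> \<omega>))) \<longlonglongrightarrow> schoenberg (Suc j) (Y (\<pi> \<omega>))"
      by (rule continuous_on_tendsto_compose[OF continuous_schoenberg Ylim])
         (use \<pi>G G_space in auto)
    ultimately show ?thesis by (simp add: \<Phi>_def)
  qed
  ultimately show ?thesis using that[OF s \<Omega> Xm Xd] by blast
qed

section \<open>Heights above spanning points\<close>

text \<open>\<open>hull_height M f e\<close> is the distance of a point to the subtree spanned by \<open>M + 1\<close> points, where \<open>f\<close>
  lists the distances to these points and \<open>e\<close> their mutual distances.\<close>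

definition hull_height :: "nat \<Rightarrow> (nat \<Rightarrow> real) \<Rightarrow> (nat \<Rightarrow> nat \<Rightarrow> real) \<Rightarrow> real" where
  "hull_height M f e = Min ((\<lambda>(i, j). (f i + f j - e i j) / 2) ` ({..M} \<times> {..M}))"

text \<open>The distance of two points that part inside this subtree, given their heights \<open>a\<close>, \<open>b\<close> above it.\<close>

definition hull_dist :: "nat \<Rightarrow> (nat \<Rightarrow> real) \<Rightarrow> real \<Rightarrow> (nat \<Rightarrow> real) \<Rightarrow> real \<Rightarrow> real" where
  "hull_dist M f a g b = Max ((\<lambda>j. max (2 * a + g j - f j) (2 * b + f j - g j)) ` {..M})"

lemma tendsto_Max_image:
  fixes f :: "nat \<Rightarrow> 'i \<Rightarrow> real"
  assumes "finite A" "A \<noteq> {}" "\<And>i. i \<in> A \<Longrightarrow> (\<lambda>n. f n i) \<longlonglongrightarrow> l i"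
  shows "(\<lambda>n. Max (f n ` A)) \<longlonglongrightarrow> Max (l ` A)"
  using assms by (induction rule: finite_ne_induct) (auto intro!: tendsto_max)

lemma tendsto_Min_image:
  fixes f :: "nat \<Rightarrow> 'i \<Rightarrow> real"
  assumes "finite A" "A \<noteq> {}" "\<And>i. i \<in> A \<Longrightarrow> (\<lambda>n. f n i) \<longlonglongrightarrow> l i"
  shows "(\<lambda>n. Min (f n ` A)) \<longlonglongrightarrow> Min (l ` A)"
  using assms by (induction rule: finite_ne_induct) (auto intro!: tendsto_min)

lemma tendsto_hull_height:
  assumes "\<And>i. (\<lambda>n. f n i) \<longlonglongrightarrow> f' i" "\<And>i j. (\<lambda>n. e n i j) \<longlonglongrightarrow> e' i j"
  shows "(\<lambda>n. hull_height M (f n) (e n)) \<longlonglongrightarrow> hull_height M f' e'"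
  unfolding hull_height_def
  by (rule tendsto_Min_image) (auto intro!: tendsto_intros assms)

lemma tendsto_hull_dist:
  assumes "\<And>i. (\<lambda>n. f n i) \<longlonglongrightarrow> f' i" "\<And>i. (\<lambda>n. g n i) \<longlonglongrightarrow> g' i" "a \<longlonglongrightarrow> a'" "b \<longlonglongrightarrow> b'"
  shows "(\<lambda>n. hull_dist M (f n) (a n) (g n) (b n)) \<longlonglongrightarrow> hull_dist M f' a' g' b'"
  unfolding hull_dist_def
  by (rule tendsto_Max_image) (auto intro!: tendsto_intros tendsto_max assms)

lemma hull_height_le: "i \<le> M \<Longrightarrow> j \<le> M \<Longrightarrow> hull_height M f e \<le> (f i + f j - e i j) / 2"
  unfolding hull_height_def by (rule Min_le) auto

lemma hull_height_attained:
  obtains i j where "i \<le> M" "j \<le> M" "hull_height M f e = (f i + f j - e i j) / 2"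
proof -
  have "hull_height M f e \<in> (\<lambda>(i, j). (f i + f j - e i j) / 2) ` ({..M} \<times> {..M})"
    unfolding hull_height_def by (rule Min_in) auto
  then show ?thesis using that by auto
qed

lemma hull_height_decreasing: "M \<le> N \<Longrightarrow> hull_height N f e \<le> hull_height M f e"
  unfolding hull_height_def by (rule Min_antimono) auto

lemma hull_height_cong:
  assumes "\<And>i. i \<le> M \<Longrightarrow> f i = f' i" "\<And>i j. i \<le> M \<Longrightarrow> j \<le> M \<Longrightarrow> e i j = e' i j"
  shows "hull_height M f e = hull_height M f' e'"
  unfolding hull_height_def by (rule arg_cong[where f = Min], rule image_cong) (use assms in auto)

lemma hull_dist_ge:
  "j \<le> M \<Longrightarrow> 2 * a + g j - f j \<le> hull_dist M f a g b"
  "j \<le> M \<Longrightarrow> 2 * b + f j - g j \<le> hull_dist M f a g b"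
  unfolding hull_dist_def by (rule order_trans[OF _ Max_ge[OF _ imageI]]; simp)+

lemma hull_dist_attained:
  obtains j where "j \<le> M" "hull_dist M f a g b = max (2 * a + g j - f j) (2 * b + f j - g j)"
proof -
  have "hull_dist M f a g b \<in> (\<lambda>j. max (2 * a + g j - f j) (2 * b + f j - g j)) ` {..M}"
    unfolding hull_dist_def by (rule Max_in) auto
  then show ?thesis using that by auto
qed

text \<open>Whole sequences are chosen, each differing from its predecessor only at place
  \<open>Suc M\<close>, and the diagonal is taken. The objective at stage \<open>M\<close> sees only
  the places up to \<open>M\<close>, so later changes do not spoil minimality.\<close>

lemma greedy_sequence:
  fixes G :: "nat \<Rightarrow> (nat \<Rightarrow> 'a) \<Rightarrow> real"
  assumes V: "finite V" "V \<noteq> {}"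
    and local: "\<And>M z z'. (\<And>i. i \<le> M \<Longrightarrow> z i = z' i) \<Longrightarrow> G M z = G M z'"
  obtains z where "\<And>i. z i \<in> V" "\<And>M y. y \<in> V \<Longrightarrow> G (Suc M) z \<le> G (Suc M) (z(Suc M := y))"
proof -
  let ?Q = "\<lambda>M z z'. (\<forall>i\<le>M. z' i = z i) \<and> (\<forall>y\<in>V. G (Suc M) z' \<le> G (Suc M) (z'(Suc M := y)))"
  have "\<exists>Z. \<forall>M. (\<forall>i. Z M i \<in> V) \<and> ?Q M (Z M) (Z (Suc M))"
  proof (rule dependent_nat_choice)
    show "\<exists>z. \<forall>i::nat. z i \<in> V" using V by auto
    fix z :: "nat \<Rightarrow> 'a" and M assume z: "\<forall>i. z i \<in> V"
    define y where "y = arg_min_on (\<lambda>y. G (Suc M) (z(Suc M := y))) V"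
    have y: "y \<in> V" "\<And>y'. y' \<in> V \<Longrightarrow> G (Suc M) (z(Suc M := y)) \<le> G (Suc M) (z(Suc M := y'))"
      unfolding y_def using arg_min_if_finite(1)[OF V] arg_min_least[OF V] by auto
    then show "\<exists>z'. (\<forall>i. z' i \<in> V) \<and> ?Q M z z'"
      using z by (intro exI[of _ "z(Suc M := y)"]) auto
  qed
  then obtain Z where Z: "\<And>M i. Z M i \<in> V" "\<And>M i. i \<le> M \<Longrightarrow> Z (Suc M) i = Z M i"
    "\<And>M y. y \<in> V \<Longrightarrow> G (Suc M) (Z (Suc M)) \<le> G (Suc M) ((Z (Suc M))(Suc M := y))"
    by metis
  have stable: "Z M i = Z i i" if "i \<le> M" for M i
    using that by (induction M rule: dec_induct) (auto simp: Z(2))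
  define z where "z i = Z i i" for i
  show ?thesis
  proof (rule that[of z])
    show "z i \<in> V" for i by (simp add: z_def Z)
    fix M y assume "y \<in> V"
    have "G (Suc M) z = G (Suc M) (Z (Suc M))"
      by (rule local) (simp add: z_def stable[of _ "Suc M"])
    also have "\<dots> \<le> G (Suc M) ((Z (Suc M))(Suc M := y))" by (rule Z(3)) fact
    also have "\<dots> = G (Suc M) (z(Suc M := y))"
      by (rule local) (simp add: z_def stable[of _ "Suc M"])
    finally show "G (Suc M) z \<le> G (Suc M) (z(Suc M := y))" .
  qed
qed

lemma tree_pseudometric_simps:
  assumes "tree_pseudometric V d" "x \<in> V" "y \<in> V"
  shows "d x x = 0" "d x y = d y x" "d x y \<le> 1" "0 \<le> d x y"
proof -
  show "d x x = 0" "d x y = d y x" "d x y \<le> 1"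
    using assms by (auto simp: tree_pseudometric_def)
  have "d x x + d y y \<le> max (d x y + d x y) (d x y + d x y)"
    using assms unfolding tree_pseudometric_def by blast
  then show "0 \<le> d x y" using assms by (simp add: tree_pseudometric_def)
qed

lemma tree_pseudometric_triangle:
  assumes "tree_pseudometric V d" "x \<in> V" "y \<in> V" "z \<in> V"
  shows "d x y \<le> d x z + d z y"
proof -
  have "d x y + d z z \<le> max (d x z + d y z) (d x z + d y z)"
    using assms unfolding tree_pseudometric_def by blast
  then show ?thesis
    using assms(1) tree_pseudometric_simps(1)[OF assms(1,4,4)] tree_pseudometric_simps(2)[OF assms(1,3,4)] by simp
qed

text \<open>If \<open>x\<close> and \<open>y\<close> share a piece of their ways to the spanned subtree, then adding one of
  them to the spanning points lowers the height of the other by the length of this piece.\<close>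

lemma hull_dist_error:
  fixes z :: "nat \<Rightarrow> 'a"
  assumes d: "tree_pseudometric V d" and xy: "x \<in> V" "y \<in> V" and z: "\<And>i. z i \<in> V"
  defines "h \<equiv> \<lambda>M z x. hull_height M (\<lambda>i. d x (z i)) (\<lambda>i j. d (z i) (z j))"
  shows "\<bar>d x y - hull_dist M (\<lambda>i. d x (z i)) (h M z x) (\<lambda>i. d y (z i)) (h M z y)\<bar>
    \<le> 2 * (h M z x - h (Suc M) (z(Suc M := y)) x) + 2 * (h M z y - h (Suc M) (z(Suc M := x)) y)"
proof -
  let ?D = "hull_dist M (\<lambda>i. d x (z i)) (h M z x) (\<lambda>i. d y (z i)) (h M z y)"
  have le: "h (Suc M) (z(Suc M := v)) u \<le> h M z u" for u v
  proof -
    have "h (Suc M) (z(Suc M := v)) u \<le> h M (z(Suc M := v)) u"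
      unfolding h_def by (rule hull_height_decreasing) simp
    also have "\<dots> = h M z u"
      unfolding h_def by (rule hull_height_cong) auto
    finally show ?thesis .
  qed
  have new: "2 * h (Suc M) (z(Suc M := v)) u \<le> d u (z j) + d u v - d (z j) v" if "j \<le> M" for u v j
    using hull_height_le[of j "Suc M" "Suc M" "\<lambda>i. d u ((z(Suc M := v)) i)"
        "\<lambda>i j. d ((z(Suc M := v)) i) ((z(Suc M := v)) j)"] that
    by (simp add: h_def)
  \<comment> \<open>Parting above the subtree only shortens the way. The four-point condition is
    applied to \<open>x\<close>, \<open>y\<close> and a pair of spanning points that realises the
    height of \<open>x\<close>.\<close>
  have "d x y \<le> ?D"
  proof -
    obtain i j where ij: "i \<le> M" "j \<le> M" "h M z x = (d x (z i) + d x (z j) - d (z i) (z j)) / 2"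
      unfolding h_def by (rule hull_height_attained)
    have "d x y + d (z i) (z j) \<le> max (d x (z i) + d y (z j)) (d x (z j) + d y (z i))"
      using d xy z unfolding tree_pseudometric_def by blast
    moreover have "2 * h M z x + d y (z i) - d x (z i) \<le> ?D" by (rule hull_dist_ge(1)[OF ij(1)])
    moreover have "2 * h M z x + d y (z j) - d x (z j) \<le> ?D" by (rule hull_dist_ge(1)[OF ij(2)])
    moreover have "2 * h M z x = d x (z i) + d x (z j) - d (z i) (z j)" using ij(3) by simp
    ultimately show ?thesis by linarith
  qed
  \<comment> \<open>One of the two drops already bounds the excess, depending on which term of the
    maximum is attained; the other is nonnegative by \<open>le\<close>. The instances of
    \<open>new\<close> are Gromov products of \<open>z j\<close> with the added point.\<close>
  moreover have "?D \<le> d x y + 2 * (h M z x - h (Suc M) (z(Suc M := y)) x)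
      + 2 * (h M z y - h (Suc M) (z(Suc M := x)) y)"
  proof -
    obtain j where j: "j \<le> M" "?D = max (2 * h M z x + d y (z j) - d x (z j)) (2 * h M z y + d x (z j) - d y (z j))"
      by (rule hull_dist_attained)
    then have "?D = 2 * h M z x + d y (z j) - d x (z j) \<or> ?D = 2 * h M z y + d x (z j) - d y (z j)"
      by (auto simp: max_def split: if_splits)
    moreover have "2 * h (Suc M) (z(Suc M := y)) x \<le> d x (z j) + d x y - d y (z j)"
      using new[OF j(1), of y x] tree_pseudometric_simps(2)[OF d xy(2) z[of j]] by simp
    moreover have "2 * h (Suc M) (z(Suc M := x)) y \<le> d y (z j) + d x y - d x (z j)"
      using new[OF j(1), of x y] tree_pseudometric_simps(2)[OF d xy]
        tree_pseudometric_simps(2)[OF d xy(1) z[of j]] by simp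
    moreover have "h (Suc M) (z(Suc M := y)) x \<le> h M z x" "h (Suc M) (z(Suc M := x)) y \<le> h M z y"
      by (rule le)+
    ultimately show ?thesis by (elim disjE) argo+
  qed
  ultimately show ?thesis by linarith
qed

section \<open>The limit of the sampled distances\<close>

text \<open>For a random new point \<open>y\<close>, the error is bounded by the drop in height. The
  greedy choice lowers the total height at least as much as each \<open>y\<close>, hence as much as
  the average over \<open>y\<close>. The factor 4 is 2 for each of \<open>x\<close> and
  \<open>y\<close>, whose contributions agree after exchanging the sums.\<close>

lemma greedy_spanning_points:
  assumes d: "tree_pseudometric V d" and V: "finite V" "V \<noteq> {}"
  defines "h \<equiv> \<lambda>M z x. hull_height M (\<lambda>i. d x (z i)) (\<lambda>i j. d (z i) (z j))"
  obtains z where "\<And>i. z i \<in> V"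
    "\<And>M. (\<Sum>x\<in>V. \<Sum>y\<in>V. \<bar>d x y - hull_dist M (\<lambda>i. d x (z i)) (h M z x) (\<lambda>i. d y (z i)) (h M z y)\<bar>)
      \<le> 4 * (real (card V) * ((\<Sum>x\<in>V. h M z x) - (\<Sum>x\<in>V. h (Suc M) z x)))"
proof -
  have local: "(\<Sum>x\<in>V. h M z x) = (\<Sum>x\<in>V. h M z' x)" if "\<And>i. i \<le> M \<Longrightarrow> z i = z' i" for M z z'
    unfolding h_def by (intro sum.cong refl hull_height_cong) (simp_all add: that)
  obtain z where z: "\<And>i. z i \<in> V"
    "\<And>M y. y \<in> V \<Longrightarrow> (\<Sum>x\<in>V. h (Suc M) z x) \<le> (\<Sum>x\<in>V. h (Suc M) (z(Suc M := y)) x)"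
    using greedy_sequence[OF V, of "\<lambda>M z. \<Sum>x\<in>V. h M z x", OF local] by metis
  have "(\<Sum>x\<in>V. \<Sum>y\<in>V. \<bar>d x y - hull_dist M (\<lambda>i. d x (z i)) (h M z x) (\<lambda>i. d y (z i)) (h M z y)\<bar>)
      \<le> 4 * (real (card V) * ((\<Sum>x\<in>V. h M z x) - (\<Sum>x\<in>V. h (Suc M) z x)))" for M
  proof -
    define c where "c x y = h M z x - h (Suc M) (z(Suc M := y)) x" for x y
    have "(\<Sum>x\<in>V. \<Sum>y\<in>V. \<bar>d x y - hull_dist M (\<lambda>i. d x (z i)) (h M z x) (\<lambda>i. d y (z i)) (h M z y)\<bar>)
        \<le> (\<Sum>x\<in>V. \<Sum>y\<in>V. 2 * c x y + 2 * c y x)"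
      unfolding c_def h_def by (intro sum_mono hull_dist_error[OF d _ _ z(1)])
    also have "\<dots> = 2 * (\<Sum>x\<in>V. \<Sum>y\<in>V. c x y) + 2 * (\<Sum>x\<in>V. \<Sum>y\<in>V. c y x)"
      by (simp add: sum.distrib sum_distrib_left)
    also have "(\<Sum>x\<in>V. \<Sum>y\<in>V. c x y) = (\<Sum>x\<in>V. \<Sum>y\<in>V. c y x)"
      by (rule sum.swap)
    also have "(\<Sum>x\<in>V. \<Sum>y\<in>V. c y x)
        = real (card V) * (\<Sum>x\<in>V. h M z x) - (\<Sum>y\<in>V. \<Sum>x\<in>V. h (Suc M) (z(Suc M := y)) x)"
      by (simp add: c_def sum_subtractf)
    also have "\<dots> \<le> real (card V) * (\<Sum>x\<in>V. h M z x) - (\<Sum>y\<in>V. \<Sum>x\<in>V. h (Suc M) z x)"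
      by (intro diff_left_mono sum_mono z(2))
    finally show ?thesis by (simp add: right_diff_distrib)
  qed
  then show ?thesis using that z(1) by blast
qed

lemma hull_height_nonneg:
  assumes "\<And>i j. e i j \<le> f i + f j"
  shows "0 \<le> hull_height M f e"
proof -
  obtain i j where "hull_height M f e = (f i + f j - e i j) / 2"
    by (rule hull_height_attained)
  then show ?thesis using assms[of i j] by simp
qed

lemma bounded_convergence:
  fixes f :: "nat \<Rightarrow> 'w \<Rightarrow> real"
  assumes "prob_space M" "\<And>n. f n \<in> borel_measurable M" "g \<in> borel_measurable M"
    and "\<And>n x. x \<in> space M \<Longrightarrow> \<bar>f n x\<bar> \<le> B" "\<And>x. x \<in> space M \<Longrightarrow> (\<lambda>n. f n x) \<longlonglongrightarrow> g x"
  shows "(\<lambda>n. \<integral>x. f n x \<partial>M) \<longlonglongrightarrow> (\<integral>x. g x \<partial>M)"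
proof -
  interpret prob_space M by fact
  show ?thesis
    by (rule integral_dominated_convergence[where w = "\<lambda>_. B"]) (use assms in auto)
qed

text \<open>Term by term, \<open>hull_dist M f a g b\<close> equals \<open>a + b\<close> plus the
  maximum over \<open>j\<close> up to \<open>M\<close> of
  \<open>\<bar>(f j - a) - (g j - b)\<bar>\<close>, a finite part of a supremum distance between
  feet. A nearly optimal coordinate \<open>j\<close> takes part as soon as \<open>M\<close> reaches
  it.\<close>

lemma hull_dist_limit:
  fixes \<phi> \<phi>' :: "nat \<Rightarrow> real"
  assumes h: "h \<longlonglongrightarrow> a" "\<And>M. a \<le> h M" and h': "h' \<longlonglongrightarrow> a'" "\<And>M. a' \<le> h' M"
    and le1: "\<And>j. \<bar>(\<phi> j - a) - (\<phi>' j - a')\<bar> \<le> 1"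
  shows "(\<lambda>M. hull_dist M \<phi> (h M) \<phi>' (h' M))
    \<longlonglongrightarrow> a + a' + sup_dist (\<lambda>j. \<phi> j - a) (\<lambda>j. \<phi>' j - a')"
proof (rule LIMSEQ_I)
  let ?D = "sup_dist (\<lambda>j. \<phi> j - a) (\<lambda>j. \<phi>' j - a')"
  fix r :: real assume r: "0 < r"
  have up: "\<bar>(\<phi> j - a) - (\<phi>' j - a')\<bar> \<le> ?D" for j
    by (rule sup_dist_upper[OF le1])
  have "\<exists>j. ?D - r/4 < \<bar>(\<phi> j - a) - (\<phi>' j - a')\<bar>"
  proof (rule ccontr)
    assume "\<not> ?thesis"
    then have "?D \<le> ?D - r/4" by (intro sup_dist_le) (auto simp: not_less)
    then show False using r by simp
  qed
  then obtain j where j: "?D - r/4 < \<bar>(\<phi> j - a) - (\<phi>' j - a')\<bar>" by blast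
  obtain N1 where N1: "\<And>M. N1 \<le> M \<Longrightarrow> norm (h M - a) < r/8"
    using LIMSEQ_D[OF h(1), of "r/8"] r by auto
  obtain N2 where N2: "\<And>M. N2 \<le> M \<Longrightarrow> norm (h' M - a') < r/8"
    using LIMSEQ_D[OF h'(1), of "r/8"] r by auto
  have "norm (hull_dist M \<phi> (h M) \<phi>' (h' M) - (a + a' + ?D)) < r"
    if M: "N1 \<le> M" "N2 \<le> M" "j \<le> M" for M
  proof -
    have hM: "a \<le> h M" "h M < a + r/8" "a' \<le> h' M" "h' M < a' + r/8"
      using h(2)[of M] h'(2)[of M] N1[OF M(1)] N2[OF M(2)] by auto
    have "2 * h M + \<phi>' j - \<phi> j \<le> hull_dist M \<phi> (h M) \<phi>' (h' M)"
      "2 * h' M + \<phi> j - \<phi>' j \<le> hull_dist M \<phi> (h M) \<phi>' (h' M)"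
      by (rule hull_dist_ge[OF M(3)])+
    moreover obtain i where "hull_dist M \<phi> (h M) \<phi>' (h' M)
        = max (2 * h M + \<phi>' i - \<phi> i) (2 * h' M + \<phi> i - \<phi>' i)"
      by (rule hull_dist_attained)
    moreover note j up[of i] hM
    ultimately show ?thesis by (simp add: abs_if max_def split: if_splits)
  qed
  then show "\<exists>no. \<forall>M\<ge>no. norm (hull_dist M \<phi> (h M) \<phi>' (h' M) - (a + a' + ?D)) < r"
    by (intro exI[of _ "max N1 (max N2 j)"]) auto
qed

lemma sup_dist_measurable [measurable (raw)]:
  assumes [measurable]: "\<And>i. (\<lambda>x. f x i) \<in> borel_measurable N" "\<And>i. (\<lambda>x. g x i) \<in> borel_measurable N"
  shows "(\<lambda>x. sup_dist (f x) (g x)) \<in> borel_measurable N"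
  unfolding sup_dist_def
  by (rule borel_measurable_cSUP) (auto intro: bdd_sup_dist)

text \<open>All uniform vertices \<open>X n\<close> live on one probability space, so independent
  sample points are coordinates of its powers. Convergence is required at every point, which makes
  the hair and the foot meaningful on all of \<open>\<Omega>\<close>.\<close>

locale sampled_limit = prob_space \<Omega> for \<Omega> :: "'w measure" +
  fixes V :: "nat \<Rightarrow> 'a set" and d :: "nat \<Rightarrow> 'a \<Rightarrow> 'a \<Rightarrow> real" and z :: "nat \<Rightarrow> nat \<Rightarrow> 'a"
    and X :: "nat \<Rightarrow> 'w \<Rightarrow> 'a" and \<phi> :: "nat \<Rightarrow> 'w \<Rightarrow> real" and e :: "nat \<Rightarrow> nat \<Rightarrow> real"
  assumes V: "finite (V n)" "V n \<noteq> {}"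
    and d: "tree_pseudometric (V n) (d n)"
    and z: "z n i \<in> V n"
    and X: "X n \<in> \<Omega> \<rightarrow>\<^sub>M count_space (V n)"
    and X_law: "distr \<Omega> (count_space (V n)) (X n) = uniform_count_measure (V n)"
    and \<phi>_measurable [measurable]: "\<phi> i \<in> borel_measurable \<Omega>"
    and lim_\<phi>: "\<omega> \<in> space \<Omega> \<Longrightarrow> (\<lambda>n. d n (X n \<omega>) (z n i)) \<longlonglongrightarrow> \<phi> i \<omega>"
    and lim_e: "(\<lambda>n. d n (z n i) (z n j)) \<longlonglongrightarrow> e i j"
    and greedy: "(\<Sum>x\<in>V n. \<Sum>y\<in>V n. \<bar>d n x y - hull_dist M
          (\<lambda>i. d n x (z n i)) (hull_height M (\<lambda>i. d n x (z n i)) (\<lambda>i j. d n (z n i) (z n j)))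
          (\<lambda>i. d n y (z n i)) (hull_height M (\<lambda>i. d n y (z n i)) (\<lambda>i j. d n (z n i) (z n j)))\<bar>)
      \<le> 4 * (real (card (V n)) *
          ((\<Sum>x\<in>V n. hull_height M (\<lambda>i. d n x (z n i)) (\<lambda>i j. d n (z n i) (z n j)))
         - (\<Sum>x\<in>V n. hull_height (Suc M) (\<lambda>i. d n x (z n i)) (\<lambda>i j. d n (z n i) (z n j)))))"
begin

lemma XV: "\<omega> \<in> space \<Omega> \<Longrightarrow> X n \<omega> \<in> V n"
  using measurable_space[OF X] by simp

lemma e_tree: "tree_pseudometric UNIV e"
  unfolding tree_pseudometric_def
proof (intro conjI ballI)
  fix i j k l
  show "e i i = 0"
    using LIMSEQ_unique[OF lim_e[of i i]] tree_pseudometric_simps(1)[OF d z z] by simp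
  show "e i j = e j i"
    using LIMSEQ_unique[OF lim_e[of i j]] lim_e[of j i] tree_pseudometric_simps(2)[OF d z z, of _ i j] by simp
  show "e i j \<le> 1"
    by (rule LIMSEQ_le_const2[OF lim_e]) (use tree_pseudometric_simps(3)[OF d z z] in auto)
  have "d n (z n i) (z n j) + d n (z n k) (z n l) \<le>
      max (d n (z n i) (z n k) + d n (z n j) (z n l)) (d n (z n i) (z n l) + d n (z n j) (z n k))" for n
    using d[of n] z unfolding tree_pseudometric_def by blast
  then show "e i j + e k l \<le> max (e i k + e j l) (e i l + e j k)"
    by (intro LIMSEQ_le[OF tendsto_add[OF lim_e lim_e] tendsto_max[OF tendsto_add[OF lim_e lim_e] tendsto_add[OF lim_e lim_e]]]) auto
qed

lemma
  assumes \<omega>: "\<omega> \<in> space \<Omega>"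
  shows \<phi>_nonneg: "0 \<le> \<phi> i \<omega>" and \<phi>_le1: "\<phi> i \<omega> \<le> 1"
    and \<phi>_ge: "e i j \<le> \<phi> i \<omega> + \<phi> j \<omega>"
    and \<phi>_four: "\<phi> i \<omega> + e j k \<le> max (\<phi> j \<omega> + e i k) (\<phi> k \<omega> + e i j)"
proof -
  note s = tree_pseudometric_simps[OF d XV[OF \<omega>] z]
  show "0 \<le> \<phi> i \<omega>"
    by (rule LIMSEQ_le_const[OF lim_\<phi>[OF \<omega>]]) (use s(4) in auto)
  show "\<phi> i \<omega> \<le> 1"
    by (rule LIMSEQ_le_const2[OF lim_\<phi>[OF \<omega>]]) (use s(3) in auto)
  have "d n (z n i) (z n j) \<le> d n (X n \<omega>) (z n i) + d n (X n \<omega>) (z n j)" for n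
    using tree_pseudometric_triangle[OF d z z XV[OF \<omega>], of n i j] s(2)[of n i] by simp
  then show "e i j \<le> \<phi> i \<omega> + \<phi> j \<omega>"
    by (intro LIMSEQ_le[OF lim_e tendsto_add[OF lim_\<phi>[OF \<omega>] lim_\<phi>[OF \<omega>]]]) auto
  have "d n (X n \<omega>) (z n i) + d n (z n j) (z n k) \<le>
      max (d n (X n \<omega>) (z n j) + d n (z n i) (z n k)) (d n (X n \<omega>) (z n k) + d n (z n i) (z n j))" for n
    using d[of n] z XV[OF \<omega>] unfolding tree_pseudometric_def by blast
  then show "\<phi> i \<omega> + e j k \<le> max (\<phi> j \<omega> + e i k) (\<phi> k \<omega> + e i j)"
    by (intro LIMSEQ_le[OF tendsto_add[OF lim_\<phi>[OF \<omega>] lim_e] tendsto_max[OF tendsto_add[OF lim_\<phi>[OF \<omega>] lim_e]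
        tendsto_add[OF lim_\<phi>[OF \<omega>] lim_e]]]) auto
qed

definition limit_height :: "nat \<Rightarrow> 'w \<Rightarrow> real" where
  "limit_height M \<omega> = hull_height M (\<lambda>i. \<phi> i \<omega>) e"

text \<open>A limit point hangs at the end of a hair above its foot in the tree spanned by the limits of the
  \<open>z n i\<close>; the foot is given by its distances to these limits.\<close>

definition hair :: "'w \<Rightarrow> real" where
  "hair \<omega> = lim (\<lambda>M. limit_height M \<omega>)"

definition foot :: "'w \<Rightarrow> nat \<Rightarrow> real" where
  "foot \<omega> i = \<phi> i \<omega> - hair \<omega>"

definition limit_dist :: "'w \<Rightarrow> 'w \<Rightarrow> real" where
  "limit_dist \<omega> \<omega>' = hair \<omega> + hair \<omega>' + sup_dist (foot \<omega>) (foot \<omega>')"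

lemma
  assumes \<omega>: "\<omega> \<in> space \<Omega>"
  shows limit_height_nonneg: "0 \<le> limit_height M \<omega>" and limit_height_le1: "limit_height M \<omega> \<le> 1"
    and limit_height_lim: "(\<lambda>M. limit_height M \<omega>) \<longlonglongrightarrow> hair \<omega>" and hair_le_height: "hair \<omega> \<le> limit_height M \<omega>"
    and hair_nonneg: "0 \<le> hair \<omega>"
proof -
  have h0: "0 \<le> limit_height M \<omega>" for M
    unfolding limit_height_def by (rule hull_height_nonneg[OF \<phi>_ge[OF \<omega>]])
  show "0 \<le> limit_height M \<omega>" by (rule h0)
  interpret E: tree_span e by (rule tree_span.intro[OF e_tree])
  show "limit_height M \<omega> \<le> 1"
    unfolding limit_height_def using hull_height_le[of 0 M 0 "\<lambda>i. \<phi> i \<omega>" e] \<phi>_le1[OF \<omega>, of 0] by simp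
  have dec: "decseq (\<lambda>M. limit_height M \<omega>)"
    unfolding decseq_def limit_height_def by (auto intro: hull_height_decreasing)
  obtain l where l: "(\<lambda>M. limit_height M \<omega>) \<longlonglongrightarrow> l"
    by (rule decseq_convergent[OF dec, of 0]) (use h0 in auto)
  then show lim: "(\<lambda>M. limit_height M \<omega>) \<longlonglongrightarrow> hair \<omega>"
    by (simp add: hair_def limI)
  show "hair \<omega> \<le> limit_height M \<omega>" by (rule decseq_ge[OF dec lim])
  show "0 \<le> hair \<omega>" by (rule LIMSEQ_le_const[OF lim]) (use h0 in auto)
qed

text \<open>The hair is a lower bound of all Gromov products, which is the first condition. For
  tightness, the foot is almost on the segment of a pair \<open>k\<close>, \<open>l\<close> that
  nearly attains the hair length, and by the four-point condition the way from any \<open>i\<close>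
  to one of the two passes nearby.\<close>

lemma foot_in_span:
  assumes \<omega>: "\<omega> \<in> space \<Omega>"
  shows "foot \<omega> \<in> tight_span e"
  unfolding tight_span_def
proof (intro CollectI conjI allI impI)
  fix i j
  have "hair \<omega> \<le> (\<phi> i \<omega> + \<phi> j \<omega> - e i j) / 2"
    using hair_le_height[OF \<omega>, of "max i j"] hull_height_le[of i "max i j" j "\<lambda>i. \<phi> i \<omega>" e]
    by (simp add: limit_height_def)
  then show "e i j \<le> foot \<omega> i + foot \<omega> j" by (simp add: foot_def)
next
  fix i and r :: real assume r: "0 < r"
  obtain M where M: "limit_height M \<omega> < hair \<omega> + r/2"
    using order_tendstoD(2)[OF limit_height_lim[OF \<omega>], of "hair \<omega> + r/2"] r
    by (auto simp: eventually_sequentially)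
  obtain k l where kl: "limit_height M \<omega> = (\<phi> k \<omega> + \<phi> l \<omega> - e k l) / 2"
    unfolding limit_height_def by (rule hull_height_attained)
  have "\<phi> i \<omega> + e k l \<le> max (\<phi> k \<omega> + e i l) (\<phi> l \<omega> + e i k)"
    by (rule \<phi>_four[OF \<omega>])
  then have "\<phi> i \<omega> + e k l \<le> \<phi> k \<omega> + e i l \<or> \<phi> i \<omega> + e k l \<le> \<phi> l \<omega> + e i k"
    by (simp add: le_max_iff_disj)
  moreover have "\<phi> k \<omega> + \<phi> l \<omega> - e k l < 2 * hair \<omega> + r" using M kl by simp
  ultimately have "foot \<omega> i + foot \<omega> l \<le> e i l + r \<or> foot \<omega> i + foot \<omega> k \<le> e i k + r"
    by (auto simp: foot_def)
  then show "\<exists>j. foot \<omega> i + foot \<omega> j \<le> e i j + r" by blast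
qed

lemma limit_height_measurable [measurable]: "limit_height M \<in> borel_measurable \<Omega>"
  unfolding limit_height_def[abs_def] hull_height_def case_prod_beta by measurable

lemma hair_measurable [measurable]: "hair \<in> borel_measurable \<Omega>"
  by (rule borel_measurable_LIMSEQ_real[OF limit_height_lim limit_height_measurable])

lemma foot_measurable [measurable]: "(\<lambda>\<omega>. foot \<omega> i) \<in> borel_measurable \<Omega>"
  unfolding foot_def by measurable

lemma X_pair_measurable:
  "(\<lambda>p. f (X n (fst p)) (X n (snd p))) \<in> borel_measurable (\<Omega> \<Otimes>\<^sub>M \<Omega>)"
proof -
  have "(\<lambda>p. (X n (fst p), X n (snd p))) \<in> \<Omega> \<Otimes>\<^sub>M \<Omega> \<rightarrow>\<^sub>M count_space (V n) \<Otimes>\<^sub>M count_space (V n)"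
    using X by measurable
  then have "(\<lambda>p. (X n (fst p), X n (snd p))) \<in> \<Omega> \<Otimes>\<^sub>M \<Omega> \<rightarrow>\<^sub>M count_space (V n \<times> V n)"
    using V by (simp add: pair_measure_countable countable_finite)
  from measurable_compose[OF this, of "\<lambda>(x, y). f x y" borel] show ?thesis by simp
qed

lemma X_integral: "(\<integral>\<omega>. f (X n \<omega>) \<partial>\<Omega>) = (\<Sum>x\<in>V n. f x) / real (card (V n))" for f :: "'a \<Rightarrow> real"
  using integral_distr[OF X, of f n] integral_uniform_count_measure[OF V(1), of n f]
  by (simp add: X_law)

text \<open>The two factors of the product space supply independent uniform vertices, so Fubini
  turns the double average over vertices into one integral.\<close>

lemma X_pair_integral:
  fixes f :: "'a \<Rightarrow> 'a \<Rightarrow> real"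
  shows "(\<integral>p. f (X n (fst p)) (X n (snd p)) \<partial>(\<Omega> \<Otimes>\<^sub>M \<Omega>))
    = (\<Sum>x\<in>V n. \<Sum>y\<in>V n. f x y) / real (card (V n)) / real (card (V n))"
proof -
  interpret P: pair_prob_space \<Omega> \<Omega> ..
  define B where "B = Max ((\<lambda>(x, y). \<bar>f x y\<bar>) ` (V n \<times> V n))"
  have B: "\<bar>f x y\<bar> \<le> B" if "x \<in> V n" "y \<in> V n" for x y
    unfolding B_def by (rule Max_ge) (use V that in auto)
  have "integrable (\<Omega> \<Otimes>\<^sub>M \<Omega>) (\<lambda>p. f (X n (fst p)) (X n (snd p)))"
    by (rule P.integrable_const_bound[of _ B])
       (auto intro!: AE_I2 B XV X_pair_measurable simp: space_pair_measure)
  from P.integral_fst'[OF this]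
  have "(\<integral>p. f (X n (fst p)) (X n (snd p)) \<partial>(\<Omega> \<Otimes>\<^sub>M \<Omega>)) = (\<integral>\<omega>. (\<integral>\<omega>'. f (X n \<omega>) (X n \<omega>') \<partial>\<Omega>) \<partial>\<Omega>)"
    by simp
  also have "\<dots> = (\<integral>\<omega>. (\<Sum>y\<in>V n. f (X n \<omega>) y) / real (card (V n)) \<partial>\<Omega>)"
    by (simp only: X_integral)
  also have "\<dots> = (\<Sum>x\<in>V n. (\<Sum>y\<in>V n. f x y) / real (card (V n))) / real (card (V n))"
    by (rule X_integral)
  finally show ?thesis by (simp only: sum_divide_distrib)
qed

definition sample_height :: "nat \<Rightarrow> nat \<Rightarrow> 'w \<Rightarrow> real" where
  "sample_height n M \<omega> = hull_height M (\<lambda>i. d n (X n \<omega>) (z n i)) (\<lambda>i j. d n (z n i) (z n j))"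

definition sample_hull_dist :: "nat \<Rightarrow> nat \<Rightarrow> 'w \<times> 'w \<Rightarrow> real" where
  "sample_hull_dist n M p = hull_dist M (\<lambda>i. d n (X n (fst p)) (z n i)) (sample_height n M (fst p))
     (\<lambda>i. d n (X n (snd p)) (z n i)) (sample_height n M (snd p))"

definition limit_hull_dist :: "nat \<Rightarrow> 'w \<times> 'w \<Rightarrow> real" where
  "limit_hull_dist M p = hull_dist M (\<lambda>i. \<phi> i (fst p)) (limit_height M (fst p)) (\<lambda>i. \<phi> i (snd p)) (limit_height M (snd p))"

lemma sample_height_bounds:
  assumes \<omega>: "\<omega> \<in> space \<Omega>"
  shows "0 \<le> sample_height n M \<omega>" "sample_height n M \<omega> \<le> 1"
proof -
  note s = tree_pseudometric_simps[OF d XV[OF \<omega>] z]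
  have "d n (z n i) (z n j) \<le> d n (X n \<omega>) (z n i) + d n (X n \<omega>) (z n j)" for i j
    using tree_pseudometric_triangle[OF d z z XV[OF \<omega>], of n i j] s(2)[of n i] by simp
  then show "0 \<le> sample_height n M \<omega>"
    unfolding sample_height_def by (rule hull_height_nonneg)
  show "sample_height n M \<omega> \<le> 1"
    using hull_height_le[of 0 M 0 "\<lambda>i. d n (X n \<omega>) (z n i)" "\<lambda>i j. d n (z n i) (z n j)"] s(3)[of n 0]
      tree_pseudometric_simps(1)[OF d z z, of n 0] by (simp add: sample_height_def)
qed

lemma hull_dist_bounds:
  assumes "\<And>i. 0 \<le> f i \<and> f i \<le> 1" "\<And>i. 0 \<le> g i \<and> g i \<le> 1" "0 \<le> a" "a \<le> 1" "0 \<le> b" "b \<le> 1"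
  shows "\<bar>hull_dist M f a g b\<bar> \<le> 3"
proof -
  obtain j where "hull_dist M f a g b = max (2 * a + g j - f j) (2 * b + f j - g j)"
    by (rule hull_dist_attained)
  then show ?thesis using assms(1)[of j] assms(2)[of j] assms(3-6) by (auto simp: abs_le_iff max_def)
qed

lemma sample_hull_dist_bound: "p \<in> space (\<Omega> \<Otimes>\<^sub>M \<Omega>) \<Longrightarrow> \<bar>sample_hull_dist n M p\<bar> \<le> 3"
  unfolding sample_hull_dist_def
  by (rule hull_dist_bounds) (auto simp: space_pair_measure sample_height_bounds intro!: tree_pseudometric_simps[OF d XV z])

lemma limit_hull_dist_bound: "p \<in> space (\<Omega> \<Otimes>\<^sub>M \<Omega>) \<Longrightarrow> \<bar>limit_hull_dist M p\<bar> \<le> 3"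
  unfolding limit_hull_dist_def
  by (rule hull_dist_bounds) (auto simp: space_pair_measure limit_height_nonneg limit_height_le1 \<phi>_nonneg \<phi>_le1)

lemma sample_hull_dist_lim:
  assumes "p \<in> space (\<Omega> \<Otimes>\<^sub>M \<Omega>)"
  shows "(\<lambda>n. sample_hull_dist n M p) \<longlonglongrightarrow> limit_hull_dist M p"
proof -
  have "(\<lambda>n. sample_height n M \<omega>) \<longlonglongrightarrow> limit_height M \<omega>" if "\<omega> \<in> space \<Omega>" for \<omega>
    unfolding sample_height_def limit_height_def by (rule tendsto_hull_height[OF lim_\<phi>[OF that] lim_e])
  then show ?thesis
    unfolding sample_hull_dist_def limit_hull_dist_def using assms
    by (intro tendsto_hull_dist lim_\<phi>) (auto simp: space_pair_measure)
qed

lemma sample_height_integral_lim: "(\<lambda>n. \<integral>\<omega>. sample_height n M \<omega> \<partial>\<Omega>) \<longlonglongrightarrow> (\<integral>\<omega>. limit_height M \<omega> \<partial>\<Omega>)"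
proof (rule bounded_convergence[of _ _ _ 1])
  show "prob_space \<Omega>" by unfold_locales
  show "sample_height n M \<in> borel_measurable \<Omega>" for n
    unfolding sample_height_def[abs_def]
    by (rule measurable_compose[OF X]) simp
  show "\<bar>sample_height n M \<omega>\<bar> \<le> 1" if "\<omega> \<in> space \<Omega>" for n \<omega>
    using sample_height_bounds[OF that, of n M] by simp
  show "(\<lambda>n. sample_height n M \<omega>) \<longlonglongrightarrow> limit_height M \<omega>" if "\<omega> \<in> space \<Omega>" for \<omega>
    unfolding sample_height_def limit_height_def by (rule tendsto_hull_height[OF lim_\<phi>[OF that] lim_e])
qed measurable

lemma sample_hull_dist_measurable [measurable]: "sample_hull_dist n M \<in> borel_measurable (\<Omega> \<Otimes>\<^sub>M \<Omega>)"
  unfolding sample_hull_dist_def[abs_def] sample_height_def by (rule X_pair_measurable)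

lemma limit_hull_dist_measurable [measurable]: "limit_hull_dist M \<in> borel_measurable (\<Omega> \<Otimes>\<^sub>M \<Omega>)"
  unfolding limit_hull_dist_def[abs_def] hull_dist_def by measurable

lemma limit_dist_measurable [measurable]:
  "(\<lambda>p. limit_dist (fst p) (snd p)) \<in> borel_measurable (\<Omega> \<Otimes>\<^sub>M \<Omega>)"
  unfolding limit_dist_def by measurable

lemma limit_hull_dist_lim:
  assumes "p \<in> space (\<Omega> \<Otimes>\<^sub>M \<Omega>)"
  shows "(\<lambda>M. limit_hull_dist M p) \<longlonglongrightarrow> limit_dist (fst p) (snd p)"
proof -
  interpret E: tree_span e by (rule tree_span.intro[OF e_tree])
  have p: "fst p \<in> space \<Omega>" "snd p \<in> space \<Omega>" using assms by (auto simp: space_pair_measure)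
  have "\<bar>foot (fst p) j - foot (snd p) j\<bar> \<le> 1" for j
    using E.span_nonneg[OF foot_in_span[OF p(1)], of j] E.span_nonneg[OF foot_in_span[OF p(2)], of j]
      E.span_le1[OF foot_in_span[OF p(1)], of j] E.span_le1[OF foot_in_span[OF p(2)], of j] by linarith
  then show ?thesis
    unfolding limit_hull_dist_def limit_dist_def foot_def[abs_def]
    by (intro hull_dist_limit limit_height_lim hair_le_height p) (simp add: foot_def)
qed

lemma limit_dist_bound:
  assumes "p \<in> space (\<Omega> \<Otimes>\<^sub>M \<Omega>)"
  shows "\<bar>limit_dist (fst p) (snd p)\<bar> \<le> 3"
  by (rule LIMSEQ_le_const2[OF tendsto_rabs[OF limit_hull_dist_lim[OF assms]]]) (use limit_hull_dist_bound[OF assms] in auto)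

lemma dist_hull_dist_integral:
  "(\<integral>p. \<bar>d n (X n (fst p)) (X n (snd p)) - sample_hull_dist n M p\<bar> \<partial>(\<Omega> \<Otimes>\<^sub>M \<Omega>))
    \<le> 4 * ((\<integral>\<omega>. sample_height n M \<omega> \<partial>\<Omega>) - (\<integral>\<omega>. sample_height n (Suc M) \<omega> \<partial>\<Omega>))"
proof -
  let ?c = "real (card (V n))"
  have c: "0 < ?c" using V by (simp add: card_gt_0_iff)
  let ?H = "\<lambda>M x. hull_height M (\<lambda>i. d n x (z n i)) (\<lambda>i j. d n (z n i) (z n j))"
  have "(\<integral>p. \<bar>d n (X n (fst p)) (X n (snd p)) - sample_hull_dist n M p\<bar> \<partial>(\<Omega> \<Otimes>\<^sub>M \<Omega>))
      = (\<Sum>x\<in>V n. \<Sum>y\<in>V n. \<bar>d n x y - hull_dist M (\<lambda>i. d n x (z n i)) (?H M x) (\<lambda>i. d n y (z n i)) (?H M y)\<bar>)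
        / ?c / ?c"
    unfolding sample_hull_dist_def sample_height_def by (rule X_pair_integral)
  also have "\<dots> \<le> (4 * (?c * ((\<Sum>x\<in>V n. ?H M x) - (\<Sum>x\<in>V n. ?H (Suc M) x)))) / ?c / ?c"
    by (intro divide_right_mono greedy) (use c in auto)
  also have "\<dots> = 4 * ((\<Sum>x\<in>V n. ?H M x) / ?c - (\<Sum>x\<in>V n. ?H (Suc M) x) / ?c)"
    using c by (simp add: field_simps)
  finally have "(\<integral>p. \<bar>d n (X n (fst p)) (X n (snd p)) - sample_hull_dist n M p\<bar> \<partial>(\<Omega> \<Otimes>\<^sub>M \<Omega>))
      \<le> 4 * ((\<Sum>x\<in>V n. ?H M x) / ?c - (\<Sum>x\<in>V n. ?H (Suc M) x) / ?c)" .
  moreover have "(\<Sum>x\<in>V n. ?H M x) / ?c = (\<integral>\<omega>. sample_height n M \<omega> \<partial>\<Omega>)" for M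
    unfolding sample_height_def by (rule X_integral[symmetric])
  ultimately show ?thesis by simp
qed

text \<open>\<open>M\<close> must be fixed before \<open>n\<close>. The limiting mean heights
  converge in \<open>M\<close>, so some \<open>M\<close> has both a small drop to
  \<open>Suc M\<close> and a small hull error in the limit. For this \<open>M\<close> the drop at
  stage \<open>n\<close> is eventually small too, and the greedy estimate controls the distance
  error by it.\<close>

theorem dist_converges_L1:
  "(\<lambda>n. \<integral>p. \<bar>d n (X n (fst p)) (X n (snd p)) - limit_dist (fst p) (snd p)\<bar> \<partial>(\<Omega> \<Otimes>\<^sub>M \<Omega>)) \<longlonglongrightarrow> 0"
proof (rule LIMSEQ_I)
  interpret P: pair_prob_space \<Omega> \<Omega> ..
  let ?P = "\<Omega> \<Otimes>\<^sub>M \<Omega>"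
  let ?d = "\<lambda>n p. d n (X n (fst p)) (X n (snd p))" and ?F = "\<lambda>p. limit_dist (fst p) (snd p)"
  fix r :: real assume r: "0 < r"
  define g where "g M = (\<integral>\<omega>. limit_height M \<omega> \<partial>\<Omega>)" for M
  have "g \<longlonglongrightarrow> (\<integral>\<omega>. hair \<omega> \<partial>\<Omega>)"
    unfolding g_def
    by (rule bounded_convergence[of _ _ _ 1]) (auto simp: limit_height_nonneg limit_height_le1 limit_height_lim prob_space_axioms)
  then have "(\<lambda>M. g M - g (Suc M)) \<longlonglongrightarrow> 0"
    using tendsto_diff[OF _ LIMSEQ_Suc] by fastforce
  then have "\<forall>\<^sub>F M in sequentially. g M - g (Suc M) < r/16"
    by (rule order_tendstoD) (use r in simp)
  moreover have "(\<lambda>M. \<integral>p. \<bar>limit_hull_dist M p - ?F p\<bar> \<partial>?P) \<longlonglongrightarrow> (\<integral>p. 0 \<partial>?P)"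
  proof (rule bounded_convergence[of _ _ _ 6])
    fix p assume p: "p \<in> space ?P"
    show "\<bar>\<bar>limit_hull_dist M p - ?F p\<bar>\<bar> \<le> 6" for M using limit_hull_dist_bound[OF p, of M] limit_dist_bound[OF p] by linarith
    show "(\<lambda>M. \<bar>limit_hull_dist M p - ?F p\<bar>) \<longlonglongrightarrow> 0"
      using tendsto_rabs[OF tendsto_diff[OF limit_hull_dist_lim[OF p] tendsto_const[of "?F p"]]] by simp
  qed (auto simp: P.prob_space_axioms)
  then have "\<forall>\<^sub>F M in sequentially. (\<integral>p. \<bar>limit_hull_dist M p - ?F p\<bar> \<partial>?P) < r/4"
    by (rule order_tendstoD) (use r in simp)
  ultimately obtain M where M: "g M - g (Suc M) < r/16" "(\<integral>p. \<bar>limit_hull_dist M p - ?F p\<bar> \<partial>?P) < r/4"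
    using eventually_conj eventually_happens'[OF sequentially_bot] by fast
  have "(\<lambda>n. (\<integral>\<omega>. sample_height n M \<omega> \<partial>\<Omega>) - (\<integral>\<omega>. sample_height n (Suc M) \<omega> \<partial>\<Omega>)) \<longlonglongrightarrow> g M - g (Suc M)"
    unfolding g_def by (intro tendsto_diff sample_height_integral_lim)
  then have e1: "\<forall>\<^sub>F n in sequentially. (\<integral>\<omega>. sample_height n M \<omega> \<partial>\<Omega>) - (\<integral>\<omega>. sample_height n (Suc M) \<omega> \<partial>\<Omega>) < r/16"
    by (rule order_tendstoD) (rule M)
  have "(\<lambda>n. \<integral>p. \<bar>sample_hull_dist n M p - limit_hull_dist M p\<bar> \<partial>?P) \<longlonglongrightarrow> (\<integral>p. 0 \<partial>?P)"
  proof (rule bounded_convergence[of _ _ _ 6])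
    fix p assume p: "p \<in> space ?P"
    show "\<bar>\<bar>sample_hull_dist n M p - limit_hull_dist M p\<bar>\<bar> \<le> 6" for n using limit_hull_dist_bound[OF p, of M] sample_hull_dist_bound[OF p, of n M] by linarith
    show "(\<lambda>n. \<bar>sample_hull_dist n M p - limit_hull_dist M p\<bar>) \<longlonglongrightarrow> 0"
      using tendsto_rabs[OF tendsto_diff[OF sample_hull_dist_lim[OF p, of M] tendsto_const[of "limit_hull_dist M p"]]] by simp
  qed (auto simp: P.prob_space_axioms)
  then have e2: "\<forall>\<^sub>F n in sequentially. (\<integral>p. \<bar>sample_hull_dist n M p - limit_hull_dist M p\<bar> \<partial>?P) < r/4"
    by (rule order_tendstoD) (use r in simp)
  have dm [measurable]: "?d n \<in> borel_measurable ?P" for n by (rule X_pair_measurable)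
  have d_bound: "\<bar>?d n p\<bar> \<le> 1" if "p \<in> space ?P" for n p
    using tree_pseudometric_simps(3,4)[OF d XV XV, of "fst p" "snd p"] that
    by (auto simp: space_pair_measure)
  have bnd: "\<bar>u - v\<bar> \<le> 6" if "\<bar>u\<bar> \<le> 3" "\<bar>v\<bar> \<le> 3" for u v :: real
    using that by linarith
  have i1: "integrable ?P (\<lambda>p. \<bar>?d n p - sample_hull_dist n M p\<bar>)" for n
    by (rule P.integrable_const_bound[of _ 6])
       (auto intro!: AE_I2 bnd order_trans[OF d_bound] sample_hull_dist_bound)
  have i2: "integrable ?P (\<lambda>p. \<bar>sample_hull_dist n M p - limit_hull_dist M p\<bar>)" for n
    by (rule P.integrable_const_bound[of _ 6]) (auto intro!: AE_I2 bnd limit_hull_dist_bound sample_hull_dist_bound)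
  have i3: "integrable ?P (\<lambda>p. \<bar>limit_hull_dist M p - ?F p\<bar>)"
    by (rule P.integrable_const_bound[of _ 6]) (auto intro!: AE_I2 bnd limit_hull_dist_bound limit_dist_bound)
  have i4: "integrable ?P (\<lambda>p. \<bar>?d n p - ?F p\<bar>)" for n
    by (rule P.integrable_const_bound[of _ 6])
       (auto intro!: AE_I2 bnd order_trans[OF d_bound] limit_dist_bound)
  \<comment> \<open>Three errors below \<open>r/4\<close> each; the drop below \<open>r/16\<close>
    allows for the factor 4 of the greedy estimate.\<close>
  have total: "t < r" if "t \<le> a + b + c" "a \<le> 4 * q" "q < r/16" "b < r/4" "c < r/4" "0 < r"
    for t a b c q :: real
    using that by linarith
  have "\<forall>\<^sub>F n in sequentially. (\<integral>p. \<bar>?d n p - ?F p\<bar> \<partial>?P) < r"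
    using e1 e2
  proof eventually_elim
    case (elim n)
    have "(\<integral>p. \<bar>?d n p - ?F p\<bar> \<partial>?P)
        \<le> (\<integral>p. \<bar>?d n p - sample_hull_dist n M p\<bar> + \<bar>sample_hull_dist n M p - limit_hull_dist M p\<bar> + \<bar>limit_hull_dist M p - ?F p\<bar> \<partial>?P)"
      by (rule integral_mono[OF i4]) (auto intro!: Bochner_Integration.integrable_add i1 i2 i3)
    also have "\<dots> = (\<integral>p. \<bar>?d n p - sample_hull_dist n M p\<bar> \<partial>?P) + (\<integral>p. \<bar>sample_hull_dist n M p - limit_hull_dist M p\<bar> \<partial>?P)
        + (\<integral>p. \<bar>limit_hull_dist M p - ?F p\<bar> \<partial>?P)"
      by (simp add: Bochner_Integration.integral_add Bochner_Integration.integrable_add i1 i2 i3)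
    finally show ?case by (rule total[OF _ dist_hull_dist_integral elim(1,2) M(2) r])
  qed
  then show "\<exists>no. \<forall>n\<ge>no. norm ((\<integral>p. \<bar>?d n p - ?F p\<bar> \<partial>?P) - 0) < r"
    by (auto simp: eventually_sequentially integral_nonneg_AE)
qed

end

section \<open>Borel sets of matrices and push-forwards of samples\<close>

lemma space_borel_of [simp]: "space (borel_of X) = topspace X"
  by (auto simp: borel_of_def space_measure_of_conv)

lemma openin_in_sets_borel_of: "openin X U \<Longrightarrow> U \<in> sets (borel_of X)"
  unfolding borel_of_def by (subst sets_measure_of) (auto dest: openin_subset)

lemma measurable_borel_ofI:
  assumes "\<And>x. x \<in> space M \<Longrightarrow> f x \<in> topspace X" "\<And>U. openin X U \<Longrightarrow> f -` U \<inter> space M \<in> sets M"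
  shows "f \<in> M \<rightarrow>\<^sub>M borel_of X"
  unfolding borel_of_def
  by (rule measurable_measure_of) (use assms in \<open>auto dest: openin_subset\<close>)

lemma continuous_map_borel_of:
  assumes "continuous_map X euclideanreal f"
  shows "f \<in> borel_measurable (borel_of X)"
proof (rule borel_measurableI)
  fix S :: "real set" assume "open S"
  then have "openin X {x \<in> topspace X. f x \<in> S}"
    using openin_continuous_map_preimage[OF assms] by simp
  moreover have "f -` S \<inter> space (borel_of X) = {x \<in> topspace X. f x \<in> S}" by auto
  ultimately show "f -` S \<inter> space (borel_of X) \<in> sets (borel_of X)"
    by (simp add: openin_in_sets_borel_of)
qed

text \<open>Borel sets of a countable product are generated by the coordinates. This is used on the
  full function space, where \<open>f\<close> has the constant value \<open>undefined\<close> off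
  \<open>I\<close>; the continuous map \<open>restrict\<close> then pulls open sets of the smaller
  product back.\<close>

lemma measurable_powertop_real:
  fixes I :: "('i::countable) set"
  assumes ext: "\<And>x. x \<in> space M \<Longrightarrow> f x \<in> extensional I"
    and comp: "\<And>i. i \<in> I \<Longrightarrow> (\<lambda>x. f x i) \<in> borel_measurable M"
  shows "f \<in> M \<rightarrow>\<^sub>M borel_of (powertop_real I)"
proof (rule measurable_borel_ofI)
  show "f x \<in> topspace (powertop_real I)" if "x \<in> space M" for x
    using ext[OF that] by (simp add: PiE_UNIV_domain PiE_iff)
  have "(\<lambda>x. f x i) \<in> borel_measurable M" for i
  proof (cases "i \<in> I")
    case False
    have "(\<lambda>x. undefined :: real) \<in> borel_measurable M" by simp
    then show ?thesis
      by (rule measurable_cong[THEN iffD1, rotated]) (use ext False in \<open>auto simp: extensional_def\<close>)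
  qed (rule comp)
  then have f: "f \<in> borel_measurable M" by (rule measurable_coordinatewise_then_product)
  fix U assume U: "openin (powertop_real I) U"
  have "continuous_map euclidean (powertop_real I) (\<lambda>x. restrict x I)"
    unfolding continuous_map_componentwise
    by (auto simp: continuous_on_product_coordinates)
  then have "openin euclidean {x \<in> topspace euclidean. restrict x I \<in> U}"
    by (rule openin_continuous_map_preimage[OF _ U])
  then have "open {x. restrict x I \<in> U}" by simp
  then have "f -` {x. restrict x I \<in> U} \<inter> space M \<in> sets M"
    by (intro measurable_sets[OF f] borel_open)
  moreover have "f -` {x. restrict x I \<in> U} \<inter> space M = f -` U \<inter> space M"
    using ext by (auto simp: extensional_restrict)
  ultimately show "f -` U \<inter> space M \<in> sets M" by simp
qed

text \<open>For distinct indices the joint law of \<open>x i\<close> and \<open>x j\<close> is the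
  product measure; for equal ones it would sit on the diagonal.\<close>

lemma AE_PiM_pair:
  assumes M: "prob_space M" and ij: "i \<in> I" "j \<in> I" "i \<noteq> j"
    and AE: "AE p in M \<Otimes>\<^sub>M M. P (fst p) (snd p)"
  shows "AE x in Pi\<^sub>M I (\<lambda>_. M). P (x i) (x j)"
proof -
  interpret M: prob_space M by fact
  interpret product_prob_space "\<lambda>_. M" I ..
  have m: "(\<lambda>x. (x i, x j)) \<in> Pi\<^sub>M I (\<lambda>_. M) \<rightarrow>\<^sub>M M \<Otimes>\<^sub>M M"
    using ij by measurable
  have marginal: "M \<Otimes>\<^sub>M M = distr (Pi\<^sub>M I (\<lambda>_. M)) (M \<Otimes>\<^sub>M M) (\<lambda>x. (x i, x j))"
  proof (rule pair_measure_eqI)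
    fix A B assume AB: "A \<in> sets M" "B \<in> sets M"
    have "emeasure (distr (Pi\<^sub>M I (\<lambda>_. M)) (M \<Otimes>\<^sub>M M) (\<lambda>x. (x i, x j))) (A \<times> B)
        = emeasure (Pi\<^sub>M I (\<lambda>_. M)) ((\<lambda>x. (x i, x j)) -` (A \<times> B) \<inter> space (Pi\<^sub>M I (\<lambda>_. M)))"
      by (rule emeasure_distr[OF m]) (use AB in auto)
    also have "(\<lambda>x. (x i, x j)) -` (A \<times> B) \<inter> space (Pi\<^sub>M I (\<lambda>_. M))
        = {x \<in> space (Pi\<^sub>M I (\<lambda>_. M)). \<forall>k\<in>{i, j}. x k \<in> (if k = i then A else B)}"
      using ij by auto
    also have "emeasure (Pi\<^sub>M I (\<lambda>_. M)) \<dots> = (\<Prod>k\<in>{i, j}. emeasure M (if k = i then A else B))"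
      by (rule emeasure_PiM_Collect) (use ij AB in auto)
    also have "\<dots> = emeasure M A * emeasure M B" using ij by auto
    finally show "emeasure M A * emeasure M B
        = emeasure (distr (Pi\<^sub>M I (\<lambda>_. M)) (M \<Otimes>\<^sub>M M) (\<lambda>x. (x i, x j))) (A \<times> B)" by simp
  qed (auto intro: M.sigma_finite_measure_axioms)
  have "AE p in distr (Pi\<^sub>M I (\<lambda>_. M)) (M \<Otimes>\<^sub>M M) (\<lambda>x. (x i, x j)). P (fst p) (snd p)"
    unfolding marginal[symmetric] by (rule AE)
  from AE_distrD[OF m this] show ?thesis by simp
qed

lemma sample_matrix_measurable:
  assumes "(\<lambda>p. d (fst p) (snd p)) \<in> borel_measurable (N \<Otimes>\<^sub>M N)"
  shows "sample_matrix r d \<in> Pi\<^sub>M {1..r} (\<lambda>_. N) \<rightarrow>\<^sub>M borel_of (matrix_space r)"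
  unfolding matrix_space_def
proof (rule measurable_powertop_real)
  show "sample_matrix r d x \<in> extensional ({1..r} \<times> {1..r})" for x
    by (simp add: sample_matrix_def)
  fix ij assume ij: "ij \<in> {1..r} \<times> {1..r}"
  obtain i j where [simp]: "ij = (i, j)" by fastforce
  have "(\<lambda>x. (x i, x j)) \<in> Pi\<^sub>M {1..r} (\<lambda>_. N) \<rightarrow>\<^sub>M N \<Otimes>\<^sub>M N"
    using ij by (intro measurable_Pair measurable_component_singleton) auto
  from measurable_compose[OF this assms]
  show "(\<lambda>x. sample_matrix r d x ij) \<in> borel_measurable (Pi\<^sub>M {1..r} (\<lambda>_. N))"
    using ij by (cases "i = j") (auto simp: sample_matrix_def)
qed

text \<open>Sampling commutes with push-forward. All sampling measures thereby become laws of
  matrices on one common power of \<open>\<Omega>\<close>, where almost sure convergence makes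
  sense.\<close>

lemma sampling_measure_distr:
  assumes \<Omega>: "prob_space \<Omega>" and g: "g \<in> \<Omega> \<rightarrow>\<^sub>M N"
    and d: "(\<lambda>p. d (fst p) (snd p)) \<in> borel_measurable (N \<Otimes>\<^sub>M N)"
  shows "sampling_measure r d (distr \<Omega> N g)
    = distr (Pi\<^sub>M {1..r} (\<lambda>_. \<Omega>)) (borel_of (matrix_space r)) (\<lambda>x. sample_matrix r d (\<lambda>i. g (x i)))"
    and "(\<lambda>x. sample_matrix r d (\<lambda>i. g (x i))) \<in> Pi\<^sub>M {1..r} (\<lambda>_. \<Omega>) \<rightarrow>\<^sub>M borel_of (matrix_space r)"
proof -
  let ?D = "distr \<Omega> N g"
  have c: "compose {1..r} g \<in> Pi\<^sub>M {1..r} (\<lambda>_. \<Omega>) \<rightarrow>\<^sub>M Pi\<^sub>M {1..r} (\<lambda>_. ?D)"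
    unfolding compose_def using g by measurable
  have sm: "sample_matrix r d \<in> Pi\<^sub>M {1..r} (\<lambda>_. ?D) \<rightarrow>\<^sub>M borel_of (matrix_space r)"
    by (rule sample_matrix_measurable)
       (use d in \<open>simp cong: measurable_cong_sets add: sets_pair_measure_cong[OF sets_distr sets_distr]\<close>)
  have eq: "sample_matrix r d (compose {1..r} g x) = sample_matrix r d (\<lambda>i. g (x i))" for x
    by (auto simp: sample_matrix_def compose_def fun_eq_iff restrict_def)
  have "distr (Pi\<^sub>M {1..r} (\<lambda>_. \<Omega>)) (Pi\<^sub>M {1..r} (\<lambda>_. ?D)) (compose {1..r} g)
      = Pi\<^sub>M {1..r} (\<lambda>_. distr \<Omega> ?D g)"
    by (rule distr_PiM_finite_prob_space') (use \<Omega> g in \<open>auto intro: prob_space.prob_space_distr\<close>)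
  also have "distr \<Omega> ?D g = ?D" by (rule distr_cong) auto
  finally have D: "Pi\<^sub>M {1..r} (\<lambda>_. ?D) = distr (Pi\<^sub>M {1..r} (\<lambda>_. \<Omega>)) (Pi\<^sub>M {1..r} (\<lambda>_. ?D)) (compose {1..r} g)"
    by simp
  show "sampling_measure r d ?D = distr (Pi\<^sub>M {1..r} (\<lambda>_. \<Omega>)) (borel_of (matrix_space r))
      (\<lambda>x. sample_matrix r d (\<lambda>i. g (x i)))"
    unfolding sampling_measure_def by (subst D, subst distr_distr[OF sm c]) (simp add: comp_def eq del: One_nat_def)
  show "(\<lambda>x. sample_matrix r d (\<lambda>i. g (x i))) \<in> Pi\<^sub>M {1..r} (\<lambda>_. \<Omega>) \<rightarrow>\<^sub>M borel_of (matrix_space r)"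
    using measurable_compose[OF c sm] by (simp add: eq del: One_nat_def)
qed

section \<open>Separability of the span and the support of the feet\<close>

context tree_span
begin

text \<open>A point almost on the segment from \<open>k\<close> to \<open>l\<close> is nearly
  determined by its distance to \<open>k\<close>: by the four-point condition, the way from any
  \<open>i\<close> to it continues along the segment towards \<open>k\<close> or towards
  \<open>l\<close>.\<close>

lemma bucket_close:
  assumes f: "f \<in> tight_span E" "f k + f l \<le> E k l + r"
    and g: "g \<in> tight_span E" "g k + g l \<le> E k l + r" and fg: "\<bar>f k - g k\<bar> \<le> r"
  shows "sup_dist f g \<le> 2 * r"
proof -
  have "u i - v i \<le> 2 * r" if u: "u \<in> tight_span E" "u k + u l \<le> E k l + r"
    and v: "v \<in> tight_span E" "v k + v l \<le> E k l + r" and uv: "\<bar>u k - v k\<bar> \<le> r" for u v i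
  proof -
    have "sup_dist u (E i) + sup_dist (E k) (E l)
        \<le> max (sup_dist u (E k) + sup_dist (E i) (E l)) (sup_dist u (E l) + sup_dist (E i) (E k))"
      by (rule sup_dist_four_point[OF u(1) row_in_span row_in_span row_in_span])
    then have "u i + E k l \<le> u k + E i l \<or> u i + E k l \<le> u l + E i k"
      by (simp add: sup_dist_row u(1) row_in_span le_max_iff_disj)
    moreover have "E i l \<le> v i + v l" "E i k \<le> v i + v k" using span_ge[OF v(1)] by auto
    ultimately show ?thesis using u(2) v(2) uv by (auto simp: abs_le_iff)
  qed
  from this[OF f g fg] this[OF g f] fg show ?thesis
    by (intro sup_dist_le) (simp add: abs_le_iff minus_diff_commute abs_minus_commute)
qed

text \<open>The rows need not be dense in the span, which contains whole segments. Countably many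
  buckets cover \<open>S\<close> at every precision, and one point of \<open>S\<close> is taken from
  each nonempty bucket.\<close>

lemma dense_sequence:
  assumes S: "S \<subseteq> tight_span E" "S \<noteq> {}"
  obtains c :: "nat \<Rightarrow> nat \<Rightarrow> real" where "range c \<subseteq> S" "\<forall>f\<in>S. \<forall>r>0. \<exists>i. sup_dist f (c i) < r"
proof -
  \<comment> \<open>\<open>m\<close> is the precision, \<open>k\<close> and \<open>l\<close> name a
    segment, and \<open>b\<close> is the distance to \<open>k\<close> rounded down to the grid of
    mesh \<open>1 / (1 + real m)\<close>.\<close>
  define Q where "Q = (\<lambda>(m::nat, k, l, b::int) f. f \<in> S \<and> f k + f l \<le> E k l + 1 / (1 + real m) \<and>
    b = \<lfloor>f k * (1 + real m)\<rfloor>)"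
  obtain s0 where s0: "s0 \<in> S" using S by blast
  define C where "C x = (if \<exists>f. Q x f then SOME f. Q x f else s0)" for x
  have CQ: "Q x (C x)" if "Q x f" for x f
    using that someI_ex[of "Q x"] by (auto simp: C_def)
  have CS: "C x \<in> S" for x
    using CQ[of x] s0 by (cases "\<exists>f. Q x f") (auto simp: C_def Q_def split: prod.splits)
  show ?thesis
  proof (rule that[of "\<lambda>i. C (from_nat i)"])
    show "range (\<lambda>i. C (from_nat i)) \<subseteq> S" by (auto intro: CS)
    show "\<forall>f\<in>S. \<forall>r>0. \<exists>i. sup_dist f (C (from_nat i)) < r"
    proof (intro ballI allI impI)
      fix f and r :: real assume f: "f \<in> S" and r: "0 < r"
      obtain m :: nat where m: "inverse (real (Suc m)) < r / 2" using reals_Archimedean[of "r / 2"] r by auto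
      define \<delta> where "\<delta> = 1 / (1 + real m)"
      have \<delta>: "0 < \<delta>" "2 * \<delta> < r"
        using m by (simp_all add: \<delta>_def inverse_eq_divide)
      \<comment> \<open>Tightness at the fixed index 0 already puts every point near some segment
        starting at 0.\<close>
      obtain k where k: "f 0 + f k \<le> E 0 k + \<delta>" using span_tight[OF _ \<delta>(1)] f S by blast
      define x where "x = (m, 0::nat, k, \<lfloor>f 0 * (1 + real m)\<rfloor>)"
      have "Q x f" using f k by (simp add: Q_def x_def \<delta>_def)
      then have "Q x (C x)" by (rule CQ)
      then have c: "C x \<in> S" "C x 0 + C x k \<le> E 0 k + \<delta>" "\<lfloor>f 0 * (1 + real m)\<rfloor> = \<lfloor>C x 0 * (1 + real m)\<rfloor>"
        by (simp_all add: Q_def x_def \<delta>_def)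
      have "\<bar>f 0 * (1 + real m) - C x 0 * (1 + real m)\<bar> \<le> 1"
        using c(3) by linarith
      then have "\<bar>f 0 - C x 0\<bar> * (1 + real m) \<le> 1"
        by (simp add: left_diff_distrib[symmetric] abs_mult)
      then have "\<bar>f 0 - C x 0\<bar> \<le> \<delta>" by (simp add: \<delta>_def field_simps)
      then have "sup_dist f (C x) \<le> 2 * \<delta>"
        using bucket_close[of f 0 k \<delta> "C x"] f c k S by auto
      then have "sup_dist f (C (from_nat (to_nat x))) < r" using \<delta> by simp
      then show "\<exists>i. sup_dist f (C (from_nat i)) < r" by blast
    qed
  qed
qed

end

text \<open>Density is used twice: a first sequence provides countably many test balls, and
  discarding those of measure 0 leaves the full-measure set \<open>G\<close>; a second sequence is
  dense among the feet of \<open>G\<close>. A ball around such a foot contains a smaller test ball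
  through that foot, which has positive measure.\<close>

lemma (in sampled_limit) foot_support:
  obtains w :: "nat \<Rightarrow> 'w" where "\<And>k. w k \<in> space \<Omega>"
    "\<And>k r. 0 < r \<Longrightarrow> 0 < emeasure \<Omega> {\<omega> \<in> space \<Omega>. sup_dist (foot \<omega>) (foot (w k)) < r}"
    "AE \<omega> in \<Omega>. \<forall>r>0. \<exists>k. sup_dist (foot \<omega>) (foot (w k)) < r"
proof -
  interpret E: tree_span e by (rule tree_span.intro[OF e_tree])
  have S: "foot ` space \<Omega> \<subseteq> tight_span e" "foot ` space \<Omega> \<noteq> {}"
    using foot_in_span not_empty by auto
  obtain c :: "nat \<Rightarrow> nat \<Rightarrow> real" where c: "range c \<subseteq> foot ` space \<Omega>"
    "\<forall>f \<in> foot ` space \<Omega>. \<forall>r>0. \<exists>i. sup_dist f (c i) < r"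
    using E.dense_sequence[OF S] .
  define ball where "ball f r = {\<omega> \<in> space \<Omega>. sup_dist (foot \<omega>) f < r}" for f r
  have ball_sets: "ball f r \<in> sets \<Omega>" for f r unfolding ball_def by measurable
  define G where "G = {\<omega> \<in> space \<Omega>. \<forall>i m. emeasure \<Omega> (ball (c i) (1 / (1 + real m))) = 0 \<longrightarrow>
      \<omega> \<notin> ball (c i) (1 / (1 + real m))}"
  have "AE \<omega> in \<Omega>. emeasure \<Omega> (ball (c i) (1 / (1 + real m))) = 0 \<longrightarrow> \<omega> \<notin> ball (c i) (1 / (1 + real m))"
    for i and m :: nat
  proof (cases "emeasure \<Omega> (ball (c i) (1 / (1 + real m))) = 0")
    case True
    then have "ball (c i) (1 / (1 + real m)) \<in> null_sets \<Omega>" using ball_sets by auto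
    then show ?thesis by (auto dest: AE_not_in)
  qed simp
  then have "AE \<omega> in \<Omega>. \<forall>i m. emeasure \<Omega> (ball (c i) (1 / (1 + real m))) = 0 \<longrightarrow>
      \<omega> \<notin> ball (c i) (1 / (1 + real m))"
    by (simp add: AE_all_countable)
  then have G: "AE \<omega> in \<Omega>. \<omega> \<in> G"
    by (rule AE_mp) (auto simp: G_def intro!: AE_I2)
  have "G \<noteq> {}" using G AE_False by auto
  have GS: "G \<subseteq> space \<Omega>" by (auto simp: G_def)
  have SG: "foot ` G \<subseteq> tight_span e" "foot ` G \<noteq> {}"
    using foot_in_span GS \<open>G \<noteq> {}\<close> by auto
  obtain q :: "nat \<Rightarrow> nat \<Rightarrow> real" where q: "range q \<subseteq> foot ` G"
    "\<forall>f \<in> foot ` G. \<forall>r>0. \<exists>i. sup_dist f (q i) < r"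
    using E.dense_sequence[OF SG] .
  have "\<forall>k. \<exists>\<omega>. \<omega> \<in> G \<and> q k = foot \<omega>" using q(1) by auto
  then obtain w where w: "\<And>k. w k \<in> G" "\<And>k. q k = foot (w k)" by metis
  have pos: "0 < emeasure \<Omega> (ball (foot (w k)) r)" if r: "0 < r" for k r
  proof -
    obtain m :: nat where m: "inverse (real (Suc m)) < r / 2" using reals_Archimedean[of "r / 2"] r by auto
    define \<delta> where "\<delta> = 1 / (1 + real m)"
    have \<delta>: "0 < \<delta>" "2 * \<delta> < r"
      using m by (simp_all add: \<delta>_def inverse_eq_divide)
    have wk: "w k \<in> space \<Omega>" using w(1) GS by blast
    then obtain i where i: "sup_dist (foot (w k)) (c i) < \<delta>" using c(2) \<delta>(1) by blast
    then have "w k \<in> ball (c i) \<delta>" using wk by (simp add: ball_def)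
    then have "emeasure \<Omega> (ball (c i) \<delta>) \<noteq> 0" using w(1)[of k] by (auto simp: G_def \<delta>_def)
    moreover have "ball (c i) \<delta> \<subseteq> ball (foot (w k)) r"
    proof
      fix \<omega> assume \<omega>: "\<omega> \<in> ball (c i) \<delta>"
      have "c i \<in> tight_span e" by (rule subsetD[OF S(1) subsetD[OF c(1) rangeI]])
      then have "sup_dist (foot \<omega>) (foot (w k)) \<le> sup_dist (foot \<omega>) (c i) + sup_dist (c i) (foot (w k))"
        using \<omega> wk by (intro E.triangle foot_in_span) (auto simp: ball_def)
      then show "\<omega> \<in> ball (foot (w k)) r"
        using \<omega> i \<delta>(2) sup_dist_commute[of "c i" "foot (w k)"] by (simp add: ball_def)
    qed
    then have "emeasure \<Omega> (ball (c i) \<delta>) \<le> emeasure \<Omega> (ball (foot (w k)) r)"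
      by (rule emeasure_mono) (rule ball_sets)
    ultimately show ?thesis by (metis le_zero_eq zero_less_iff_neq_zero)
  qed
  have "AE \<omega> in \<Omega>. \<forall>r>0. \<exists>k. sup_dist (foot \<omega>) (foot (w k)) < r"
    using G by (rule AE_mp) (use q(2) w(2) in \<open>auto intro!: AE_I2\<close>)
  then show ?thesis using that[of w] w(1) GS pos by (auto simp: ball_def)
qed

section \<open>The limit dendron\<close>

lemma sample_matrix_in_topspace: "sample_matrix r u x \<in> topspace (matrix_space r)"
  by (auto simp: matrix_space_def sample_matrix_def)

text \<open>Almost sure convergence of the distances is assumed here; it comes from convergence in
  mean after thinning the sequence.\<close>

locale sampled_dendron = sampled_limit \<Omega> V d z X \<phi> e
  for \<Omega> :: "'w measure" and V :: "nat \<Rightarrow> 'a set" and d z X \<phi> e +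
  fixes w :: "nat \<Rightarrow> 'w"
  assumes w_space: "w k \<in> space \<Omega>"
    and w_support: "0 < r \<Longrightarrow> 0 < emeasure \<Omega> {\<omega> \<in> space \<Omega>. sup_dist (foot \<omega>) (foot (w k)) < r}"
    and w_dense: "AE \<omega> in \<Omega>. \<forall>r>0. \<exists>k. sup_dist (foot \<omega>) (foot (w k)) < r"
    and lim_dist: "AE p in \<Omega> \<Otimes>\<^sub>M \<Omega>.
      (\<lambda>n. d n (X n (fst p)) (X n (snd p))) \<longlonglongrightarrow> limit_dist (fst p) (snd p)"
begin

text \<open>The spanning points themselves may be leaves of branches of measure zero, so the tree is spanned
  anew by points \<open>foot (w k)\<close> that are dense in the support.\<close>

definition core :: "nat \<Rightarrow> nat \<Rightarrow> real" where
  "core k l = sup_dist (foot (w k)) (foot (w l))"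

lemma core_tree: "tree_pseudometric UNIV core"
proof -
  interpret e: tree_span e by (rule tree_span.intro[OF e_tree])
  have f: "foot (w k) \<in> tight_span e" for k by (rule foot_in_span[OF w_space])
  show ?thesis
    unfolding tree_pseudometric_def core_def
    using e.mdist_zero[OF f] sup_dist_commute e.sup_dist_le1[OF f f] e.sup_dist_four_point[OF f f f f]
    by blast
qed

sublocale S: tree_span core
  by (rule tree_span.intro[OF core_tree])

definition position :: "'w \<Rightarrow> nat \<Rightarrow> real" where
  "position \<omega> k = sup_dist (foot \<omega>) (foot (w k))"

definition good :: "'w set" where
  "good = {\<omega> \<in> space \<Omega>. \<forall>m. \<exists>k. position \<omega> k < 1 / (1 + real m)}"

text \<open>Off \<open>good\<close> the positions need not lie in the new span. The default keeps
  \<open>point\<close> inside the space there and affects only a null set.\<close>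

definition point :: "'w \<Rightarrow> (nat \<Rightarrow> real) \<times> real" where
  "point \<omega> = (if \<omega> \<in> good then (position \<omega>, hair \<omega>) else (core 0, 0))"

definition \<nu> :: "((nat \<Rightarrow> real) \<times> real) measure" where
  "\<nu> = distr \<Omega> (borel_of (dendron_topology S.span_metric)) point"

lemma position_measurable [measurable]: "(\<lambda>\<omega>. position \<omega> k) \<in> borel_measurable \<Omega>"
  unfolding position_def by measurable

lemma good_sets [measurable]: "good \<in> sets \<Omega>"
  unfolding good_def by measurable

lemma good_space: "\<omega> \<in> good \<Longrightarrow> \<omega> \<in> space \<Omega>"
  by (simp add: good_def)

lemma AE_good: "AE \<omega> in \<Omega>. \<omega> \<in> good"
  using w_dense by (rule AE_mp) (auto simp: good_def position_def intro!: AE_I2)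

lemma good_dense:
  assumes "\<omega> \<in> good" "0 < r"
  obtains k where "position \<omega> k < r"
proof -
  obtain m :: nat where m: "inverse (real (Suc m)) < r" using reals_Archimedean[OF assms(2)] by auto
  obtain k where "position \<omega> k < 1 / (1 + real m)" using assms(1) by (auto simp: good_def)
  then show ?thesis using m that by (simp add: inverse_eq_divide) (meson less_trans)
qed

lemma position_triangle:
  assumes "\<omega> \<in> space \<Omega>" "\<omega>' \<in> space \<Omega>"
  shows "core k l \<le> position \<omega> k + position \<omega> l"
    and "position \<omega> k \<le> core k l + position \<omega> l"
    and "\<bar>position \<omega> k - position \<omega>' k\<bar> \<le> sup_dist (foot \<omega>) (foot \<omega>')"
    and "sup_dist (foot \<omega>) (foot \<omega>') \<le> position \<omega> k + position \<omega>' k"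
proof -
  interpret e: tree_span e by (rule tree_span.intro[OF e_tree])
  note f = foot_in_span[OF w_space] foot_in_span[OF assms(1)] foot_in_span[OF assms(2)]
  show "core k l \<le> position \<omega> k + position \<omega> l"
    using e.triangle[OF f(1) f(2) f(1), of k l] sup_dist_commute[of "foot (w k)" "foot \<omega>"]
    by (simp add: core_def position_def)
  show "position \<omega> k \<le> core k l + position \<omega> l"
    using e.triangle[OF f(2) f(1) f(1), of k l] sup_dist_commute[of "foot (w k)" "foot (w l)"]
    by (simp add: core_def position_def)
  show "sup_dist (foot \<omega>) (foot \<omega>') \<le> position \<omega> k + position \<omega>' k"
    using e.triangle[OF f(2) f(1) f(3), of k] sup_dist_commute[of "foot (w k)" "foot \<omega>'"]
    by (simp add: position_def)
  show "\<bar>position \<omega> k - position \<omega>' k\<bar> \<le> sup_dist (foot \<omega>) (foot \<omega>')"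
    using e.triangle[OF f(2) f(3) f(1), of k] e.triangle[OF f(3) f(2) f(1), of k]
      sup_dist_commute[of "foot \<omega>" "foot \<omega>'"]
    by (simp add: position_def abs_le_iff)
qed

text \<open>A core point within \<open>r/2\<close> of the foot serves as tight partner of every
  index at once.\<close>

lemma position_in_span:
  assumes \<omega>: "\<omega> \<in> good"
  shows "position \<omega> \<in> tight_span core"
  unfolding tight_span_def
proof (intro CollectI conjI allI impI)
  fix i j show "core i j \<le> position \<omega> i + position \<omega> j"
    by (rule position_triangle(1)[OF good_space[OF \<omega>] good_space[OF \<omega>]])
next
  fix i and r :: real assume "0 < r"
  then obtain j where "position \<omega> j < r/2" using good_dense[OF \<omega>, of "r/2"] by auto
  then have "position \<omega> i + position \<omega> j \<le> core i j + r"
    using position_triangle(2)[OF good_space[OF \<omega>] good_space[OF \<omega>], of i j] by linarith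
  then show "\<exists>j. position \<omega> i + position \<omega> j \<le> core i j + r" by blast
qed

text \<open>Distances to the points \<open>foot (w k)\<close> determine the distance of two feet,
  because these points come arbitrarily close to one of them.\<close>

lemma sup_dist_position:
  assumes \<omega>: "\<omega> \<in> good" "\<omega>' \<in> good"
  shows "sup_dist (position \<omega>) (position \<omega>') = sup_dist (foot \<omega>) (foot \<omega>')"
proof (rule antisym)
  note t = position_triangle[OF \<omega>[THEN good_space]]
  show "sup_dist (position \<omega>) (position \<omega>') \<le> sup_dist (foot \<omega>) (foot \<omega>')"
    by (rule sup_dist_le) (rule t(3))
  show "sup_dist (foot \<omega>) (foot \<omega>') \<le> sup_dist (position \<omega>) (position \<omega>')"
  proof (rule field_le_epsilon)
    fix r :: real assume "0 < r"
    then obtain k where "position \<omega> k < r/2" using good_dense[OF \<omega>(1), of "r/2"] by auto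
    then show "sup_dist (foot \<omega>) (foot \<omega>') \<le> sup_dist (position \<omega>) (position \<omega>') + r"
      using t(4)[of k] S.abs_le_sup_dist[OF position_in_span[OF \<omega>(1)] position_in_span[OF \<omega>(2)], of k]
      by linarith
  qed
qed

lemma topspace_dendron [simp]:
  "topspace (dendron_topology S.span_metric) = tight_span core \<times> {0..}"
  by (simp add: dendron_topology_def)

lemma point_in:
  assumes "\<omega> \<in> space \<Omega>"
  shows "point \<omega> \<in> tight_span core \<times> {0..}"
  using position_in_span S.row_in_span hair_nonneg[OF assms] by (simp add: point_def)

text \<open>The boxes with core centres and rational data need not form a base of the topology,
  since the core points need not be dense in the span. They are a base at the values of
  \<open>point\<close> on \<open>good\<close>, which suffices to write preimages of open sets as
  countable unions.\<close>

lemma open_box_around: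
  assumes U: "openin (dendron_topology S.span_metric) U" and \<omega>: "\<omega> \<in> good" "point \<omega> \<in> U"
  obtains k m and a b :: rat where
    "S.mball (core k) (1 / (1 + real m)) \<times> ({of_rat a<..<of_rat b} \<inter> {0..}) \<subseteq> U"
    "position \<omega> k < 1 / (1 + real m)" "of_rat a < hair \<omega>" "hair \<omega> < of_rat b"
proof -
  have p: "(position \<omega>, hair \<omega>) \<in> U" using \<omega> by (simp add: point_def)
  obtain A B where AB: "openin S.mtopology A" "openin (top_of_set {0..}) B" "position \<omega> \<in> A" "hair \<omega> \<in> B"
    "A \<times> B \<subseteq> U"
    using U p unfolding dendron_topology_def openin_prod_topology_alt by (simp, metis)
  obtain r where r: "0 < r" "S.mball (position \<omega>) r \<subseteq> A"
    using AB(1,3) unfolding S.openin_mtopology by blast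
  obtain m :: nat where m: "inverse (real (Suc m)) < r/2" using reals_Archimedean[of "r/2"] r by auto
  obtain k where k: "position \<omega> k < 1 / (1 + real m)" using \<omega>(1) by (auto simp: good_def)
  have ball: "S.mball (core k) (1 / (1 + real m)) \<subseteq> A"
  proof
    fix f assume f: "f \<in> S.mball (core k) (1 / (1 + real m))"
    have ps: "position \<omega> \<in> tight_span core" by (rule position_in_span[OF \<omega>(1)])
    have "sup_dist (position \<omega>) f \<le> sup_dist (position \<omega>) (core k) + sup_dist (core k) f"
      by (rule S.triangle[OF ps S.row_in_span]) (use f in simp)
    also have "\<dots> < r"
      using f k m S.sup_dist_row[OF ps, of k] by (simp add: inverse_eq_divide)
    finally show "f \<in> A" using r(2) ps f by auto
  qed
  obtain O' where O: "open O'" "B = {0..} \<inter> O'" using AB(2) by (auto simp: openin_open)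
  then obtain x where x: "0 < x" "ball (hair \<omega>) x \<subseteq> O'"
    using AB(4) open_contains_ball by blast
  obtain a :: rat where a: "hair \<omega> - x < of_rat a" "of_rat a < hair \<omega>"
    using of_rat_dense[of "hair \<omega> - x" "hair \<omega>"] x by auto
  obtain b :: rat where b: "hair \<omega> < of_rat b" "of_rat b < hair \<omega> + x"
    using of_rat_dense[of "hair \<omega>" "hair \<omega> + x"] x by auto
  have "{of_rat a<..<of_rat b} \<subseteq> O'"
  proof
    fix y assume "y \<in> {of_rat a<..<real_of_rat b}"
    then have "y \<in> ball (hair \<omega>) x" using a b by (auto simp: dist_real_def abs_less_iff)
    then show "y \<in> O'" using x(2) by blast
  qed
  then have "{of_rat a<..<of_rat b} \<inter> {0..} \<subseteq> B" using O(2) by blast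
  then show ?thesis using that[of k m a b] ball AB(5) k a b by blast
qed

lemma point_measurable [measurable]: "point \<in> \<Omega> \<rightarrow>\<^sub>M borel_of (dendron_topology S.span_metric)"
proof (rule measurable_borel_ofI)
  show "point \<omega> \<in> topspace (dendron_topology S.span_metric)" if "\<omega> \<in> space \<Omega>" for \<omega>
    using point_in[OF that] by simp
  fix U assume U: "openin (dendron_topology S.span_metric) U"
  define J where "J = {(k, m::nat, a::rat, b::rat).
    S.mball (core k) (1 / (1 + real m)) \<times> ({of_rat a<..<of_rat b} \<inter> {0..}) \<subseteq> U}"
  define W where "W = (\<lambda>(k, m::nat, a::rat, b::rat).
    {\<omega> \<in> good. position \<omega> k < 1 / (1 + real m) \<and> of_rat a < hair \<omega> \<and> hair \<omega> < of_rat b})"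
  have Wm: "W x \<in> sets \<Omega>" for x
  proof -
    obtain k m a b where x: "x = (k, m, a, b)" by (cases x)
    have "W x = good \<inter> {\<omega> \<in> space \<Omega>. position \<omega> k < 1 / (1 + real m) \<and> of_rat a < hair \<omega> \<and> hair \<omega> < of_rat b}"
      using good_space by (auto simp: W_def x)
    also have "\<dots> \<in> sets \<Omega>" by measurable
    finally show ?thesis .
  qed
  have eq: "point -` U \<inter> good = (\<Union>x\<in>J. W x)"
  proof (intro set_eqI iffI)
    fix \<omega> assume \<omega>: "\<omega> \<in> point -` U \<inter> good"
    then obtain k m and a b :: rat where
      "S.mball (core k) (1 / (1 + real m)) \<times> ({of_rat a<..<of_rat b} \<inter> {0..}) \<subseteq> U"
      "position \<omega> k < 1 / (1 + real m)" "of_rat a < hair \<omega>" "hair \<omega> < of_rat b"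
      using open_box_around[OF U, of \<omega>] by blast
    then have "(k, m, a, b) \<in> J" "\<omega> \<in> W (k, m, a, b)" using \<omega> by (auto simp: J_def W_def)
    then show "\<omega> \<in> (\<Union>x\<in>J. W x)" by blast
  next
    fix \<omega> assume "\<omega> \<in> (\<Union>x\<in>J. W x)"
    then obtain k m and a b :: rat where
      box: "S.mball (core k) (1 / (1 + real m)) \<times> ({of_rat a<..<of_rat b} \<inter> {0..}) \<subseteq> U"
      and \<omega>: "\<omega> \<in> good" "position \<omega> k < 1 / (1 + real m)" "of_rat a < hair \<omega>" "hair \<omega> < of_rat b"
      by (auto simp: J_def W_def)
    have "position \<omega> \<in> S.mball (core k) (1 / (1 + real m))"
      using position_in_span[OF \<omega>(1)] S.row_in_span \<omega>(2) S.sup_dist_row[OF position_in_span[OF \<omega>(1)], of k]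
        sup_dist_commute[of "core k" "position \<omega>"] by simp
    then have "(position \<omega>, hair \<omega>) \<in> U" using box \<omega> hair_nonneg[OF good_space[OF \<omega>(1)]] by auto
    then show "\<omega> \<in> point -` U \<inter> good" using \<omega>(1) by (simp add: point_def)
  qed
  have "point -` U \<inter> good \<in> sets \<Omega>"
    unfolding eq by (rule sets.countable_UN') (auto simp: Wm)
  moreover have "point -` U \<inter> (space \<Omega> - good) \<in> sets \<Omega>"
  proof -
    have "point -` U \<inter> (space \<Omega> - good) = (if (core 0, 0) \<in> U then space \<Omega> - good else {})"
      by (auto simp: point_def)
    then show ?thesis by auto
  qed
  moreover have "point -` U \<inter> space \<Omega> = point -` U \<inter> good \<union> point -` U \<inter> (space \<Omega> - good)"
    using good_space by auto
  ultimately show "point -` U \<inter> space \<Omega> \<in> sets \<Omega>" by simp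
qed

lemma \<nu>_prob: "\<nu> \<in> borel_probs (dendron_topology S.span_metric)"
  unfolding borel_probs_def \<nu>_def using prob_space_distr[OF point_measurable] by simp

text \<open>A branch contains a ball around some \<open>core k\<close>. The sample points landing
  there are, up to a null set, those whose feet are near \<open>foot (w k)\<close>, and
  \<open>w k\<close> was chosen in the support.\<close>

lemma branch_positive:
  assumes "B \<in> branches S.span_metric"
  shows "0 < emeasure \<nu> (B \<times> {0..})"
proof -
  have "openin (dendron_topology S.span_metric) (B \<times> {0..})"
    using S.openin_branch[OF assms] by (simp add: dendron_topology_def openin_prod_Times_iff)
  then have B: "B \<times> {0..} \<in> sets (borel_of (dendron_topology S.span_metric))"
    by (rule openin_in_sets_borel_of)
  obtain k r where r: "0 < r" "S.mball (core k) r \<subseteq> B"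
    using S.branch_contains_row_ball[OF assms] .
  have "emeasure \<Omega> {\<omega> \<in> space \<Omega>. sup_dist (foot \<omega>) (foot (w k)) < r}
      \<le> emeasure \<Omega> (point -` (B \<times> {0..}) \<inter> space \<Omega>)"
  proof (rule emeasure_mono_AE)
    show "AE \<omega> in \<Omega>. \<omega> \<in> {\<omega> \<in> space \<Omega>. sup_dist (foot \<omega>) (foot (w k)) < r} \<longrightarrow>
        \<omega> \<in> point -` (B \<times> {0..}) \<inter> space \<Omega>"
      using AE_good
    proof (rule AE_mp, intro AE_I2 impI)
      fix \<omega> assume \<omega>: "\<omega> \<in> good" "\<omega> \<in> {\<omega> \<in> space \<Omega>. sup_dist (foot \<omega>) (foot (w k)) < r}"
      have "position \<omega> \<in> S.mball (core k) r"
        using position_in_span[OF \<omega>(1)] S.row_in_span \<omega>(2) S.sup_dist_row[OF position_in_span[OF \<omega>(1)], of k]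
          sup_dist_commute[of "core k" "position \<omega>"] by (simp add: position_def)
      then show "\<omega> \<in> point -` (B \<times> {0..}) \<inter> space \<Omega>"
        using r(2) \<omega> hair_nonneg[of \<omega>] by (auto simp: point_def)
    qed
    show "point -` (B \<times> {0..}) \<inter> space \<Omega> \<in> sets \<Omega>" by (rule measurable_sets[OF point_measurable B])
  qed
  then show ?thesis
    using w_support[OF r(1), of k] emeasure_distr[OF point_measurable B] by (simp add: \<nu>_def)
qed

lemma long_dendron_\<nu>: "long_dendron S.span_metric \<nu>"
  unfolding long_dendron_def using S.real_tree_span \<nu>_prob branch_positive by blast

text \<open>Continuity of the distance alone would give measurability for the Borel sets of the
  product topology. Written as a supremum over countably many coordinates, it is measurable for the
  product sigma-algebra.\<close>

lemma dendron_dist_measurable [measurable]: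
  "(\<lambda>p. dendron_dist S.span_metric (fst p) (snd p)) \<in> borel_measurable
    (borel_of (dendron_topology S.span_metric) \<Otimes>\<^sub>M borel_of (dendron_topology S.span_metric))"
proof -
  let ?N = "borel_of (dendron_topology S.span_metric)"
  have c: "continuous_map S.mtopology euclideanreal (\<lambda>f. f k)" for k
  proof -
    have "\<exists>r>0. \<forall>g. g \<in> tight_span core \<and> sup_dist f g < r \<longrightarrow> g k \<in> U"
      if f: "f \<in> tight_span core" and U: "open U" "f k \<in> U" for f and U :: "real set"
    proof -
      obtain r where r: "0 < r" "ball (f k) r \<subseteq> U" using U open_contains_ball by blast
      have "g k \<in> U" if "g \<in> tight_span core" "sup_dist f g < r" for g
        using S.abs_le_sup_dist[OF f that(1), of k] that(2) r(2) by (auto simp: dist_real_def subset_iff)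
      then show ?thesis using r(1) by blast
    qed
    then show ?thesis unfolding S.continuous_map_from_metric by auto
  qed
  have "continuous_map (dendron_topology S.span_metric) euclideanreal (\<lambda>x. fst x k)" for k
    unfolding dendron_topology_def
    using continuous_map_compose[OF continuous_map_fst[of S.mtopology "top_of_set {0::real..}"] c[of k]]
    by (simp add: comp_def)
  from continuous_map_borel_of[OF this]
  have m1: "(\<lambda>x. fst x k) \<in> borel_measurable ?N" for k .
  have "continuous_map (dendron_topology S.span_metric) euclideanreal snd"
    unfolding dendron_topology_def
    using continuous_map_into_fulltopology[OF continuous_map_snd[of S.mtopology "top_of_set {0::real..}"]] by simp
  from continuous_map_borel_of[OF this]
  have m2: "snd \<in> borel_measurable ?N" .
  have [measurable]: "(\<lambda>p. fst (fst p) k) \<in> borel_measurable (?N \<Otimes>\<^sub>M ?N)"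
    "(\<lambda>p. fst (snd p) k) \<in> borel_measurable (?N \<Otimes>\<^sub>M ?N)" for k
    by (rule measurable_compose[OF measurable_fst m1], rule measurable_compose[OF measurable_snd m1])
  have [measurable]: "(\<lambda>p. snd (fst p)) \<in> borel_measurable (?N \<Otimes>\<^sub>M ?N)"
    "(\<lambda>p. snd (snd p)) \<in> borel_measurable (?N \<Otimes>\<^sub>M ?N)"
    by (rule measurable_compose[OF measurable_fst m2], rule measurable_compose[OF measurable_snd m2])
  have "(\<lambda>p. sup_dist (fst (fst p)) (fst (snd p)) + snd (fst p) + snd (snd p))
      \<in> borel_measurable (?N \<Otimes>\<^sub>M ?N)"
    by measurable
  then show ?thesis by (simp add: dendron_dist_def case_prod_beta)
qed

lemma dendron_dist_point:
  "\<omega> \<in> good \<Longrightarrow> \<omega>' \<in> good \<Longrightarrow>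
    dendron_dist S.span_metric (point \<omega>) (point \<omega>') = limit_dist \<omega> \<omega>'"
  by (simp add: dendron_dist_def point_def sup_dist_position limit_dist_def)

lemma AE_pair_good: "AE p in \<Omega> \<Otimes>\<^sub>M \<Omega>. fst p \<in> good \<and> snd p \<in> good"
proof -
  interpret P: pair_prob_space \<Omega> \<Omega> ..
  show ?thesis
  proof (rule P.AE_pair_measure)
    show "{p \<in> space (\<Omega> \<Otimes>\<^sub>M \<Omega>). fst p \<in> good \<and> snd p \<in> good} \<in> sets (\<Omega> \<Otimes>\<^sub>M \<Omega>)"
      by measurable
    show "AE x in \<Omega>. AE y in \<Omega>. fst (x, y) \<in> good \<and> snd (x, y) \<in> good"
      using AE_good by (auto elim: AE_mp)
  qed
qed

lemma AE_limit:
  "AE p in \<Omega> \<Otimes>\<^sub>M \<Omega>. (\<lambda>n. d n (X n (fst p)) (X n (snd p)))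
    \<longlonglongrightarrow> dendron_dist S.span_metric (point (fst p)) (point (snd p))"
  using lim_dist AE_pair_good by eventually_elim (simp add: dendron_dist_point)

text \<open>The distance of two independent points is almost surely a limit of normalised tree
  distances, all at most 1.\<close>

lemma dendron_\<nu>: "dendron S.span_metric \<nu>"
proof -
  let ?N = "borel_of (dendron_topology S.span_metric)"
  let ?A = "{(x, y) \<in> (mspace S.span_metric \<times> {0..}) \<times> (mspace S.span_metric \<times> {0..}).
    1 < dendron_dist S.span_metric x y}"
  interpret P: pair_prob_space \<Omega> \<Omega> ..
  have sf: "sigma_finite_measure (distr \<Omega> ?N point)"
    using prob_space_imp_sigma_finite[OF prob_space_distr[OF point_measurable]] .
  have sp: "space (?N \<Otimes>\<^sub>M ?N) = (tight_span core \<times> {0..}) \<times> (tight_span core \<times> {0..})"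
    by (simp add: space_pair_measure)
  have A: "?A = {p \<in> space (?N \<Otimes>\<^sub>M ?N). 1 < dendron_dist S.span_metric (fst p) (snd p)}"
    unfolding sp by auto
  have Am: "?A \<in> sets (?N \<Otimes>\<^sub>M ?N)"
    unfolding A by measurable
  have pm: "(\<lambda>(x, y). (point x, point y)) \<in> \<Omega> \<Otimes>\<^sub>M \<Omega> \<rightarrow>\<^sub>M ?N \<Otimes>\<^sub>M ?N"
    by measurable
  have \<nu>2: "\<nu> \<Otimes>\<^sub>M \<nu> = distr (\<Omega> \<Otimes>\<^sub>M \<Omega>) (?N \<Otimes>\<^sub>M ?N) (\<lambda>(x, y). (point x, point y))"
    unfolding \<nu>_def by (rule pair_measure_distr[OF point_measurable point_measurable sf])
  have "AE p in \<Omega> \<Otimes>\<^sub>M \<Omega>. dendron_dist S.span_metric (point (fst p)) (point (snd p)) \<le> 1"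
    using AE_limit
  proof (rule AE_mp, intro AE_I2 impI)
    fix p assume p: "p \<in> space (\<Omega> \<Otimes>\<^sub>M \<Omega>)"
      and lim: "(\<lambda>n. d n (X n (fst p)) (X n (snd p)))
        \<longlonglongrightarrow> dendron_dist S.span_metric (point (fst p)) (point (snd p))"
    show "dendron_dist S.span_metric (point (fst p)) (point (snd p)) \<le> 1"
      by (rule LIMSEQ_le_const2[OF lim])
         (use p in \<open>auto simp: space_pair_measure intro!: tree_pseudometric_simps(3)[OF d XV XV]\<close>)
  qed
  then have "AE p in \<nu> \<Otimes>\<^sub>M \<nu>. dendron_dist S.span_metric (fst p) (snd p) \<le> 1"
    unfolding \<nu>2 by (subst AE_distr_iff[OF pm]) (simp_all add: case_prod_beta)
  then have "AE p in \<nu> \<Otimes>\<^sub>M \<nu>. p \<notin> ?A"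
    by (rule AE_mp) (auto intro!: AE_I2)
  moreover have Am': "?A \<in> sets (\<nu> \<Otimes>\<^sub>M \<nu>)" unfolding \<nu>2 sets_distr by (rule Am)
  ultimately have "?A \<in> null_sets (\<nu> \<Otimes>\<^sub>M \<nu>)"
    by (subst AE_iff_null_sets)
  then show ?thesis using long_dendron_\<nu> by (simp add: dendron_def)
qed

lemma dendron_sampling_in_borel_probs:
  "dendron_sampling r S.span_metric \<nu> \<in> borel_probs (matrix_space r)"
proof -
  have "prob_space (Pi\<^sub>M {1..r} (\<lambda>_. \<Omega>))" by (rule prob_space_PiM) (rule prob_space_axioms)
  from prob_space.prob_space_distr[OF this
      sampling_measure_distr(2)[OF prob_space_axioms point_measurable dendron_dist_measurable]]
  show ?thesis
    by (simp add: dendron_sampling_def \<nu>_def borel_probs_def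
        sampling_measure_distr(1)[OF prob_space_axioms point_measurable dendron_dist_measurable]
        del: One_nat_def)
qed

text \<open>Almost surely all of the finitely many off-diagonal entries converge, and dominated
  convergence applies. The diagonal is treated apart: its entries are 0 by convention, whereas
  \<open>limit_dist\<close> of a point with itself is twice its hair.\<close>

theorem sampling_converges:
  assumes f: "continuous_map (matrix_space r) euclideanreal f" "bounded (f ` topspace (matrix_space r))"
  shows "(\<lambda>n. \<integral>x. f x \<partial>(sampling_measure r (d n) (uniform_count_measure (V n))))
    \<longlonglongrightarrow> (\<integral>x. f x \<partial>(dendron_sampling r S.span_metric \<nu>))"
proof -
  let ?P = "Pi\<^sub>M {1..r} (\<lambda>_. \<Omega>)" and ?B = "borel_of (matrix_space r)"
  define An where "An n x = sample_matrix r (d n) (\<lambda>i. X n (x i))" for n x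
  define A where "A x = sample_matrix r (dendron_dist S.span_metric) (\<lambda>i. point (x i))" for x
  have P: "prob_space ?P" by (rule prob_space_PiM) (rule prob_space_axioms)
  have dm: "(\<lambda>p. d n (fst p) (snd p)) \<in> borel_measurable (count_space (V n) \<Otimes>\<^sub>M count_space (V n))" for n
    using V by (simp add: pair_measure_countable countable_finite)
  have n1: "sampling_measure r (d n) (uniform_count_measure (V n)) = distr ?P ?B (An n)"
    and n2: "An n \<in> ?P \<rightarrow>\<^sub>M ?B" for n
    using sampling_measure_distr[OF prob_space_axioms X dm, of r n] by (simp_all add: X_law An_def[abs_def])
  have D: "dendron_sampling r S.span_metric \<nu> = distr ?P ?B A" "A \<in> ?P \<rightarrow>\<^sub>M ?B"
    using sampling_measure_distr[OF prob_space_axioms point_measurable dendron_dist_measurable, of r]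
    by (simp_all add: dendron_sampling_def \<nu>_def A_def[abs_def])
  have fm: "f \<in> borel_measurable ?B" by (rule continuous_map_borel_of[OF f(1)])
  obtain K where K: "\<And>y. y \<in> topspace (matrix_space r) \<Longrightarrow> \<bar>f y\<bar> \<le> K"
    using f(2) by (auto simp: bounded_iff)
  have "(\<lambda>n. \<integral>x. f (An n x) \<partial>?P) \<longlonglongrightarrow> (\<integral>x. f (A x) \<partial>?P)"
  proof (rule integral_dominated_convergence[where w = "\<lambda>_. K"])
    show "(\<lambda>x. f (A x)) \<in> borel_measurable ?P" by (rule measurable_compose[OF D(2) fm])
    show "(\<lambda>x. f (An n x)) \<in> borel_measurable ?P" for n by (rule measurable_compose[OF n2 fm])
    show "integrable ?P (\<lambda>_. K)"
      by (rule finite_measure.integrable_const) (rule prob_space.axioms(1)[OF P])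
    show "AE x in ?P. norm (f (An n x)) \<le> K" for n
      by (rule AE_I2) (simp add: An_def K sample_matrix_in_topspace)
    have "AE x in ?P. \<forall>ij\<in>{ij \<in> {1..r} \<times> {1..r}. fst ij \<noteq> snd ij}.
        (\<lambda>n. d n (X n (x (fst ij))) (X n (x (snd ij))))
          \<longlonglongrightarrow> dendron_dist S.span_metric (point (x (fst ij))) (point (x (snd ij)))"
    proof (rule AE_finite_allI)
      fix ij assume ij: "ij \<in> {ij \<in> {1..r} \<times> {1..r}. fst ij \<noteq> snd ij}"
      show "AE x in ?P. (\<lambda>n. d n (X n (x (fst ij))) (X n (x (snd ij))))
          \<longlonglongrightarrow> dendron_dist S.span_metric (point (x (fst ij))) (point (x (snd ij)))"
        by (rule AE_PiM_pair[OF prob_space_axioms _ _ _ AE_limit]) (use ij in auto)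
    qed simp
    then show "AE x in ?P. (\<lambda>n. f (An n x)) \<longlonglongrightarrow> f (A x)"
    proof (rule AE_mp, intro AE_I2 impI)
      fix x assume lim: "\<forall>ij\<in>{ij \<in> {1..r} \<times> {1..r}. fst ij \<noteq> snd ij}.
        (\<lambda>n. d n (X n (x (fst ij))) (X n (x (snd ij))))
          \<longlonglongrightarrow> dendron_dist S.span_metric (point (x (fst ij))) (point (x (snd ij)))"
      have "limitin (matrix_space r) (\<lambda>n. An n x) (A x) sequentially"
        unfolding matrix_space_def limitin_componentwise
      proof (intro conjI ballI)
        show "A x \<in> extensional ({1..r} \<times> {1..r})" by (simp add: A_def sample_matrix_def)
        show "\<forall>\<^sub>F n in sequentially. An n x \<in> topspace (powertop_real ({1..r} \<times> {1..r}))"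
          unfolding An_def
          by (intro always_eventually allI sample_matrix_in_topspace[unfolded matrix_space_def])
        fix ij assume ij: "ij \<in> {1..r} \<times> {1..r}"
        obtain i j where [simp]: "ij = (i, j)" by fastforce
        show "limitin euclideanreal (\<lambda>n. An n x ij) (A x ij) sequentially"
          using ij lim[rule_format, of ij]
          by (cases "i = j") (auto simp: An_def A_def sample_matrix_def)
      qed
      from continuous_map_limit[OF f(1) this] show "(\<lambda>n. f (An n x)) \<longlonglongrightarrow> f (A x)"
        by (simp add: comp_def)
    qed
  qed
  moreover have "(\<integral>x. f x \<partial>(distr ?P ?B (An n))) = (\<integral>x. f (An n x) \<partial>?P)" for n
    by (rule integral_distr[OF n2 fm])
  moreover have "(\<integral>x. f x \<partial>(distr ?P ?B A)) = (\<integral>x. f (A x) \<partial>?P)"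
    by (rule integral_distr[OF D(2) fm])
  ultimately show ?thesis by (simp add: n1 D)
qed

end

section \<open>Choice of subsequences and conclusion\<close>

lemma (in sampled_limit) subsequence:
  assumes r: "strict_mono r"
  shows "sampled_limit \<Omega> (\<lambda>n. V (r n)) (\<lambda>n. d (r n)) (\<lambda>n. z (r n)) (\<lambda>n. X (r n)) \<phi> e"
proof unfold_locales
  fix \<omega> i j assume "\<omega> \<in> space \<Omega>"
  then show "(\<lambda>n. d (r n) (X (r n) \<omega>) (z (r n) i)) \<longlonglongrightarrow> \<phi> i \<omega>"
    using LIMSEQ_subseq_LIMSEQ[OF lim_\<phi> r] by (simp add: comp_def)
next
  fix i j show "(\<lambda>n. d (r n) (z (r n) i) (z (r n) j)) \<longlonglongrightarrow> e i j"
    using LIMSEQ_subseq_LIMSEQ[OF lim_e r] by (simp add: comp_def)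
qed (auto simp: V d z X X_law greedy)

text \<open>Convergence in mean gives almost sure convergence along a subsequence, and convergence
  of the coordinates to \<open>\<phi>\<close> and \<open>e\<close> is inherited by it.\<close>

lemma (in sampled_limit) AE_subsequence:
  obtains r :: "nat \<Rightarrow> nat" where "strict_mono r"
    "AE p in \<Omega> \<Otimes>\<^sub>M \<Omega>.
      (\<lambda>n. d (r n) (X (r n) (fst p)) (X (r n) (snd p))) \<longlonglongrightarrow> limit_dist (fst p) (snd p)"
proof -
  interpret P: pair_prob_space \<Omega> \<Omega> ..
  let ?u = "\<lambda>n p. d n (X n (fst p)) (X n (snd p)) - limit_dist (fst p) (snd p)"
  have [measurable]: "(\<lambda>p. d n (X n (fst p)) (X n (snd p))) \<in> borel_measurable (\<Omega> \<Otimes>\<^sub>M \<Omega>)" for n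
    by (rule X_pair_measurable)
  have "\<bar>?u n p\<bar> \<le> 4" if "p \<in> space (\<Omega> \<Otimes>\<^sub>M \<Omega>)" for n p
  proof -
    have "fst p \<in> space \<Omega>" "snd p \<in> space \<Omega>" using that by (auto simp: space_pair_measure)
    then show ?thesis
      using limit_dist_bound[OF that] tree_pseudometric_simps(3,4)[OF d XV XV, of "fst p" "snd p" n]
      by linarith
  qed
  then have int: "integrable (\<Omega> \<Otimes>\<^sub>M \<Omega>) (?u n)" for n
    by (intro P.integrable_const_bound[of _ 4]) (auto intro!: AE_I2)
  have "(\<lambda>n. \<integral>p. norm (?u n p) \<partial>(\<Omega> \<Otimes>\<^sub>M \<Omega>)) \<longlonglongrightarrow> 0"
    using dist_converges_L1 by simp
  from tendsto_L1_AE_subseq[OF int this] obtain r :: "nat \<Rightarrow> nat" where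
    r: "strict_mono r" "AE p in \<Omega> \<Otimes>\<^sub>M \<Omega>. (\<lambda>n. ?u (r n) p) \<longlonglongrightarrow> 0"
    by blast
  then show ?thesis by (intro that[OF r(1)]) (simp add: LIM_zero_iff)
qed

lemma sampled_limit_exists:
  fixes V :: "nat \<Rightarrow> 'a set"
  assumes V: "\<And>n. finite (V n)" "\<And>n. V n \<noteq> {}" and d: "\<And>n. tree_pseudometric (V n) (d n)"
  obtains s :: "nat \<Rightarrow> nat" and \<Omega> :: "real measure" and z X \<phi> e where "strict_mono s"
    "sampled_limit \<Omega> (\<lambda>n. V (s n)) (\<lambda>n. d (s n)) z X \<phi> e"
proof -
  define err where "err n z M = (\<Sum>x\<in>V n. \<Sum>y\<in>V n. \<bar>d n x y - hull_dist M
          (\<lambda>i. d n x (z i)) (hull_height M (\<lambda>i. d n x (z i)) (\<lambda>i j. d n (z i) (z j)))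
          (\<lambda>i. d n y (z i)) (hull_height M (\<lambda>i. d n y (z i)) (\<lambda>i j. d n (z i) (z j)))\<bar>)"
    for n M and z :: "nat \<Rightarrow> 'a"
  define avg where "avg n z M = (\<Sum>x\<in>V n. hull_height M (\<lambda>i. d n x (z i)) (\<lambda>i j. d n (z i) (z j)))"
    for n M and z :: "nat \<Rightarrow> 'a"
  have "\<exists>z. (\<forall>i. z i \<in> V n) \<and>
      (\<forall>M. err n z M \<le> 4 * (real (card (V n)) * (avg n z M - avg n z (Suc M))))" for n
    unfolding err_def avg_def by (rule greedy_spanning_points[OF d V]) blast
  then obtain z where z: "\<And>n i. z n i \<in> V n"
    and greedy: "\<And>n M. err n (z n) M \<le> 4 * (real (card (V n)) * (avg n (z n) M - avg n (z n) (Suc M)))"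
    by metis
  \<comment> \<open>Even places hold the distances to the spanning points. Odd places hold the
    mutual distances of these points as functions constant in \<open>x\<close>, so that a single
    compactness argument handles both.\<close>
  define \<psi> where "\<psi> n j x = (if even j then d n x (z n (j div 2))
      else d n (z n (fst (prod_decode (j div 2)))) (z n (snd (prod_decode (j div 2)))))" for n j x
  have "0 \<le> \<psi> n j x \<and> \<psi> n j x \<le> 1" if "x \<in> V n" for n j x
    using tree_pseudometric_simps(3,4)[OF d that z[of n "j div 2"]]
      tree_pseudometric_simps(3,4)[OF d z[of n "fst (prod_decode (j div 2))"] z[of n "snd (prod_decode (j div 2))"]]
    by (cases "even j") (simp_all add: \<psi>_def)
  from uniform_coordinates_limit[of V \<psi>, OF V this]
  obtain s :: "nat \<Rightarrow> nat" and \<Omega> :: "real measure" and X \<Phi> where s: "strict_mono s"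
    and \<Omega>: "prob_space \<Omega>" and X: "\<And>n. X n \<in> \<Omega> \<rightarrow>\<^sub>M count_space (V (s n))"
    "\<And>n. distr \<Omega> (count_space (V (s n))) (X n) = uniform_count_measure (V (s n))"
    and \<Phi>: "\<And>j. \<Phi> j \<in> borel_measurable \<Omega>"
    "\<And>\<omega> j. \<omega> \<in> space \<Omega> \<Longrightarrow> (\<lambda>n. \<psi> (s n) j (X n \<omega>)) \<longlonglongrightarrow> \<Phi> j \<omega>"
    by blast
  interpret prob_space \<Omega> by fact
  obtain \<omega>0 where \<omega>0: "\<omega>0 \<in> space \<Omega>" using not_empty by blast
  \<comment> \<open>The odd coordinates do not depend on the vertex, so any sample point may be used
    to read off their limits.\<close>
  define e where "e i j = \<Phi> (2 * prod_encode (i, j) + 1) \<omega>0" for i j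
  have "sampled_limit \<Omega> (\<lambda>n. V (s n)) (\<lambda>n. d (s n)) (\<lambda>n. z (s n)) X (\<lambda>i. \<Phi> (2 * i)) e"
  proof unfold_locales
    fix \<omega> i assume "\<omega> \<in> space \<Omega>"
    then show "(\<lambda>n. d (s n) (X n \<omega>) (z (s n) i)) \<longlonglongrightarrow> \<Phi> (2 * i) \<omega>"
      using \<Phi>(2)[of \<omega> "2 * i"] by (simp add: \<psi>_def)
  next
    fix i j show "(\<lambda>n. d (s n) (z (s n) i) (z (s n) j)) \<longlonglongrightarrow> e i j"
      using \<Phi>(2)[OF \<omega>0, of "2 * prod_encode (i, j) + 1"] by (simp add: \<psi>_def e_def)
  qed (auto simp: V d z X \<Phi>(1) greedy[unfolded err_def avg_def])
  with s show ?thesis by (rule that)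
qed

theorem tree_sampling_dendron_subsequence:
  fixes T :: "nat \<Rightarrow> 'a pair_pre_digraph"
  assumes T: "\<And>n. nontrivial_tree (T n)"
  shows "\<exists>s (D :: (nat \<Rightarrow> real) metric) \<nu>. strict_mono s \<and> dendron D \<nu> \<and>
    (\<forall>r. weakly_converges (matrix_space r) (\<lambda>n. tree_sampling r (T (s n))) (dendron_sampling r D \<nu>))"
proof -
  have V: "finite (pverts (T n))" "pverts (T n) \<noteq> {}" for n
    using T[of n] pair_fin_digraph.pair_finite_verts
    by (auto simp: nontrivial_tree_def finite_tree_def pair_graph_def pair_digraph_def)
  obtain s :: "nat \<Rightarrow> nat" and \<Omega> :: "real measure" and z X \<phi> e where s: "strict_mono s"
    and limit: "sampled_limit \<Omega> (\<lambda>n. pverts (T (s n))) (\<lambda>n. tree_dist (T (s n))) z X \<phi> e"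
    using sampled_limit_exists[of "\<lambda>n. pverts (T n)" "\<lambda>n. tree_dist (T n)",
        OF V tree_pseudometric_tree_dist[OF T]] by blast
  interpret L: sampled_limit \<Omega> "\<lambda>n. pverts (T (s n))" "\<lambda>n. tree_dist (T (s n))" z X \<phi> e
    by (rule limit)
  obtain r :: "nat \<Rightarrow> nat" where r: "strict_mono r"
    and AE: "AE p in \<Omega> \<Otimes>\<^sub>M \<Omega>. (\<lambda>n. tree_dist (T (s (r n))) (X (r n) (fst p)) (X (r n) (snd p)))
      \<longlonglongrightarrow> L.limit_dist (fst p) (snd p)"
    by (rule L.AE_subsequence)
  obtain w :: "nat \<Rightarrow> real" where w: "\<And>k. w k \<in> space \<Omega>"
    "\<And>k r. 0 < r \<Longrightarrow> 0 < emeasure \<Omega> {\<omega> \<in> space \<Omega>. sup_dist (L.foot \<omega>) (L.foot (w k)) < r}"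
    "AE \<omega> in \<Omega>. \<forall>r>0. \<exists>k. sup_dist (L.foot \<omega>) (L.foot (w k)) < r"
    by (rule L.foot_support) blast
  interpret sampled_dendron \<Omega> "\<lambda>n. pverts (T (s (r n)))" "\<lambda>n. tree_dist (T (s (r n)))" "\<lambda>n. z (r n)"
    "\<lambda>n. X (r n)" \<phi> e w
    by (intro sampled_dendron.intro sampled_dendron_axioms.intro L.subsequence[OF r] w AE)
  have "weakly_converges (matrix_space m) (\<lambda>n. tree_sampling m (T (s (r n))))
      (dendron_sampling m S.span_metric \<nu>)" for m
    unfolding weakly_converges_def
    using tree_sampling_in_borel_probs[OF T] dendron_sampling_in_borel_probs sampling_converges[of m]
    by (simp add: tree_sampling_def)
  then show ?thesis
    using strict_mono_o[OF s r] dendron_\<nu> unfolding comp_def by blast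
qed

theorem theorem1:
  fixes T :: "nat \<Rightarrow> 'a pair_pre_digraph"
  assumes "\<And>n. nontrivial_tree (T n)"
    and "\<And>r. r \<ge> 1 \<Longrightarrow> \<exists>L. weakly_converges (matrix_space r) (\<lambda>n. tree_sampling r (T n)) L"
  shows "\<exists>(D :: (nat \<Rightarrow> real) metric) \<nu>. dendron D \<nu> \<and>
           (\<forall>r\<ge>1. weakly_converges (matrix_space r) (\<lambda>n. tree_sampling r (T n))
                     (dendron_sampling r D \<nu>))"
proof -
  obtain s :: "nat \<Rightarrow> nat" and D :: "(nat \<Rightarrow> real) metric" and \<nu> where s: "strict_mono s"
    and D: "dendron D \<nu>"
    and conv: "\<And>r. weakly_converges (matrix_space r) (\<lambda>n. tree_sampling r (T (s n))) (dendron_sampling r D \<nu>)"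
    using tree_sampling_dendron_subsequence[of T] assms(1) by auto
  have "weakly_converges (matrix_space r) (\<lambda>n. tree_sampling r (T n)) (dendron_sampling r D \<nu>)"
    if r: "1 \<le> r" for r
    unfolding weakly_converges_def
  proof (intro conjI allI impI)
    show "tree_sampling r (T n) \<in> borel_probs (matrix_space r)" for n
      by (rule tree_sampling_in_borel_probs[OF assms(1)])
    show "dendron_sampling r D \<nu> \<in> borel_probs (matrix_space r)"
      using conv[of r] by (simp add: weakly_converges_def)
    fix f assume f: "continuous_map (matrix_space r) euclideanreal f \<and> bounded (f ` topspace (matrix_space r))"
    obtain L where "weakly_converges (matrix_space r) (\<lambda>n. tree_sampling r (T n)) L"
      using assms(2)[OF r] by blast
    then have L: "(\<lambda>n. \<integral>x. f x \<partial>tree_sampling r (T n)) \<longlonglongrightarrow> (\<integral>x. f x \<partial>L)"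
      using f by (simp add: weakly_converges_def)
    \<comment> \<open>The two limits are compared for each test function separately, so the measures
      themselves need not be identified.\<close>
    have "(\<lambda>n. \<integral>x. f x \<partial>tree_sampling r (T (s n))) \<longlonglongrightarrow> (\<integral>x. f x \<partial>L)"
      using LIMSEQ_subseq_LIMSEQ[OF L s] by (simp add: comp_def)
    moreover have "(\<lambda>n. \<integral>x. f x \<partial>tree_sampling r (T (s n))) \<longlonglongrightarrow> (\<integral>x. f x \<partial>dendron_sampling r D \<nu>)"
      using conv[of r] f by (simp add: weakly_converges_def)
    ultimately have "(\<integral>x. f x \<partial>L) = (\<integral>x. f x \<partial>dendron_sampling r D \<nu>)"
      by (rule LIMSEQ_unique)
    then show "(\<lambda>n. \<integral>x. f x \<partial>tree_sampling r (T n)) \<longlonglongrightarrow> (\<integral>x. f x \<partial>dendron_sampling r D \<nu>)"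
      using L by simp
  qed
  with D show ?thesis by blast
qed

end
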